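(* Let $G=\mathbb F_d*G_1*\cdots*G_m$ with generating set $S$, and let $(X_n)_{n\ge0}$ be a quasi-irreducible nearest-neighbour coloured random walk on $G\times[r]$ defined by matrices $(p_g)_{g\in S}$. With $X_\infty$, $X_\infty^{(n)}$, $u_n$, $p^\infty_u$, $\mu_g$ and $\Delta_g$ as defined in the context, for every starting colour $u\in[r]$, every $n\ge1$, every $v\in[r]$ and every cylinder $\xi_1\cdots\xi_n$ (that is, $\xi_i\in S$ and $\xi_{i+1}\in\mathrm{Next}(\xi_i)$ for $1\le i<n$), $$\mathbb P_u\big[X_\infty^{(n)}=\xi_1\cdots\xi_n,\ u_n=v\big]=\mathbf 1_u^{\top}\,\mu_{\xi_1}\Delta_{\xi_1}^{-1}\mu_{\xi_2}\cdots\Delta_{\xi_{n-1}}^{-1}\mu_{\xi_n}\,\mathbf 1_v$$ and $$p^\infty_u(\xi_1\cdots\xi_n)=\mathbf 1_u^{\top}\,\mu_{\xi_1}\Delta_{\xi_1}^{-1}\mu_{\xi_2}\cdots\Delta_{\xi_{n-1}}^{-1}\mu_{\xi_n}\,\mathbf 1 .$$ Moreover, the family $\mu=(\mu_g)_{g\in S}$ is the unique family $x=(x_g)_{g\in S}$ of $r\times r$ matrices with non-negative entries such that $\sum_{g\in S}x_g$ is a stochastic matrix and $$x_g=p_g\,\Delta(x)_g+\sum_{\substack{h,h'\in S\\ hh'=g}}p_h\,x_{h'}+\sum_{h\in\mathrm{Next}(g)}p_{h^{-1}}\,x_h\,\Delta(x)_h^{-1}\,x_g\qquad\text{for all } g\in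 S,$$ where $\Delta(x)_g$ is the diagonal matrix with entries $\Delta(x)_g(u,u)=\sum_{h\in\mathrm{Next}(g)}\sum_{v\in[r]}x_h(u,v)$, $u\in[r]$.
   Context: Group: $\mathbb F_d$ is the free group on $a_1,\dots,a_d$; $G_1,\dots,G_m$ are finite groups; $G=\mathbb F_d*G_1*\cdots*G_m$ has identity $e$ and generating set $S=\bigcup_{i=1}^d\{a_i,a_i^{-1}\}\cup\bigsqcup_{j=1}^m S_j$ with $S_j=G_j\setminus\{e\}$. $G$ is assumed not isomorphic to $\mathbb Z$ or $\mathbb Z/2\mathbb Z*\mathbb Z/2\mathbb Z$. For $g\in S$, $\mathrm{Next}(g)=S\setminus\{g^{-1}\}$ if $g\in\mathbb F_d$, and $\mathrm{Next}(g)=S\setminus S_j$ if $g\in S_j$. Every $g\in G$ is uniquely a reduced word $g_1\cdots g_n$ with $g_i\in S$, $g_{i+1}\in\mathrm{Next}(g_i)$. Coloured random walk: $[r]=\{1,\dots,r\}$; $(p_g)_{g\in G}$ are $r\times r$ matrices with non-negative entries such that $P=\sum_gp_g$ is stochastic; $(X_n)$ is the Markov chain on $G\times[r]$ with transition probability $p_{g^{-1}h}(u,v)$ from $(g,u)$ to $(h,v)$. Its support is $\{g:p_g\neq0\}$; nearest-neighbour means support contained in $S$; quasi-irreducible means that the support generates $G$ and $P$ is irreducible. $\mathbb P_u=\mathbb P_{(e,u)}$ is the law of the walk started at $(e,u)$. Boundary: $\partial G$ is the set of infinite words $\xi_1\xi_2\cdots$ with $\xi_i\in S$, $\xi_{i+1}\in\mathrm{Next}(\xi_i)$,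 with the product topology and $\sigma$-algebra; $G$ acts on it by left multiplication followed by reduction. $g\cdot\nu$ is the image of a measure $\nu$ under $\xi\mapsto g\xi$. A family $(\nu_u)_{u\in[r]}$ of probability measures on $\partial G$ is stationary if $\nu_u=\sum_{g\in G,v\in[r]}p_g(u,v)\,g\cdot\nu_v$ for all $u$. Taken as given (stated separately in the paper): $X_n$ (its $G$-coordinate) converges a.s. to a random variable $X_\infty\in\partial G$, and its law $p^\infty_u$ under $\mathbb P_u$ (the harmonic measure) gives the unique stationary family $(p^\infty_u)_{u\in[r]}$. $p^\infty_u(\xi_1\cdots\xi_n)$ is the mass of the cylinder of infinite words with prefix $\xi_1\cdots\xi_n$. $X_\infty^{(n)}$ is the word formed by the first $n$ letters of $X_\infty$. For $g\in G$, $\tau_g=\inf\{n\ge0:X_n\in\{g\}\times[r]\}$; $u_n$ is the colour of the walk at time $\tau_{X_\infty^{(n)}}$. For $g\in S$, $\mu_g(u,v)=\mathbb P_{(e,u)}[X_\infty^{(1)}=g,\ X_{\tau_g}=(g,v)]$, and $\Delta_g=\Delta(\mu)_g$ is the diagonal matrix with $\Delta_g(u,u)=\sum_{h\in\mathrm{Next}(g)}\sum_{v\in[r]}\mu_h(u,v)$. $\mathbf 1\in\mathbb R^r$ is the all-ones vector and $\mathbf 1_u$ is the indicator vector of $u$. *)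

theory Defs
  imports "HOL-Probability.Probability" "HOL-Algebra.Elementary_Groups"
begin

section \<open>The free product of a free group and finitely many groups\<close>

text \<open>
  The letters \<open>Gen i\<close> and \<open>GenInv i\<close> stand for \<open>a\<^sub>i\<close> and its inverse, the letter \<open>Elt j x\<close> for the
  element \<open>x\<close> of the factor \<open>G\<^sub>j\<close>, which is the group \<open>H j\<close>.
\<close>

datatype 'b letter = Gen nat | GenInv nat | Elt nat 'b

definition factor_letters :: "(nat \<Rightarrow> 'b monoid) \<Rightarrow> nat \<Rightarrow> 'b letter set" where
  "factor_letters H j = Elt j ` (carrier (H j) - {\<one>\<^bsub>H j\<^esub>})"

definition letters :: "nat \<Rightarrow> nat \<Rightarrow> (nat \<Rightarrow> 'b monoid) \<Rightarrow> 'b letter set" where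
  "letters d m H = (\<Union>i\<in>{1..d}. {Gen i, GenInv i}) \<union> (\<Union>j\<in>{1..m}. factor_letters H j)"

fun Next :: "nat \<Rightarrow> nat \<Rightarrow> (nat \<Rightarrow> 'b monoid) \<Rightarrow> 'b letter \<Rightarrow> 'b letter set" where
  "Next d m H (Gen i) = letters d m H - {GenInv i}"
| "Next d m H (GenInv i) = letters d m H - {Gen i}"
| "Next d m H (Elt j x) = letters d m H - factor_letters H j"

definition reduced :: "nat \<Rightarrow> nat \<Rightarrow> (nat \<Rightarrow> 'b monoid) \<Rightarrow> 'b letter list \<Rightarrow> bool" where
  "reduced d m H w \<longleftrightarrow>
     set w \<subseteq> letters d m H \<and> successively (\<lambda>g h. h \<in> Next d m H g) w"

text \<open>\<open>push H s w\<close> is the reduction of \<open>s w\<close>, for a letter \<open>s\<close> and a reduced word \<open>w\<close>.\<close>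

fun push :: "(nat \<Rightarrow> 'b monoid) \<Rightarrow> 'b letter \<Rightarrow> 'b letter list \<Rightarrow> 'b letter list" where
  "push H s [] = [s]"
| "push H (Gen i) (t # w) = (if t = GenInv i then w else Gen i # t # w)"
| "push H (GenInv i) (t # w) = (if t = Gen i then w else GenInv i # t # w)"
| "push H (Elt j x) (t # w) =
    (case t of
       Elt k y \<Rightarrow>
         if k \<noteq> j then Elt j x # t # w
         else if x \<otimes>\<^bsub>H j\<^esub> y = \<one>\<^bsub>H j\<^esub> then w
         else Elt j (x \<otimes>\<^bsub>H j\<^esub> y) # w
     | _ \<Rightarrow> Elt j x # t # w)"

definition free_product :: "nat \<Rightarrow> nat \<Rightarrow> (nat \<Rightarrow> 'b monoid) \<Rightarrow> 'b letter list monoid" where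
  "free_product d m H =
     \<lparr>carrier = {w. reduced d m H w}, monoid.mult = (\<lambda>v w. foldr (push H) v w), one = []\<rparr>"

fun letter_inv :: "(nat \<Rightarrow> 'b monoid) \<Rightarrow> 'b letter \<Rightarrow> 'b letter" where
  "letter_inv H (Gen i) = GenInv i"
| "letter_inv H (GenInv i) = Gen i"
| "letter_inv H (Elt j x) = Elt j (inv\<^bsub>H j\<^esub> x)"

lemma reduced_Nil [simp]: "reduced d m H []"
  by (simp add: reduced_def)

lemma reduced_Cons:
  "reduced d m H (s # w) \<longleftrightarrow>
     s \<in> letters d m H \<and> (w = [] \<or> hd w \<in> Next d m H s) \<and> reduced d m H w"
  by (auto simp: reduced_def successively_Cons)

lemma Gen_in_letters [simp]:
  "Gen i \<in> letters d m H \<longleftrightarrow> i \<in> {1..d}"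
  "GenInv i \<in> letters d m H \<longleftrightarrow> i \<in> {1..d}"
  by (auto simp: letters_def factor_letters_def)

lemma Elt_in_letters [simp]:
  "Elt j x \<in> letters d m H \<longleftrightarrow> j \<in> {1..m} \<and> x \<in> carrier (H j) \<and> x \<noteq> \<one>\<^bsub>H j\<^esub>"
  by (auto simp: letters_def factor_letters_def)

lemma factor_letters_iff [simp]:
  "Gen i \<notin> factor_letters H j"
  "GenInv i \<notin> factor_letters H j"
  "Elt k x \<in> factor_letters H j \<longleftrightarrow> k = j \<and> x \<in> carrier (H j) \<and> x \<noteq> \<one>\<^bsub>H j\<^esub>"
  by (auto simp: factor_letters_def)

context
  fixes d m :: nat and H :: "nat \<Rightarrow> 'b monoid"
  assumes H: "\<And>j. j \<in> {1..m} \<Longrightarrow> group (H j)"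
begin

lemma reduced_push:
  assumes "s \<in> letters d m H" "reduced d m H w"
  shows "reduced d m H (push H s w)"
proof (cases w)
  case Nil
  then show ?thesis using assms by (simp add: reduced_Cons)
next
  case (Cons t v)
  show ?thesis
  proof (cases s)
    case (Elt j x)
    then interpret group "H j" using assms H by auto
    show ?thesis
    proof (cases t)
      case (Elt k y)
      then show ?thesis using Cons assms \<open>s = Elt j x\<close> by (auto simp: reduced_Cons)
    qed (use Cons assms Elt in \<open>auto simp: reduced_Cons\<close>)
  qed (use Cons assms in \<open>auto simp: reduced_Cons\<close>)
qed

lemma reduced_foldr_push:
  "set v \<subseteq> letters d m H \<Longrightarrow> reduced d m H w \<Longrightarrow> reduced d m H (foldr (push H) v w)"
  by (induction v) (auto intro: reduced_push)

lemma push_Elt_Elt: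
  assumes "Elt j x \<in> letters d m H" "Elt j y \<in> letters d m H" "reduced d m H w"
  shows "push H (Elt j x) (push H (Elt j y) w) =
    (if x \<otimes>\<^bsub>H j\<^esub> y = \<one>\<^bsub>H j\<^esub> then w else push H (Elt j (x \<otimes>\<^bsub>H j\<^esub> y)) w)"
proof -
  interpret group "H j" using assms(1) H by auto
  have x: "x \<in> carrier (H j)" "x \<noteq> \<one>\<^bsub>H j\<^esub>" and y: "y \<in> carrier (H j)" "y \<noteq> \<one>\<^bsub>H j\<^esub>"
    using assms by auto
  show ?thesis
  proof (cases "\<exists>z v. w = Elt j z # v")
    case False
    then show ?thesis by (cases w; cases "hd w") auto
  next
    case True
    then obtain z v where w: "w = Elt j z # v" by blast
    have z: "z \<in> carrier (H j)" "z \<noteq> \<one>\<^bsub>H j\<^esub>" and v: "v = [] \<or> hd v \<notin> factor_letters H j"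
      "reduced d m H v"
      using assms(3) w by (auto simp: reduced_Cons)
    have tail: "push H (Elt j a) v = Elt j a # v" for a
    proof (cases v)
      case (Cons t v')
      then show ?thesis using v by (cases t) (auto simp: reduced_Cons)
    qed simp
    have a: "(x \<otimes>\<^bsub>H j\<^esub> y) \<otimes>\<^bsub>H j\<^esub> z = x \<otimes>\<^bsub>H j\<^esub> (y \<otimes>\<^bsub>H j\<^esub> z)"
      using x y z by (simp add: m_assoc)
    show ?thesis
    proof (cases "y \<otimes>\<^bsub>H j\<^esub> z = \<one>\<^bsub>H j\<^esub>")
      case yz: True
      have xyz: "(x \<otimes>\<^bsub>H j\<^esub> y) \<otimes>\<^bsub>H j\<^esub> z = x" using a yz x by simp
      have "z = x" if "x \<otimes>\<^bsub>H j\<^esub> y = \<one>\<^bsub>H j\<^esub>"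
        using xyz z that by simp
      then show ?thesis using w yz xyz x tail by auto
    next
      case yz: False
      have "x \<otimes>\<^bsub>H j\<^esub> (y \<otimes>\<^bsub>H j\<^esub> z) = z" if "x \<otimes>\<^bsub>H j\<^esub> y = \<one>\<^bsub>H j\<^esub>"
        using a that z by simp
      then show ?thesis using w yz a z by auto
    qed
  qed
qed

lemma push_push_inv:
  assumes "s \<in> letters d m H" "t \<in> letters d m H" "reduced d m H w" "t = letter_inv H s"
  shows "push H s (push H t w) = w"
proof (cases s)
  case (Elt j x)
  then interpret group "H j" using assms(1) H by auto
  show ?thesis using Elt assms push_Elt_Elt[of j x "inv\<^bsub>H j\<^esub> x" w] by auto
next
  case (Gen i)
  then show ?thesis using assms by (cases w; cases "tl w") (auto simp: reduced_Cons)
next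
  case (GenInv i)
  then show ?thesis using assms by (cases w; cases "tl w") (auto simp: reduced_Cons)
qed

lemma foldr_push_push:
  assumes s: "s \<in> letters d m H" and v: "reduced d m H v" and w: "reduced d m H w"
  shows "foldr (push H) (push H s v) w = push H s (foldr (push H) v w)"
proof (cases v)
  case (Cons t v')
  have v': "reduced d m H v'" "t \<in> letters d m H" using v Cons by (auto simp: reduced_Cons)
  then have r: "reduced d m H (foldr (push H) v' w)"
    using w by (intro reduced_foldr_push) (auto simp: reduced_def)
  show ?thesis
  proof (cases s)
    case (Elt j x)
    show ?thesis
    proof (cases t)
      case (Elt k y)
      show ?thesis
        using push_Elt_Elt[of j x y "foldr (push H) v' w"] r v' s Cons Elt \<open>s = Elt j x\<close>
        by auto
    qed (use Cons Elt in auto)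
  next
    case (Gen i)
    then show ?thesis using push_push_inv[of s t "foldr (push H) v' w"] s v' r Cons by auto
  next
    case (GenInv i)
    then show ?thesis using push_push_inv[of s t "foldr (push H) v' w"] s v' r Cons by auto
  qed
qed simp

lemma letter_inv_letters:
  assumes "s \<in> letters d m H"
  shows "letter_inv H s \<in> letters d m H" "letter_inv H (letter_inv H s) = s"
proof -
  have "letter_inv H s \<in> letters d m H \<and> letter_inv H (letter_inv H s) = s"
  proof (cases s)
    case (Elt j x)
    then interpret group "H j" using assms(1) H by auto
    show ?thesis using Elt assms inv_eq_1_iff by auto
  qed (use assms in auto)
  then show "letter_inv H s \<in> letters d m H" "letter_inv H (letter_inv H s) = s" by auto
qed

lemma group_free_product: "group (free_product d m H)"
proof (rule groupI)
  fix u v w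
  assume "u \<in> carrier (free_product d m H)" "v \<in> carrier (free_product d m H)"
    "w \<in> carrier (free_product d m H)"
  then have u: "set u \<subseteq> letters d m H" and v: "reduced d m H v" and w: "reduced d m H w"
    by (auto simp: free_product_def reduced_def)
  have "foldr (push H) (foldr (push H) u v) w = foldr (push H) u (foldr (push H) v w)"
    using u by (induction u) (auto simp: foldr_push_push reduced_foldr_push v w)
  then show "u \<otimes>\<^bsub>free_product d m H\<^esub> v \<otimes>\<^bsub>free_product d m H\<^esub> w =
      u \<otimes>\<^bsub>free_product d m H\<^esub> (v \<otimes>\<^bsub>free_product d m H\<^esub> w)"
    by (simp add: free_product_def)
next
  fix w
  assume "w \<in> carrier (free_product d m H)"
  then have w: "reduced d m H w" by (simp add: free_product_def)
  define v where "v = rev (map (letter_inv H) w)"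
  have sv: "set v \<subseteq> letters d m H"
    using w letter_inv_letters by (auto simp: v_def reduced_def)
  have *: "foldr (push H) (rev (map (letter_inv H) w)) w = []" using w
  proof (induction w)
    case (Cons s w)
    have s: "s \<in> letters d m H" and w: "reduced d m H w"
      using Cons.prems by (auto simp: reduced_Cons)
    have "s # w = push H s w"
    proof (cases w)
      case Nil
      then show ?thesis by simp
    next
      case (Cons t v)
      then show ?thesis using \<open>reduced d m H (s # w)\<close>
        by (cases s; cases t) (auto simp: reduced_Cons)
    qed
    then have "push H (letter_inv H s) (s # w) = w"
      using push_push_inv[of "letter_inv H s" s w] s w letter_inv_letters[OF s] by auto
    then show ?case using Cons.IH w by simp
  qed simp
  define v' where "v' = foldr (push H) v []"
  have v': "reduced d m H v'" using sv by (simp add: v'_def reduced_foldr_push)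
  have "foldr (push H) (foldr (push H) u []) w = foldr (push H) u w" if "set u \<subseteq> letters d m H" for u
    using that by (induction u) (auto simp: foldr_push_push reduced_foldr_push w)
  then have "foldr (push H) v' w = []" using * sv by (simp add: v'_def v_def)
  then show "\<exists>y\<in>carrier (free_product d m H). y \<otimes>\<^bsub>free_product d m H\<^esub> w = \<one>\<^bsub>free_product d m H\<^esub>"
    using v' by (auto simp: free_product_def)
qed (auto simp: free_product_def reduced_foldr_push reduced_def[symmetric] intro!: reduced_foldr_push,
     auto simp: reduced_def)

end


section \<open>The boundary\<close>

definition boundary :: "nat \<Rightarrow> nat \<Rightarrow> (nat \<Rightarrow> 'b monoid) \<Rightarrow> 'b letter stream set" where
  "boundary d m H = {\<xi>. \<forall>i. \<xi> !! i \<in> letters d m H \<and> \<xi> !! Suc i \<in> Next d m H (\<xi> !! i)}"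

definition boundary_space :: "nat \<Rightarrow> nat \<Rightarrow> (nat \<Rightarrow> 'b monoid) \<Rightarrow> 'b letter stream measure" where
  "boundary_space d m H = restrict_space (stream_space (count_space UNIV)) (boundary d m H)"

text \<open>
  Reducing \<open>s \<xi>\<close> for a letter \<open>s\<close> and an infinite reduced word \<open>\<xi>\<close> only affects the first letter
  of \<open>\<xi>\<close>.
\<close>

definition act :: "(nat \<Rightarrow> 'b monoid) \<Rightarrow> 'b letter list \<Rightarrow> 'b letter stream \<Rightarrow> 'b letter stream" where
  "act H g \<xi> = foldr (\<lambda>s \<xi>. push H s [shd \<xi>] @- stl \<xi>) g \<xi>"

definition cylinder ::
    "nat \<Rightarrow> nat \<Rightarrow> (nat \<Rightarrow> 'b monoid) \<Rightarrow> 'b letter list \<Rightarrow> 'b letter stream set" where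
  "cylinder d m H w = {\<xi> \<in> boundary d m H. stake (length w) \<xi> = w}"

definition converges_to :: "(nat \<Rightarrow> 'b letter list) \<Rightarrow> 'b letter stream \<Rightarrow> bool" where
  "converges_to w \<xi> \<longleftrightarrow> (\<forall>k. \<forall>\<^sub>F n in sequentially. take k (w n) = stake k \<xi>)"

text \<open>Sequences that do not converge get an arbitrary point of the boundary as their limit.\<close>

definition boundary_limit ::
    "nat \<Rightarrow> nat \<Rightarrow> (nat \<Rightarrow> 'b monoid) \<Rightarrow> (nat \<Rightarrow> 'b letter list) \<Rightarrow> 'b letter stream" where
  "boundary_limit d m H w =
     (if \<exists>\<xi>\<in>boundary d m H. converges_to w \<xi>
      then THE \<xi>. \<xi> \<in> boundary d m H \<and> converges_to w \<xi>
      else SOME \<xi>. \<xi> \<in> boundary d m H)"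


section \<open>Coloured random walks\<close>

definition stochastic :: "real^'r^'r \<Rightarrow> bool" where
  "stochastic A \<longleftrightarrow> (\<forall>u v. 0 \<le> A $ u $ v) \<and> (\<forall>u. (\<Sum>v\<in>UNIV. A $ u $ v) = 1)"

definition irreducible_matrix :: "real^'r^'r \<Rightarrow> bool" where
  "irreducible_matrix A \<longleftrightarrow> (\<forall>u v. \<exists>n. ((\<lambda>B. A ** B) ^^ n) (mat 1) $ u $ v > 0)"

definition supp :: "('g, 'x) monoid_scheme \<Rightarrow> ('g \<Rightarrow> real^'r^'r) \<Rightarrow> 'g set" where
  "supp G p = {g \<in> carrier G. p g \<noteq> 0}"

text \<open>For walks with finite support, such as the nearest-neighbour ones, this is \<open>\<Sum>\<^sub>g p\<^sub>g\<close>.\<close>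

definition total_matrix :: "('g, 'x) monoid_scheme \<Rightarrow> ('g \<Rightarrow> real^'r^'r) \<Rightarrow> real^'r^'r" where
  "total_matrix G p = (\<Sum>g\<in>supp G p. p g)"

definition coloured_walk :: "('g, 'x) monoid_scheme \<Rightarrow> ('g \<Rightarrow> real^'r^'r) \<Rightarrow> bool" where
  "coloured_walk G p \<longleftrightarrow>
     (\<forall>g\<in>carrier G. \<forall>u v. 0 \<le> p g $ u $ v) \<and> stochastic (total_matrix G p)"

definition nearest_neighbour ::
    "nat \<Rightarrow> nat \<Rightarrow> (nat \<Rightarrow> 'b monoid) \<Rightarrow> ('b letter list \<Rightarrow> real^'r^'r) \<Rightarrow> bool" where
  "nearest_neighbour d m H p \<longleftrightarrow> supp (free_product d m H) p \<subseteq> (\<lambda>s. [s]) ` letters d m H"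

text \<open>The support is only required to generate \<open>G\<close> as a group.\<close>

definition quasi_irreducible :: "('g, 'x) monoid_scheme \<Rightarrow> ('g \<Rightarrow> real^'r^'r) \<Rightarrow> bool" where
  "quasi_irreducible G p \<longleftrightarrow>
     generate G (supp G p) = carrier G \<and> irreducible_matrix (total_matrix G p)"

definition markov_chain ::
    "'w measure \<Rightarrow> (nat \<Rightarrow> 'w \<Rightarrow> 's) \<Rightarrow> 's set \<Rightarrow> ('s \<Rightarrow> 's \<Rightarrow> real) \<Rightarrow> 's \<Rightarrow> bool" where
  "markov_chain M X E K x0 \<longleftrightarrow>
     prob_space M \<and>
     (\<forall>n. X n \<in> measurable M (count_space E)) \<and>
     measure M {\<omega> \<in> space M. X 0 \<omega> = x0} = 1 \<and>
     (\<forall>n x. \<forall>y\<in>E.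
        measure M {\<omega> \<in> space M. (\<forall>i\<le>n. X i \<omega> = x i) \<and> X (Suc n) \<omega> = y} =
        measure M {\<omega> \<in> space M. \<forall>i\<le>n. X i \<omega> = x i} * K (x n) y)"

definition walk_law ::
    "('g, 'x) monoid_scheme \<Rightarrow> ('g \<Rightarrow> real^'r^'r) \<Rightarrow> 'w measure \<Rightarrow> (nat \<Rightarrow> 'w \<Rightarrow> 'g \<times> 'r) \<Rightarrow>
     'g \<times> 'r \<Rightarrow> bool" where
  "walk_law G p M X x0 \<longleftrightarrow>
     markov_chain M X (carrier G \<times> UNIV)
       (\<lambda>(g, u) (h, v). p (inv\<^bsub>G\<^esub> g \<otimes>\<^bsub>G\<^esub> h) $ u $ v) x0"

definition stationary_family ::
    "nat \<Rightarrow> nat \<Rightarrow> (nat \<Rightarrow> 'b monoid) \<Rightarrow> ('b letter list \<Rightarrow> real^'r^'r) \<Rightarrow>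
     ('r \<Rightarrow> 'b letter stream measure) \<Rightarrow> bool" where
  "stationary_family d m H p \<nu> \<longleftrightarrow>
     (\<forall>u. prob_space (\<nu> u) \<and> sets (\<nu> u) = sets (boundary_space d m H)) \<and>
     (\<forall>u. \<forall>A\<in>sets (boundary_space d m H).
        measure (\<nu> u) A =
        (\<Sum>g\<in>supp (free_product d m H) p. \<Sum>v\<in>UNIV.
           p g $ u $ v * measure (distr (\<nu> v) (boundary_space d m H) (act H g)) A))"

definition X_inf ::
    "nat \<Rightarrow> nat \<Rightarrow> (nat \<Rightarrow> 'b monoid) \<Rightarrow> (nat \<Rightarrow> 'w \<Rightarrow> 'b letter list \<times> 'r) \<Rightarrow> 'w \<Rightarrow> 'b letter stream" where
  "X_inf d m H X \<omega> = boundary_limit d m H (\<lambda>n. fst (X n \<omega>))"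

definition harmonic_measure ::
    "nat \<Rightarrow> nat \<Rightarrow> (nat \<Rightarrow> 'b monoid) \<Rightarrow> ('r \<Rightarrow> 'w measure) \<Rightarrow>
     (nat \<Rightarrow> 'w \<Rightarrow> 'b letter list \<times> 'r) \<Rightarrow> 'r \<Rightarrow> 'b letter stream measure" where
  "harmonic_measure d m H P X u = distr (P u) (boundary_space d m H) (X_inf d m H X)"

definition hitting_time :: "(nat \<Rightarrow> 'w \<Rightarrow> 'g \<times> 'r) \<Rightarrow> 'g \<Rightarrow> 'w \<Rightarrow> enat" where
  "hitting_time X g \<omega> = Inf (enat ` {n. fst (X n \<omega>) = g})"

text \<open>
  The colour \<open>u\<^sub>n\<close>; it is arbitrary on the event that the hitting time is infinite.
\<close>

definition hitting_colour ::
    "nat \<Rightarrow> nat \<Rightarrow> (nat \<Rightarrow> 'b monoid) \<Rightarrow> (nat \<Rightarrow> 'w \<Rightarrow> 'b letter list \<times> 'r) \<Rightarrow> nat \<Rightarrow> 'w \<Rightarrow> 'r" where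
  "hitting_colour d m H X n \<omega> =
     snd (X (the_enat (hitting_time X (stake n (X_inf d m H X \<omega>)) \<omega>)) \<omega>)"

definition mu ::
    "nat \<Rightarrow> nat \<Rightarrow> (nat \<Rightarrow> 'b monoid) \<Rightarrow> ('r \<Rightarrow> 'w measure) \<Rightarrow>
     (nat \<Rightarrow> 'w \<Rightarrow> 'b letter list \<times> 'r) \<Rightarrow> 'b letter \<Rightarrow> real^'r^'r" where
  "mu d m H P X g = (\<chi> u v.
     measure (P u) {\<omega> \<in> space (P u).
       stake 1 (X_inf d m H X \<omega>) = [g] \<and>
       hitting_time X [g] \<omega> \<noteq> \<infinity> \<and> X (the_enat (hitting_time X [g] \<omega>)) \<omega> = ([g], v)})"


section \<open>The matrix system\<close>

definition Delta ::
    "nat \<Rightarrow> nat \<Rightarrow> (nat \<Rightarrow> 'b monoid) \<Rightarrow> ('b letter \<Rightarrow> real^'r^'r) \<Rightarrow> 'b letter \<Rightarrow> real^'r^'r" where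
  "Delta d m H x g = (\<chi> u v. if u = v then \<Sum>h\<in>Next d m H g. \<Sum>w\<in>UNIV. x h $ u $ w else 0)"

text \<open>
  A quasi-irreducible walk may have \<open>\<Delta>\<^sub>g(u,u) = 0\<close> for some \<open>g\<close> and \<open>u\<close>. The inverse of a
  diagonal matrix is therefore taken entrywise on the diagonal with the convention \<open>1/0 = 0\<close>. It
  is the usual inverse whenever the matrix is invertible.
\<close>

definition diag_inverse :: "real^'r^'r \<Rightarrow> real^'r^'r" where
  "diag_inverse D = (\<chi> u v. if u = v then inverse (D $ u $ u) else 0)"

lemma diag_inverse:
  fixes D :: "real^'r^'r"
  assumes diag: "\<And>u v. u \<noteq> v \<Longrightarrow> D $ u $ v = 0" and inv: "invertible D"
  shows "D ** diag_inverse D = mat 1" "diag_inverse D ** D = mat 1" "matrix_inv D = diag_inverse D"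
proof -
  obtain B where B: "D ** B = mat 1" using inv by (auto simp: invertible_def)
  have nz: "D $ u $ u \<noteq> 0" for u
  proof
    assume 0: "D $ u $ u = 0"
    have "(D ** B) $ u $ u = 0"
      unfolding matrix_matrix_mult_def using diag 0
      by (auto intro!: sum.neutral) (metis)
    then show False using B by (simp add: mat_def)
  qed
  have D: "D = (\<chi> u v. if u = v then D $ u $ u else 0)"
    using diag by (auto simp: vec_eq_iff)
  have sum1: "(\<Sum>k\<in>UNIV. D $ u $ k * (if k = v then inverse (D $ k $ k) else 0)) =
      (if u = v then 1 else 0)" for u v
    using nz diag by (simp add: if_distrib[of "\<lambda>z. _ * z"] sum.delta cong: if_cong)
  have sum2: "(\<Sum>k\<in>UNIV. (if u = k then inverse (D $ u $ u) else 0) * D $ k $ v) =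
      (if u = v then 1 else 0)" for u v
    using nz diag by (simp add: if_distrib[of "\<lambda>z. z * _"] sum.delta cong: if_cong)
  show 1: "D ** diag_inverse D = mat 1"
    using sum1 by (simp add: vec_eq_iff matrix_matrix_mult_def diag_inverse_def mat_def)
  show 2: "diag_inverse D ** D = mat 1"
    using sum2 by (simp add: vec_eq_iff matrix_matrix_mult_def diag_inverse_def mat_def)
  have "D ** matrix_inv D = mat 1 \<and> matrix_inv D ** D = mat 1"
    unfolding matrix_inv_def by (rule someI[of _ "diag_inverse D"]) (simp add: 1 2)
  then show "matrix_inv D = diag_inverse D"
    by (metis 2 matrix_mul_assoc matrix_mul_lid matrix_mul_rid)
qed

text \<open>
  \<open>cylinder_product d m H x [\<xi>\<^sub>1, \<dots>, \<xi>\<^sub>n]\<close> is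
  \<open>x\<^bsub>\<xi>\<^sub>1\<^esub> \<Delta>(x)\<^bsub>\<xi>\<^sub>1\<^esub>\<inverse> x\<^bsub>\<xi>\<^sub>2\<^esub> \<dots> \<Delta>(x)\<^bsub>\<xi>\<^sub>n\<^sub>-\<^sub>1\<^esub>\<inverse> x\<^bsub>\<xi>\<^sub>n\<^esub>\<close>; the value at \<open>[]\<close> is irrelevant.
\<close>

fun cylinder_product ::
    "nat \<Rightarrow> nat \<Rightarrow> (nat \<Rightarrow> 'b monoid) \<Rightarrow> ('b letter \<Rightarrow> real^'r^'r) \<Rightarrow> 'b letter list \<Rightarrow> real^'r^'r" where
  "cylinder_product d m H x [] = mat 1"
| "cylinder_product d m H x [g] = x g"
| "cylinder_product d m H x (g # h # w) =
     x g ** diag_inverse (Delta d m H x g) ** cylinder_product d m H x (h # w)"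

definition solves_system ::
    "nat \<Rightarrow> nat \<Rightarrow> (nat \<Rightarrow> 'b monoid) \<Rightarrow> ('b letter list \<Rightarrow> real^'r^'r) \<Rightarrow>
     ('b letter \<Rightarrow> real^'r^'r) \<Rightarrow> bool" where
  "solves_system d m H p x \<longleftrightarrow>
     (\<forall>g\<in>letters d m H. \<forall>u v. 0 \<le> x g $ u $ v) \<and>
     stochastic (\<Sum>g\<in>letters d m H. x g) \<and>
     (\<forall>g\<in>letters d m H.
        x g = p [g] ** Delta d m H x g
            + (\<Sum>(h, h') \<in> {(h, h'). h \<in> letters d m H \<and> h' \<in> letters d m H \<and>
                               [h] \<otimes>\<^bsub>free_product d m H\<^esub> [h'] = [g]}. p [h] ** x h')
            + (\<Sum>h\<in>Next d m H g.
                 p (inv\<^bsub>free_product d m H\<^esub> [h]) ** x h ** diag_inverse (Delta d m H x h) ** x g))"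

end

theory Submission
  imports Defs
begin

text \<open>
  Every non-empty reduced word is a cut vertex of the Cayley graph: a nearest-neighbour path can
  enter the cone of \<open>w\<close>, the words with prefix \<open>w\<close>, only through \<open>w\<close> itself (\<open>enter_cone\<close>). Hence
  a walk with \<open>X\<^sub>\<infinity>\<close> in the cylinder of \<open>w\<close> visits \<open>w\<close>. Let \<open>F\<^sub>w(u, v)\<close>, below \<open>passage w\<close>, be the
  probability that the walk from colour \<open>u\<close> ever visits \<open>w\<close> and has colour \<open>v\<close> at the first visit.
  After that visit the walk starts afresh, seen from \<open>w\<close>, and \<open>X\<^sub>\<infinity>\<close> lies in the cylinder of \<open>w\<close>
  iff the first letter of the limit of this new walk may follow the last letter \<open>g\<close> of \<open>w\<close>. So the
  joint law of the cylinder and of the hitting colour is \<open>F\<^sub>w(u, v) \<Delta>\<^sub>g(v, v)\<close> (\<open>hit_cone\<close>), and in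
  particular \<open>\<mu>\<^sub>g = F\<^sub>g \<Delta>\<^sub>g\<close>. As \<open>F\<close> is multiplicative along reduced words (\<open>passage_append\<close>), the
  products of the theorem telescope to \<open>F\<^sub>w \<Delta>\<^sub>g\<close> (\<open>cylinder_product_mu\<close>). The matrix system for
  \<open>\<mu>\<close> is the decomposition of \<open>F\<^sub>g\<close> by the first step of the walk, multiplied by \<open>\<Delta>\<^sub>g\<close>: the first
  steps \<open>s \<noteq> g\<close> are those for which \<open>s\<inverse>g\<close> is a letter and those for which it has length two
  (\<open>system_sum\<close>). A diagonal entry of \<open>\<Delta>\<^sub>g\<close> may vanish; then the same row of every matrix that can
  follow \<open>\<mu>\<^sub>g\<close> in a product vanishes too, which makes the convention for the inverse harmless.

  Let now \<open>x\<close> be any solution. The products of the \<open>x\<^sub>g\<close> satisfy a first-step equation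
  (\<open>cp_step\<close>), which says that they are the cylinder weights of a stationary family of measures,
  provided that they are consistent, that is, that no mass gets lost at a letter \<open>g\<close> and a
  colour \<open>v\<close> with \<open>\<Delta>(x)\<^sub>g(v, v) = 0\<close>. The mass lost at a word \<open>w\<close> is a bounded subharmonic function
  of \<open>w\<close> that tends to \<open>0\<close> at infinity; since the walk leaves every finite set, it is \<open>0\<close>
  (\<open>defect_zero\<close>). Therefore the weights come from a family of measures on the boundary, realised as
  the laws of a Markov chain of letters and colours. This family is stationary
  (\<open>boundary_measure_stationary\<close>), hence it is the harmonic measure, so \<open>x\<close> and \<open>\<mu>\<close> have the same row
  sums and \<open>\<Delta>(x) = \<Delta>(\<mu>)\<close>. With \<open>\<Delta>\<close> fixed, \<open>\<mu>\<close> is the limit of the monotone iteration of the system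
  that starts from \<open>0\<close>, so \<open>\<mu> \<le> x\<close> entrywise (\<open>passage_by_le_cp\<close>), and equality of the row sums
  gives \<open>\<mu> = x\<close>.
\<close>

section \<open>Preliminaries on matrices, streams and discrete distributions\<close>

lemma matrix_sum_mult:
  fixes A :: "'s \<Rightarrow> real^'r^'r"
  shows "(\<Sum>s\<in>I. A s) ** C = (\<Sum>s\<in>I. A s ** C)"
  by (simp add: vec_eq_iff matrix_matrix_mult_def sum_distrib_right sum.swap[of _ I])

lemma matrix_add_mult: "(A + B) ** C = A ** C + B ** (C :: real^'r^'r)" for A B :: "real^'r^'r"
  by (simp add: vec_eq_iff matrix_matrix_mult_def distrib_right sum.distrib)

lemma matrix_mult_nonneg:
  fixes A B :: "real^'r^'r"
  shows "(\<And>u v. 0 \<le> A $ u $ v) \<Longrightarrow> (\<And>u v. 0 \<le> B $ u $ v) \<Longrightarrow> 0 \<le> (A ** B) $ u $ v"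
  by (simp add: matrix_matrix_mult_def sum_nonneg)

lemma diag_mult_nth:
  fixes A :: "real^'r^'r"
  shows "(A ** (\<chi> u v. if u = v then f u else 0)) $ u $ v = A $ u $ v * f v"
    "((\<chi> u v. if u = v then f u else 0) ** A) $ u $ v = f u * A $ u $ v"
  by (simp_all add: matrix_matrix_mult_def if_distrib[of "\<lambda>z. _ * z"] if_distrib[of "\<lambda>z. z * _"]
      sum.delta cong: if_cong)

lemma Least_nat_iff: "Q k \<Longrightarrow> (LEAST n. Q n) = n \<longleftrightarrow> Q n \<and> (\<forall>i<n. \<not> Q i)" for k n :: nat
  by (metis LeastI Least_equality not_le_imp_less not_less_Least)

lemma stream_eqI_stake: "(\<And>n. stake n \<xi> = stake n \<zeta>) \<Longrightarrow> \<xi> = \<zeta>"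
proof (coinduction arbitrary: \<xi> \<zeta>)
  case Eq_stream
  have "stake (Suc n) \<xi> = stake (Suc n) \<zeta>" for n using Eq_stream by blast
  then show ?case by auto
qed

lemma stake_shift_self: "stake (length w) (w @- \<zeta>) = w"
  by (simp add: stake_shift)

lemma prefix_single_unique:
  "\<forall>\<^sub>F k in sequentially. prefix [g] (y k) \<Longrightarrow> \<forall>\<^sub>F k in sequentially. prefix [h] (y k) \<Longrightarrow> g = h"
  for y :: "nat \<Rightarrow> 'c list"
proof -
  assume "\<forall>\<^sub>F k in sequentially. prefix [g] (y k)" "\<forall>\<^sub>F k in sequentially. prefix [h] (y k)"
  then have "\<forall>\<^sub>F k in sequentially. prefix [g] (y k) \<and> prefix [h] (y k)" by (rule eventually_conj)
  then obtain k where "prefix [g] (y k)" "prefix [h] (y k)"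
    using eventually_happens' sequentially_bot by blast
  then show "g = h" by (auto simp: prefix_def)
qed

lemma finite_pmf_exists:
  fixes f :: "'a \<Rightarrow> real"
  assumes "finite A" "\<And>a. a \<in> A \<Longrightarrow> 0 \<le> f a" "sum f A = 1"
  shows "\<exists>q. set_pmf q \<subseteq> A \<and> (\<forall>a\<in>A. pmf q a = f a)"
proof -
  define f' where "f' a = (if a \<in> A then f a else 0)" for a
  have "(\<integral>\<^sup>+a. ennreal (f' a) \<partial>count_space UNIV) = (\<Sum>a\<in>A. ennreal (f' a))"
    by (rule nn_integral_count_space'[OF assms(1)]) (auto simp: f'_def)
  also have "\<dots> = ennreal (\<Sum>a\<in>A. f' a)" using assms(2) by (intro sum_ennreal) (auto simp: f'_def)
  finally have 1: "(\<integral>\<^sup>+a. ennreal (f' a) \<partial>count_space UNIV) = 1" using assms(3) by (simp add: f'_def)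
  have 0: "0 \<le> f' a" for a using assms(2) by (simp add: f'_def)
  show ?thesis
    by (rule exI[of _ "embed_pmf f'"])
      (auto simp: pmf_embed_pmf[OF 0 1] set_embed_pmf[OF 0 1] f'_def split: if_splits)
qed

text \<open>
  A Markov chain is run on a stream \<open>\<omega>\<close> of independent inputs: in the state \<open>s\<close> the input \<open>f\<close> yields
  the new letter and colour \<open>t s f\<close>. The letter component of a state is \<open>None\<close> at the start only.
\<close>

primcorec driven_word ::
    "('a option \<times> 'c \<Rightarrow> 'f \<Rightarrow> 'a \<times> 'c) \<Rightarrow> 'a option \<times> 'c \<Rightarrow> 'f stream \<Rightarrow> 'a stream" where
  "shd (driven_word t s \<omega>) = fst (t s (shd \<omega>))"
| "stl (driven_word t s \<omega>) = driven_word t (apfst Some (t s (shd \<omega>))) (stl \<omega>)"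

section \<open>Reduced words\<close>

locale free_product_factors =
  fixes d m :: nat and H :: "nat \<Rightarrow> 'b monoid"
  assumes factors: "\<And>j. j \<in> {1..m} \<Longrightarrow> group (H j) \<and> finite (carrier (H j))"
begin

abbreviation "G \<equiv> free_product d m H"
abbreviation "S \<equiv> letters d m H"
abbreviation "nexts \<equiv> Next d m H"
abbreviation "red \<equiv> reduced d m H"
abbreviation "linv \<equiv> letter_inv H"

text \<open>The word \<open>pull s w\<close> is \<open>s\<inverse>w\<close>: the position \<open>w\<close> seen after a first step to \<open>s\<close>.\<close>

abbreviation pull :: "'b letter \<Rightarrow> 'b letter list \<Rightarrow> 'b letter list" where
  "pull s w \<equiv> push H (linv s) w"

lemma factor_group: "j \<in> {1..m} \<Longrightarrow> group (H j)"
  using factors by blast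

sublocale G: group G
  by (rule group_free_product[of m H, OF factor_group])

lemma finite_letters: "finite S"
  unfolding letters_def factor_letters_def using factors by auto

lemma finite_Next: "finite (nexts g)"
  by (rule finite_subset[OF _ finite_letters]) (cases g; auto)

lemma Next_subset: "nexts g \<subseteq> S"
  by (cases g) auto

lemma carrier_iff [simp]: "w \<in> carrier G \<longleftrightarrow> red w"
  by (simp add: free_product_def)

lemma one_free_product [simp]: "\<one>\<^bsub>G\<^esub> = []"
  by (simp add: free_product_def)

lemma mult_eq_foldr: "v \<otimes>\<^bsub>G\<^esub> w = foldr (push H) v w"
  by (simp add: free_product_def)

lemma letter_mult [simp]: "[s] \<otimes>\<^bsub>G\<^esub> w = push H s w"
  by (simp add: mult_eq_foldr)

lemma Cons_mult: "(s # v) \<otimes>\<^bsub>G\<^esub> w = push H s (v \<otimes>\<^bsub>G\<^esub> w)"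
  by (simp add: mult_eq_foldr)

lemma linv_in [simp]: "s \<in> S \<Longrightarrow> linv s \<in> S"
  and linv_linv [simp]: "s \<in> S \<Longrightarrow> linv (linv s) = s"
  using letter_inv_letters[of m H, OF factor_group] by blast+

lemma red_single [simp]: "red [s] \<longleftrightarrow> s \<in> S"
  by (simp add: reduced_Cons)

lemma red_push [simp]: "s \<in> S \<Longrightarrow> red w \<Longrightarrow> red (push H s w)"
  by (rule reduced_push[of m H, OF factor_group])

lemma push_pull [simp]: "s \<in> S \<Longrightarrow> red w \<Longrightarrow> push H s (pull s w) = w"
  using push_push_inv[of m H s d "linv s" w, OF factor_group] by simp

lemma pull_push [simp]: "s \<in> S \<Longrightarrow> red w \<Longrightarrow> pull s (push H s w) = w"
  using push_push_inv[of m H "linv s" d s w, OF factor_group] by simp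

lemma inv_letter: "s \<in> S \<Longrightarrow> inv\<^bsub>G\<^esub> [s] = [linv s]"
  by (rule G.inv_equality) (use push_push_inv[of m H "linv s" d s "[]", OF factor_group] in auto)

lemma push_append: "\<xi> \<noteq> [] \<Longrightarrow> push H s (\<xi> @ v) = push H s \<xi> @ v"
  by (cases \<xi>; cases s; cases "hd \<xi>") auto

lemma pull_eq_Nil_iff: "s \<in> S \<Longrightarrow> red w \<Longrightarrow> pull s w = [] \<longleftrightarrow> w = [s]"
  by (metis push_pull pull_push push.simps(1) reduced_Nil)

lemma push_Next: "s \<in> S \<Longrightarrow> red (s # w) \<Longrightarrow> push H s w = s # w"
  by (cases w; cases s; cases "hd w") (auto simp: reduced_Cons)

lemma pull_Cons_self: "red (s # w) \<Longrightarrow> pull s (s # w) = w"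
  by (metis pull_push push_Next reduced_Cons)

lemma mult_append: "red (w @ v) \<Longrightarrow> w \<otimes>\<^bsub>G\<^esub> v = w @ v"
proof (induction w)
  case (Cons s w)
  then show ?case by (metis Cons_mult append_Cons push_Next reduced_Cons)
qed (simp add: mult_eq_foldr)

lemma red_append:
  "red (w @ v) \<longleftrightarrow> red w \<and> red v \<and> (w = [] \<or> v = [] \<or> hd v \<in> nexts (last w))"
  by (auto simp: reduced_def successively_append_iff)

text \<open>
  Left multiplication by a letter \<open>s\<inverse>\<close> touches the first letter \<open>g\<close> of a word only, and
  apart from the cancellation \<open>s = g\<close> there are two cases: \<open>g\<close> is multiplied within its factor,
  or \<open>s\<inverse>\<close> is put in front.
\<close>

lemma pull_cases:
  assumes "s \<in> S" "g \<in> S" "s \<noteq> g"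
  obtains (merge) h where "pull s [g] = [h]" "h \<in> S" "nexts h = nexts g"
    | (extend) "pull s [g] = [linv s, g]" "linv s \<in> nexts g" "g \<in> nexts (linv s)"
proof (cases s)
  case (Elt j x)
  then interpret Hj: group "H j" using assms factor_group by auto
  show ?thesis
  proof (cases g)
    case (Elt k y)
    show ?thesis
    proof (cases "k = j")
      case True
      have xy: "x \<in> carrier (H j)" "y \<in> carrier (H j)" "x \<noteq> y"
        using \<open>s = Elt j x\<close> Elt assms True by auto
      have ne: "inv\<^bsub>H j\<^esub> x \<otimes>\<^bsub>H j\<^esub> y \<noteq> \<one>\<^bsub>H j\<^esub>"
        using xy by (metis Hj.inv_closed Hj.inv_inv Hj.inv_equality Hj.m_closed Hj.inv_comm)
      show ?thesis
        by (rule merge[of "Elt j (inv\<^bsub>H j\<^esub> x \<otimes>\<^bsub>H j\<^esub> y)"])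
          (use \<open>s = Elt j x\<close> Elt True ne xy assms in auto)
    next
      case False
      have "linv s \<in> S" using assms by simp
      then show ?thesis using \<open>s = Elt j x\<close> Elt False assms by (intro extend) auto
    qed
  qed (use \<open>s = Elt j x\<close> assms linv_in[OF assms(1)] in \<open>auto intro!: extend\<close>)
next
  case (Gen i)
  then show ?thesis by (cases g) (use assms in \<open>auto intro!: extend\<close>)
next
  case (GenInv i)
  then show ?thesis by (cases g) (use assms in \<open>auto intro!: extend\<close>)
qed

text \<open>
  With \<open>h = s\<inverse>\<close> this turns the index set \<open>h \<in> Next(g)\<close> of the matrix system into a set of first
  steps \<open>s\<close>.
\<close>

lemma linv_Next_iff:
  assumes "s \<in> S" "g \<in> S"
  shows "linv s \<in> nexts g \<longleftrightarrow> s \<noteq> g \<and> length (pull s [g]) = 2"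
proof (cases s)
  case (Elt j x)
  then interpret Hj: group "H j" using assms factor_group by auto
  show ?thesis
  proof (cases g)
    case (Elt k y)
    show ?thesis using \<open>s = Elt j x\<close> Elt assms linv_in[OF assms(1)] by auto
  qed (use \<open>s = Elt j x\<close> assms linv_in[OF assms(1)] in auto)
next
  case (Gen i)
  then show ?thesis by (cases g) (use assms in auto)
next
  case (GenInv i)
  then show ?thesis by (cases g) (use assms in auto)
qed

text \<open>
  Cancellation reaches the first letter of \<open>w\<close> only, so the last letter either stays or is replaced
  by another letter of the same factor, which has the same followers.
\<close>

lemma pull_append_last:
  assumes "s \<in> S" "red (w @ v)" "w \<noteq> []" "w \<noteq> [s]"
  shows "pull s (w @ v) = pull s w @ v" "pull s w \<noteq> []" "nexts (last (pull s w)) = nexts (last w)"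
proof -
  have rw: "red w" using assms(2) by (simp add: red_append)
  show "pull s (w @ v) = pull s w @ v" using assms(3) by (rule push_append)
  show "pull s w \<noteq> []" using pull_eq_Nil_iff[OF assms(1) rw] assms(4) by simp
  obtain g w' where w: "w = g # w'" using assms(3) by (cases w) auto
  have g: "g \<in> S" using rw w by (simp add: reduced_Cons)
  show "nexts (last (pull s w)) = nexts (last w)"
  proof (cases "s = g")
    case True
    then show ?thesis using rw w assms(4) by (auto simp: pull_Cons_self)
  next
    case False
    have eq: "pull s w = pull s [g] @ w'" using push_append[of "[g]" "linv s" w'] w by simp
    show ?thesis
      by (rule pull_cases[OF assms(1) g False]) (use eq w in auto)
  qed
qed

text \<open>
  The cone of \<open>\<xi>\<close> as seen from \<open>\<xi>\<close>: it consists of the words \<open>y\<close> that do not react with the last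
  letter of \<open>\<xi>\<close>.
\<close>

lemma prefix_mult_iff:
  assumes "red \<xi>" "\<xi> \<noteq> []" "red y"
  shows "prefix \<xi> (\<xi> \<otimes>\<^bsub>G\<^esub> y) \<longleftrightarrow> y = [] \<or> hd y \<in> nexts (last \<xi>)"
proof
  assume "y = [] \<or> hd y \<in> nexts (last \<xi>)"
  then have "red (\<xi> @ y)" using assms by (auto simp: red_append)
  then show "prefix \<xi> (\<xi> \<otimes>\<^bsub>G\<^esub> y)" by (simp add: mult_append)
next
  assume "prefix \<xi> (\<xi> \<otimes>\<^bsub>G\<^esub> y)"
  then obtain v where v: "\<xi> \<otimes>\<^bsub>G\<^esub> y = \<xi> @ v" by (auto simp: prefix_def)
  have r: "red (\<xi> @ v)" using v assms G.m_closed[of \<xi> y] by simp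
  then have "\<xi> \<otimes>\<^bsub>G\<^esub> y = \<xi> \<otimes>\<^bsub>G\<^esub> v" using v by (simp add: mult_append)
  moreover have "red v" using r by (simp add: red_append)
  ultimately have "y = v" using assms by (simp)
  then show "y = [] \<or> hd y \<in> nexts (last \<xi>)" using r assms by (auto simp: red_append)
qed

lemma mult_letter:
  assumes "red w" "w \<noteq> []" "s \<in> S"
  shows "w \<otimes>\<^bsub>G\<^esub> [s] = butlast w @ push H (last w) [s]"
proof -
  define a b where "a = butlast w" and "b = last w"
  have w: "w = a @ [b]" using assms(2) by (simp add: a_def b_def)
  have b: "b \<in> S" and ra: "red a" using assms(1) w by (auto simp: red_append)
  have "red (a @ push H b [s])"
  proof (cases "s = linv b")
    case True
    then have "push H b [s] = []" using push_pull[of b "[]"] b by simp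
    then show ?thesis using ra by simp
  next
    case False
    show ?thesis
    proof (cases a)
      case Nil
      then show ?thesis using b assms by simp
    next
      case (Cons t a')
      have ls: "last a \<in> S" using ra Cons by (auto simp: reduced_def)
      have bn: "b \<in> nexts (last a)" using assms(1) w Cons red_append[of a "[b]"] by auto
      have "push H b [s] \<noteq> [] \<longrightarrow> hd (push H b [s]) \<in> nexts (last a)"
      proof (cases "push H b [s] = [b, s]")
        case False
        then obtain j x y where e: "b = Elt j x" "s = Elt j y"
          using \<open>s \<noteq> linv b\<close> by (cases b; cases s) (auto split: if_splits)
        interpret Hj: group "H j" using e assms factor_group by auto
        show ?thesis using e bn assms by (cases "last a") auto
      qed (use bn in simp)
      then show ?thesis using ra b assms by (auto simp: red_append)
    qed
  qed
  then have "a \<otimes>\<^bsub>G\<^esub> push H b [s] = a @ push H b [s]" by (rule mult_append)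
  moreover have "w \<otimes>\<^bsub>G\<^esub> [s] = a \<otimes>\<^bsub>G\<^esub> push H b [s]"
    unfolding w by (simp add: mult_eq_foldr)
  ultimately show ?thesis by (simp add: a_def b_def)
qed

text \<open>
  Right multiplication by a letter affects the last letter only, so a step that produces the prefix
  \<open>\<xi>\<close> completes it: the cone of \<open>\<xi>\<close> is entered through \<open>\<xi>\<close>.
\<close>

lemma enter_cone:
  assumes "red w" "s \<in> S" "\<xi> \<noteq> []" "prefix \<xi> (w \<otimes>\<^bsub>G\<^esub> [s])" "\<not> prefix \<xi> w"
  shows "w \<otimes>\<^bsub>G\<^esub> [s] = \<xi>"
proof (cases "w = []")
  case True
  then show ?thesis using assms by (auto simp: mult_eq_foldr prefix_Cons)
next
  case False
  define a b where "a = butlast w" and "b = last w"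
  have w: "w = a @ [b]" using False by (simp add: a_def b_def)
  have b: "b \<in> S" using assms(1) w by (auto simp: red_append)
  have eq: "w \<otimes>\<^bsub>G\<^esub> [s] = a @ push H b [s]" using mult_letter assms False by (simp add: a_def b_def)
  have na: "\<not> prefix \<xi> a" using assms(5) w by (auto simp: prefix_def)
  have "push H b [s] = [] \<or> (\<exists>t. push H b [s] = [t]) \<or> push H b [s] = [b, s]"
    by (cases b; cases s) auto
  then consider "push H b [s] = []" | t where "push H b [s] = [t]" | "push H b [s] = [b, s]"
    by blast
  then show ?thesis
  proof cases
    case 3
    have eq3: "w \<otimes>\<^bsub>G\<^esub> [s] = w @ [s]" using eq 3 w by simp
    then show ?thesis using assms(4,5) by simp
  qed (use eq assms(4) na in auto)
qed

lemma length_mult_le: "red x \<Longrightarrow> red w \<Longrightarrow> length (x \<otimes>\<^bsub>G\<^esub> w) \<le> length x + length w"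
proof (induction x)
  case (Cons s x)
  have "length (push H s y) \<le> Suc (length y)" for y
    by (cases y; cases s; cases "hd y") auto
  then have "length ((s # x) \<otimes>\<^bsub>G\<^esub> w) \<le> Suc (length (x \<otimes>\<^bsub>G\<^esub> w))" by (simp add: Cons_mult)
  also have "\<dots> \<le> Suc (length x + length w)" using Cons by (simp add: reduced_Cons)
  finally show ?case by simp
qed (simp add: mult_eq_foldr)

lemma countable_carrier: "countable (carrier G)"
proof (rule countable_subset)
  show "carrier G \<subseteq> lists S" by (auto simp: reduced_def)
  show "countable (lists S)" using finite_letters by (simp add: countable_finite)
qed

lemma finite_words: "finite {w. red w \<and> length w = k}"
  by (rule finite_subset[OF _ finite_lists_length_eq[OF finite_letters, of k]]) (auto simp: reduced_def)

lemma words_Suc: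
  assumes "k \<ge> 1"
  shows "bij_betw (\<lambda>(w, h). w @ [h]) (SIGMA w:{w. red w \<and> length w = k}. nexts (last w))
           {w. red w \<and> length w = Suc k}"
proof (rule bij_betwI')
  fix w assume "w \<in> {w. red w \<and> length w = Suc k}"
  then have "red w" "length w = Suc k" by auto
  moreover from this obtain v h where "w = v @ [h]" by (cases w rule: rev_cases) auto
  ultimately show "\<exists>x\<in>SIGMA w:{w. red w \<and> length w = k}. nexts (last w). w = (case x of (w, h) \<Rightarrow> w @ [h])"
    using assms by (intro bexI[of _ "(v, h)"]) (auto simp: red_append)
next
  fix x assume "x \<in> (SIGMA w:{w. red w \<and> length w = k}. nexts (last w))"
  then show "(case x of (w, h) \<Rightarrow> w @ [h]) \<in> {w. red w \<and> length w = Suc k}"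
    using subsetD[OF Next_subset] by (auto simp: red_append)
qed auto

section \<open>Cylinders of the boundary\<close>

abbreviation "bdry \<equiv> boundary d m H"
abbreviation "BS \<equiv> boundary_space d m H"
abbreviation "cyl \<equiv> cylinder d m H"

lemma boundary_iff: "\<xi> \<in> bdry \<longleftrightarrow> (\<forall>n. red (stake n \<xi>))"
proof
  assume \<xi>: "\<xi> \<in> bdry"
  have "red (stake n \<xi>)" for n
    using \<xi> by (auto simp: boundary_def reduced_def successively_conv_nth in_set_conv_nth
      simp del: snth.simps)
  then show "\<forall>n. red (stake n \<xi>)" ..
next
  assume *: "\<forall>n. red (stake n \<xi>)"
  have "\<xi> !! i \<in> S \<and> \<xi> !! Suc i \<in> nexts (\<xi> !! i)" for i
  proof -
    have "red ((stake i \<xi> @ [\<xi> !! i]) @ [\<xi> !! Suc i])" using *[rule_format, of "Suc (Suc i)"]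
      by (simp add: stake_Suc del: stake.simps(2))
    then show ?thesis by (simp only: red_append) simp
  qed
  then show "\<xi> \<in> bdry" by (simp add: boundary_def)
qed

lemma space_BS: "space BS = bdry"
  by (simp add: boundary_space_def space_restrict_space space_stream_space)

lemma cyl_Int:
  "cyl v \<inter> cyl w = (if prefix v w then cyl w else if prefix w v then cyl v else {})"
proof -
  have A: "v = stake (length v) \<xi> \<Longrightarrow> w = stake (length w) \<xi> \<Longrightarrow> length v \<le> length w \<Longrightarrow> prefix v w"
    for \<xi> :: "'b letter stream" and v w
    by (metis min.absorb1 take_is_prefix take_stake)
  have B: "prefix v w \<Longrightarrow> stake (length w) \<xi> = w \<Longrightarrow> stake (length v) \<xi> = v"
    for \<xi> :: "'b letter stream" and v w
    by (metis append_eq_conv_conj min.absorb1 prefix_def prefix_length_le take_stake)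
  show ?thesis
    unfolding cylinder_def
    using A[of v _ w] A[of w _ v] B[of v w] B[of w v]
    by (auto; metis linear)
qed

lemma cyl_sets [measurable]: "cyl w \<in> sets BS"
proof -
  have "cyl w = {\<xi>\<in>space BS. stake (length w) \<xi> = w}"
    by (auto simp: cylinder_def space_BS)
  also have "\<dots> = bdry \<inter> {\<xi>\<in>space (stream_space (count_space UNIV)). \<forall>i<length w. \<xi> !! i = w ! i}"
    by (auto simp: space_BS list_eq_iff_nth_eq space_stream_space)
  also have "\<dots> \<in> sets BS"
    unfolding boundary_space_def sets_restrict_space
    by (intro imageI) measurable
  finally show ?thesis .
qed

text \<open>
  The empty set makes this family stable under intersections.
\<close>

definition cylinders :: "'b letter stream set set" where
  "cylinders = insert {} (cyl ` Collect red)"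

lemma Int_stable_cylinders: "Int_stable cylinders"
proof (rule Int_stableI)
  have "cyl v \<inter> cyl w \<in> cylinders" if "red v" "red w" for v w
    unfolding cyl_Int using that by (auto simp: cylinders_def)
  then show "A \<inter> B \<in> cylinders" if "A \<in> cylinders" "B \<in> cylinders" for A B
    using that unfolding cylinders_def by auto
qed

lemma sets_BS: "sets BS = sigma_sets bdry cylinders"
proof
  have sub: "cylinders \<subseteq> Pow bdry" by (auto simp: cylinders_def cylinder_def)
  have "(\<lambda>\<xi>. \<xi>) \<in> measurable (sigma bdry cylinders) BS"
    unfolding boundary_space_def
  proof (rule measurable_restrict_space2)
    show "(\<lambda>\<xi>. \<xi>) \<in> measurable (sigma bdry cylinders) (stream_space (count_space UNIV))"
    proof (rule measurable_stream_space2)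
      fix n
      show "(\<lambda>\<xi>. \<xi> !! n) \<in> measurable (sigma bdry cylinders) (count_space UNIV)"
      proof (rule measurableI)
        fix A :: "'b letter set"
        have "(\<lambda>\<xi>. \<xi> !! n) -` A \<inter> bdry =
            (\<Union>w\<in>{w. red w \<and> length w = Suc n \<and> last w \<in> A}. cyl w)"
        proof (intro equalityI subsetI)
          fix \<xi> assume "\<xi> \<in> (\<lambda>\<xi>. \<xi> !! n) -` A \<inter> bdry"
          then show "\<xi> \<in> (\<Union>w\<in>{w. red w \<and> length w = Suc n \<and> last w \<in> A}. cyl w)"
            using boundary_iff[of \<xi>] spec[of "\<lambda>n. red (stake n \<xi>)" "Suc n"]
            by (intro UN_I[of "stake (Suc n) \<xi>"])
               (auto simp: cylinder_def stake_Suc simp del: stake.simps(2))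
        next
          fix \<xi> assume "\<xi> \<in> (\<Union>w\<in>{w. red w \<and> length w = Suc n \<and> last w \<in> A}. cyl w)"
          then have "\<xi> \<in> bdry" "last (stake (Suc n) \<xi>) \<in> A"
            by (auto simp: cylinder_def simp del: stake.simps(2))
          then show "\<xi> \<in> (\<lambda>\<xi>. \<xi> !! n) -` A \<inter> bdry"
            by (auto simp: stake_Suc simp del: stake.simps(2))
        qed
        also have "\<dots> \<in> sets (sigma bdry cylinders)"
        proof (rule sets.finite_UN)
          show "finite {w. red w \<and> length w = Suc n \<and> last w \<in> A}"
            by (rule finite_subset[OF _ finite_words[of "Suc n"]]) auto
        qed (use sub in \<open>auto simp: cylinders_def\<close>)
        finally show "(\<lambda>\<xi>. \<xi> !! n) -` A \<inter> space (sigma bdry cylinders) \<in> sets (sigma bdry cylinders)"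
          using sub by (simp add: space_measure_of)
      qed simp
    qed
  qed (use sub in \<open>auto simp: space_measure_of\<close>)
  then have "A \<in> sigma_sets bdry cylinders" if "A \<in> sets BS" for A
  proof -
    have "(\<lambda>\<xi>. \<xi>) -` A \<inter> space (sigma bdry cylinders) \<in> sets (sigma bdry cylinders)"
      using that \<open>(\<lambda>\<xi>. \<xi>) \<in> _\<close> by (rule measurable_sets[rotated])
    moreover have "A \<subseteq> bdry" using that sets.sets_into_space space_BS by blast
    ultimately show ?thesis using sub by (simp add: space_measure_of Int_absorb2 sets_measure_of)
  qed
  then show "sets BS \<subseteq> sigma_sets bdry cylinders" by blast
  show "sigma_sets bdry cylinders \<subseteq> sets BS"
    using cyl_sets sets.sigma_sets_subset[of cylinders BS]
    by (simp add: space_BS cylinders_def image_subset_iff)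
qed

lemma cyl_Nil: "cyl [] = bdry"
  by (simp add: cylinder_def)

lemma act_shift: "w \<noteq> [] \<Longrightarrow> act H [s] (w @- \<zeta>) = push H s w @- \<zeta>"
  by (cases w) (auto simp: act_def push_append[of "[_]", symmetric] simp flip: shift_append)

lemma act_boundary:
  assumes "s \<in> S" "\<zeta> \<in> bdry"
  shows "act H [s] \<zeta> \<in> bdry"
proof -
  have "red (stake n (act H [s] \<zeta>))" for n
  proof -
    define w where "w = stake (Suc n) \<zeta>"
    have "\<zeta> = w @- sdrop (Suc n) \<zeta>" by (simp add: w_def stake_sdrop del: stake.simps sdrop.simps)
    then have eq: "act H [s] \<zeta> = push H s w @- sdrop (Suc n) \<zeta>"
      using act_shift[of w s "sdrop (Suc n) \<zeta>"] by (simp add: w_def)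
    have w: "red w" "length w = Suc n" using assms(2) by (auto simp: w_def boundary_iff simp del: stake.simps)
    have "length (push H s w) \<ge> n" using w(2) by (cases w; cases s; cases "hd w") auto
    then have "stake n (act H [s] \<zeta>) = take n (push H s w)" by (simp add: eq stake_shift)
    moreover have "red (push H s w)" using assms w by simp
    then have "red (take n (push H s w))" by (metis append_take_drop_id red_append)
    ultimately show ?thesis by simp
  qed
  then show ?thesis by (simp add: boundary_iff)
qed

lemma act_inverse:
  assumes "s \<in> S" "\<zeta> \<in> bdry"
  shows "act H [linv s] (act H [s] \<zeta>) = \<zeta>"
proof -
  define w where "w = stake 2 \<zeta>"
  have \<zeta>: "\<zeta> = w @- sdrop 2 \<zeta>" by (simp add: w_def stake_sdrop)
  have w: "red w" "length w = 2" using assms(2) by (auto simp: w_def boundary_iff)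
  then have "w \<noteq> []" "push H s w \<noteq> []" by (cases w; cases s; cases "hd w"; auto)+
  then show ?thesis using w assms
    by (subst \<zeta>, subst \<zeta>) (simp add: act_shift stake_sdrop w_def[symmetric])
qed

lemma cyl_shift: "\<xi> \<in> cyl w \<Longrightarrow> \<exists>\<zeta>. \<xi> = w @- \<zeta>"
  by (metis (mono_tags, lifting) cylinder_def mem_Collect_eq stake_sdrop)

text \<open>
  In general the preimage of the cylinder of \<open>w\<close> is the cylinder of \<open>s\<inverse>w\<close>. The exception is
  \<open>w = s\<close>, where \<open>s\<inverse>w\<close> is empty but \<open>\<zeta>\<close> must still not react with \<open>s\<close>.
\<close>

lemma vimage_act_cyl:
  assumes s: "s \<in> S" and w: "red w"
  shows "{\<zeta>\<in>bdry. act H [s] \<zeta> \<in> cyl w} =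
    (if w = [] then bdry else if w = [s] then \<Union>h\<in>nexts s. cyl [h] else cyl (pull s w))"
proof -
  have 1: "act H [s] \<zeta> \<in> cyl w" if c: "\<zeta> \<in> cyl (pull s w)" and n: "w \<noteq> [s]" and sw: "s \<in> S" "red w"
    for s w \<zeta>
  proof -
    have \<zeta>: "\<zeta> \<in> bdry" using c by (simp add: cylinder_def)
    obtain \<zeta>' where "\<zeta> = pull s w @- \<zeta>'" using cyl_shift[OF c] by blast
    then have "act H [s] \<zeta> = w @- \<zeta>'"
      using n sw by (simp add: act_shift pull_eq_Nil_iff)
    then show ?thesis using act_boundary[OF sw(1) \<zeta>] by (simp add: cylinder_def stake_shift_self)
  qed
  consider "w = []" | "w = [s]" | "w \<noteq> []" "w \<noteq> [s]" by blast
  then show ?thesis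
  proof cases
    case 1
    then show ?thesis using act_boundary[OF s] by (auto simp: cyl_Nil)
  next
    case 2
    have "act H [s] \<zeta> \<in> cyl [s] \<longleftrightarrow> shd \<zeta> \<in> nexts s" if "\<zeta> \<in> bdry" for \<zeta>
    proof
      assume A: "act H [s] \<zeta> \<in> cyl [s]"
      define \<eta> where "\<eta> = stl (act H [s] \<zeta>)"
      have "act H [s] \<zeta> = s ## \<eta>" using A by (simp add: cylinder_def \<eta>_def) (metis stream.collapse)
      then have ac: "act H [s] \<zeta> = [s, shd \<eta>] @- stl \<eta>" by simp
      have r: "red [s, shd \<eta>]"
        using act_boundary[OF s that] unfolding boundary_iff ac
        by (metis (no_types) stake_shift_self)
      have "\<zeta> = act H [linv s] ([s, shd \<eta>] @- stl \<eta>)" using act_inverse[OF s that] ac by simp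
      also have "\<dots> = [shd \<eta>] @- stl \<eta>" using pull_Cons_self[OF r] by (simp add: act_shift del: shift.simps)
      finally show "shd \<zeta> \<in> nexts s" using r by (simp add: reduced_Cons)
    next
      assume A: "shd \<zeta> \<in> nexts s"
      have "red [s, shd \<zeta>]" using A s that subsetD[OF Next_subset] by (auto simp: reduced_Cons)
      then have "push H s [shd \<zeta>] = [s, shd \<zeta>]" using push_Next[OF s] by blast
      then have "act H [s] \<zeta> = [s, shd \<zeta>] @- stl \<zeta>" by (simp add: act_def)
      then show "act H [s] \<zeta> \<in> cyl [s]" using act_boundary[OF s that] by (simp add: cylinder_def)
    qed
    then show ?thesis using 2 by (auto simp: cylinder_def)
  next
    case 3
    have "\<zeta> \<in> cyl (pull s w)" if "\<zeta> \<in> bdry" "act H [s] \<zeta> \<in> cyl w" for \<zeta>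
    proof -
      have "act H [linv s] (act H [s] \<zeta>) \<in> cyl (pull s w)"
      proof (rule 1)
        show "pull s w \<noteq> [linv s]"
        proof
          assume "pull s w = [linv s]"
          then have "w = push H s [linv s]" using s w push_pull by metis
          then show False using 3 s push_pull[of s "[]"] by simp
        qed
      qed (use that s w in auto)
      then show ?thesis using act_inverse s that by simp
    qed
    moreover have "\<zeta> \<in> bdry" if "\<zeta> \<in> cyl v" for \<zeta> v using that by (simp add: cylinder_def)
    ultimately show ?thesis using 3 1[OF _ _ s w] by auto
  qed
qed

lemma act_measurable [measurable]:
  assumes s: "s \<in> S"
  shows "act H [s] \<in> measurable BS BS"
proof (rule measurable_sigma_sets[OF sets_BS])
  show "cylinders \<subseteq> Pow bdry" by (auto simp: cylinders_def cylinder_def)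
  show "act H [s] \<in> space BS \<rightarrow> bdry" using act_boundary[OF s] by (simp add: space_BS)
  fix A assume "A \<in> cylinders"
  then consider "A = {}" | w where "A = cyl w" "red w" by (auto simp: cylinders_def)
  then show "act H [s] -` A \<inter> space BS \<in> sets BS"
  proof cases
    case 2
    have "act H [s] -` A \<inter> space BS = {\<zeta>\<in>bdry. act H [s] \<zeta> \<in> cyl w}"
      using 2 by (auto simp: space_BS)
    also have "\<dots> \<in> sets BS" unfolding vimage_act_cyl[OF s 2(2)]
      using finite_Next cyl_Nil cyl_sets by (auto intro!: sets.finite_UN simp flip: cyl_Nil)
    finally show ?thesis .
  qed simp
qed

section \<open>Limits of sequences of words\<close>

lemma converges_to_prefix:
  assumes "converges_to w \<xi>"
  shows "(\<forall>\<^sub>F n in sequentially. prefix v (w n)) \<longleftrightarrow> stake (length v) \<xi> = v"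
proof -
  have ev: "\<forall>\<^sub>F n in sequentially. take (length v) (w n) = stake (length v) \<xi>"
    using assms by (simp add: converges_to_def)
  have eq: "prefix v (w n) \<longleftrightarrow> take (length v) (w n) = v" for n
    by (metis append_eq_conv_conj prefix_def take_is_prefix)
  have "(\<forall>\<^sub>F n in sequentially. prefix v (w n)) \<longleftrightarrow>
        (\<forall>\<^sub>F n in sequentially. stake (length v) \<xi> = v)"
    by (rule eventually_cong[OF ev]) (simp add: eq)
  then show ?thesis by simp
qed

lemma converges_to_unique:
  assumes "converges_to w \<xi>" "converges_to w \<zeta>"
  shows "\<xi> = \<zeta>"
proof -
  have "stake n \<xi> = stake n \<zeta>" for n
    using converges_to_prefix[OF assms(1), of "stake n \<xi>"] converges_to_prefix[OF assms(2), of "stake n \<xi>"]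
    by simp
  then show ?thesis by (rule stream_eqI_stake)
qed

lemma boundary_limit_eq:
  "\<xi> \<in> bdry \<Longrightarrow> converges_to w \<xi> \<Longrightarrow> boundary_limit d m H w = \<xi>"
  unfolding boundary_limit_def by (auto intro!: the_equality dest: converges_to_unique)

lemma boundary_limit_boundary:
  assumes "bdry \<noteq> {}"
  shows "boundary_limit d m H w \<in> bdry"
proof (cases "\<exists>\<xi>\<in>bdry. converges_to w \<xi>")
  case True
  then show ?thesis using boundary_limit_eq by auto
next
  case False
  then show ?thesis using assms by (simp add: boundary_limit_def some_in_eq)
qed

text \<open>
  Convergence is a countable combination of conditions on single members of the sequence; this is
  what makes it a measurable event.
\<close>

lemma converges_to_iff:
  "(\<exists>\<xi>\<in>bdry. converges_to w \<xi>) \<longleftrightarrow>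
     (\<forall>k. \<exists>v\<in>{v. red v \<and> length v = k}. \<forall>\<^sub>F n in sequentially. prefix v (w n))"
proof
  assume "\<exists>\<xi>\<in>bdry. converges_to w \<xi>"
  then obtain \<xi> where \<xi>: "\<xi> \<in> bdry" "converges_to w \<xi>" by blast
  show "\<forall>k. \<exists>v\<in>{v. red v \<and> length v = k}. \<forall>\<^sub>F n in sequentially. prefix v (w n)"
  proof
    fix k show "\<exists>v\<in>{v. red v \<and> length v = k}. \<forall>\<^sub>F n in sequentially. prefix v (w n)"
      using \<xi> converges_to_prefix[OF \<xi>(2), of "stake k \<xi>"]
      by (intro bexI[of _ "stake k \<xi>"]) (auto simp: boundary_iff)
  qed
next
  assume "\<forall>k. \<exists>v\<in>{v. red v \<and> length v = k}. \<forall>\<^sub>F n in sequentially. prefix v (w n)"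
  then obtain V where V: "\<And>k. red (V k)" "\<And>k. length (V k) = k"
      "\<And>k. \<forall>\<^sub>F n in sequentially. prefix (V k) (w n)"
    using bchoice[of UNIV "\<lambda>k v. red v \<and> length v = k \<and> (\<forall>\<^sub>F n in sequentially. prefix v (w n))"]
    by auto
  have pre: "prefix (V k) (V l)" if "k \<le> l" for k l
  proof -
    have "\<forall>\<^sub>F n in sequentially. prefix (V k) (w n) \<and> prefix (V l) (w n)"
      using V(3) by (intro eventually_conj)
    then obtain n where "prefix (V k) (w n)" "prefix (V l) (w n)"
      using eventually_happens' sequentially_bot by blast
    then show ?thesis using prefix_length_prefix V(2) that by metis
  qed
  define \<xi> where "\<xi> = to_stream (\<lambda>n. V (Suc n) ! n)"
  have st: "stake k \<xi> = V k" for k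
  proof (rule nth_equalityI)
    fix i assume "i < length (stake k \<xi>)"
    then have i: "i < k" by simp
    have "stake k \<xi> ! i = V (Suc i) ! i" using i by (simp add: \<xi>_def to_stream_def)
    also have "\<dots> = V k ! i" using pre[of "Suc i" k] i V(2) by (auto simp: prefix_def nth_append)
    finally show "stake k \<xi> ! i = V k ! i" .
  qed (simp add: V)
  have "converges_to w \<xi>" unfolding converges_to_def st
  proof
    fix k show "\<forall>\<^sub>F n in sequentially. take k (w n) = V k"
      using V(3)[of k] by eventually_elim (use V(2)[of k] in \<open>auto simp: prefix_def\<close>)
  qed
  then show "\<exists>\<xi>\<in>bdry. converges_to w \<xi>" using V(1) st by (auto simp: boundary_iff)
qed

lemma converges_to_length:
  assumes "converges_to w \<xi>"
  shows "\<forall>\<^sub>F n in sequentially. k \<le> length (w n)"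
proof -
  have "\<forall>\<^sub>F n in sequentially. prefix (stake k \<xi>) (w n)"
    using converges_to_prefix[OF assms, of "stake k \<xi>"] by simp
  then show ?thesis by eventually_elim (metis length_stake prefix_length_le)
qed

end

section \<open>The law of the walk on path space\<close>

locale nearest_neighbour_walk = free_product_factors d m H
  for d m :: nat and H :: "nat \<Rightarrow> 'b monoid" +
  fixes p :: "'b letter list \<Rightarrow> real^'r^'r"
    and P :: "'r \<Rightarrow> 'w measure"
    and X :: "nat \<Rightarrow> 'w \<Rightarrow> 'b letter list \<times> 'r"
  assumes walk: "coloured_walk G p"
    and nearest: "nearest_neighbour d m H p"
    and law: "\<And>u. walk_law G p (P u) X ([], u)"
    and converges: "\<And>u. AE \<omega> in P u. \<exists>\<xi>\<in>boundary d m H. converges_to (\<lambda>n. fst (X n \<omega>)) \<xi>"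
begin

lemma p_nonneg: "s \<in> S \<Longrightarrow> 0 \<le> p [s] $ u $ c"
  using walk by (auto simp: coloured_walk_def)

lemma supp_subset: "supp G p \<subseteq> (\<lambda>s. [s]) ` S"
  using nearest by (simp add: nearest_neighbour_def)

lemma p_eq_0: "red g \<Longrightarrow> g \<notin> (\<lambda>s. [s]) ` S \<Longrightarrow> p g = 0"
  using supp_subset by (auto simp: supp_def)

lemma sum_supp: "(\<Sum>g\<in>supp G p. f g) = (\<Sum>s\<in>S. f [s])" if "\<And>g. p g = 0 \<Longrightarrow> f g = 0"
proof -
  have "(\<Sum>g\<in>supp G p. f g) = (\<Sum>g\<in>(\<lambda>s. [s]) ` S. f g)"
    using supp_subset finite_letters that by (intro sum.mono_neutral_left) (auto simp: supp_def)
  also have "\<dots> = (\<Sum>s\<in>S. f [s])" by (subst sum.reindex) (auto simp: inj_on_def)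
  finally show ?thesis .
qed

lemma p_sum: "(\<Sum>s\<in>S. \<Sum>c\<in>UNIV. p [s] $ u $ c) = 1"
proof -
  have "(\<Sum>c\<in>UNIV. total_matrix G p $ u $ c) = 1"
    using walk by (simp add: coloured_walk_def stochastic_def)
  also have "total_matrix G p = (\<Sum>s\<in>S. p [s])" unfolding total_matrix_def by (rule sum_supp) simp
  finally show ?thesis by (simp add: sum.swap[of _ S])
qed

abbreviation states :: "('b letter list \<times> 'r) set" where "states \<equiv> carrier G \<times> UNIV"

text \<open>
  The walk is transported to the space of its trajectories. There all starting colours share one
  probability space, so that the law started in one colour can be expressed by the others.
\<close>

definition paths :: "(nat \<Rightarrow> 'b letter list \<times> 'r) measure" where
  "paths = PiM UNIV (\<lambda>_. count_space states)"

definition path_law :: "'r \<Rightarrow> (nat \<Rightarrow> 'b letter list \<times> 'r) measure" where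
  "path_law u = distr (P u) paths (\<lambda>\<omega> n. X n \<omega>)"

lemma space_paths: "x \<in> space paths \<longleftrightarrow> (\<forall>n. red (fst (x n)))"
  by (auto simp: paths_def space_PiM PiE_iff mem_Times_iff)

lemma countable_states: "countable states"
  using countable_carrier by (intro countable_SIGMA) auto

lemma walk_process: "prob_space (P u)" "X n \<in> measurable (P u) (count_space states)"
  "measure (P u) {\<omega> \<in> space (P u). X 0 \<omega> = ([], u)} = 1"
  using law[of u] by (auto simp: walk_law_def markov_chain_def)

lemma path_measurable [measurable]: "(\<lambda>\<omega> n. X n \<omega>) \<in> measurable (P u) paths"
  unfolding paths_def using walk_process(2)[THEN measurable_space] by (intro measurable_PiM_single' walk_process(2)) auto

lemma prob_path_law: "prob_space (path_law u)"
  unfolding path_law_def by (rule prob_space.prob_space_distr[OF walk_process(1) path_measurable])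

lemma sets_path_law [measurable_cong, simp]: "sets (path_law u) = sets paths"
  by (simp add: path_law_def)

lemma space_path_law [simp]: "space (path_law u) = space paths"
  by (simp add: path_law_def)

lemma coordinate_measurable [measurable]: "(\<lambda>x. x n) \<in> measurable paths (count_space states)"
  unfolding paths_def by (rule measurable_component_singleton) simp

lemma pred_coordinate [measurable]: "Measurable.pred paths (\<lambda>x. Q (x n))"
  by (rule measurable_compose[OF coordinate_measurable]) simp

lemma pred_eventually [measurable]: "Measurable.pred paths (\<lambda>x. \<forall>\<^sub>F n in sequentially. Q (x n))"
  unfolding eventually_sequentially by measurable

definition thin :: "('b letter list \<times> 'r) list \<Rightarrow> (nat \<Rightarrow> 'b letter list \<times> 'r) set" where
  "thin l = {x \<in> space paths. \<forall>i<length l. x i = l ! i}"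

text \<open>
  This puts a first step to \<open>s\<close> in front of a path that is seen from \<open>s\<close>. The Markov property at
  time \<open>1\<close> is an equation between path laws that involves these maps.
\<close>

definition step :: "'r \<Rightarrow> 'b letter \<Rightarrow> (nat \<Rightarrow> 'b letter list \<times> 'r) \<Rightarrow> nat \<Rightarrow> 'b letter list \<times> 'r" where
  "step u s x n = (case n of 0 \<Rightarrow> ([], u) | Suc k \<Rightarrow> (push H s (fst (x k)), snd (x k)))"

lemma step_simps [simp]: "step u s x 0 = ([], u)" "step u s x (Suc n) = (push H s (fst (x n)), snd (x n))"
  by (simp_all add: step_def)

lemma thin_sets [measurable]: "thin l \<in> sets paths"
  unfolding thin_def by measurable

lemma thin_mono: "length l \<le> length l' \<Longrightarrow> thin l \<inter> thin l' = {} \<or> thin l \<inter> thin l' = thin l'"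
  unfolding thin_def
  by (cases "\<forall>i<length l. l ! i = l' ! i") (fastforce+)

text \<open>
  There are only countably many states, so the \<open>\<sigma>\<close>-algebra is generated by the sets that fix an
  initial segment of the path.
\<close>

lemma sets_paths: "sets paths = sigma_sets (space paths) (insert {} (thin ` lists states))"
    (is "_ = sigma_sets _ ?C")
proof
  have C: "?C \<subseteq> Pow (space paths)" by (auto simp: thin_def)
  let ?N = "sigma (space paths) ?C"
  have N: "sets ?N = sigma_sets (space paths) ?C" "space ?N = space paths"
    using C by (simp_all add: space_measure_of sets_measure_of)
  have "sets (PiM UNIV (\<lambda>_::nat. count_space states)) \<subseteq> sets ?N"
  proof (rule sets_PiM_in_sets)
    show "space ?N = (\<Pi>\<^sub>E i\<in>UNIV. space (count_space states))"
      unfolding N(2) by (simp add: paths_def space_PiM)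
    fix i :: nat and A assume "A \<in> sets (count_space states)"
    have "{x \<in> \<Pi>\<^sub>E i\<in>UNIV. space (count_space states). x i \<in> A} =
        (\<Union>l\<in>{l\<in>lists states. length l = Suc i \<and> l ! i \<in> A}. thin l)"
    proof (intro equalityI subsetI)
      fix x assume x: "x \<in> {x \<in> \<Pi>\<^sub>E i\<in>UNIV. space (count_space states). x i \<in> A}"
      then have "x j \<in> states" for j by auto
      then have "map x [0..<Suc i] \<in> lists states"
        unfolding lists_eq_set mem_Collect_eq set_map by blast
      moreover have "x \<in> thin (map x [0..<Suc i])"
        using x by (simp add: thin_def paths_def space_PiM del: upt_Suc)
      ultimately show "x \<in> (\<Union>l\<in>{l\<in>lists states. length l = Suc i \<and> l ! i \<in> A}. thin l)"
        using x by (intro UN_I[of "map x [0..<Suc i]"])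
          (simp_all del: upt_Suc in_lists_conv_set)
    qed (auto simp: thin_def paths_def space_PiM)
    also have "\<dots> \<in> sets ?N"
    proof (rule sets.countable_UN')
      show "countable {l\<in>lists states. length l = Suc i \<and> l ! i \<in> A}"
        by (rule countable_subset[of _ "lists states"]) (use countable_states in auto)
    qed (use C in \<open>auto simp: sets_measure_of\<close>)
    finally show "{x \<in> space ?N. x i \<in> A} \<in> sets ?N"
      unfolding N(2) by (simp add: paths_def space_PiM)
  qed
  then show "sets paths \<subseteq> sigma_sets (space paths) ?C" unfolding N(1) paths_def[symmetric] .
  show "sigma_sets (space paths) ?C \<subseteq> sets paths"
    by (rule sets.sigma_sets_subset) auto
qed

lemma Int_stable_thin: "Int_stable (insert {} (thin ` lists states))"
proof (rule Int_stableI)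
  fix A B assume AB: "A \<in> insert {} (thin ` lists states)" "B \<in> insert {} (thin ` lists states)"
  have "thin l \<inter> thin l' \<in> insert {} (thin ` lists states)" if "l \<in> lists states" "l' \<in> lists states" for l l'
    using thin_mono[of l l'] thin_mono[of l' l] that by (cases "length l \<le> length l'") (auto simp: Int_commute)
  then show "A \<inter> B \<in> insert {} (thin ` lists states)" using AB by auto
qed

lemma step_paths: "s \<in> S \<Longrightarrow> x \<in> space paths \<Longrightarrow> step u s x \<in> space paths"
  by (auto simp: space_paths step_def split: nat.split)

lemma step_measurable [measurable]: "s \<in> S \<Longrightarrow> step u s \<in> measurable paths paths"
proof -
  assume s: "s \<in> S"
  show ?thesis unfolding paths_def
  proof (rule measurable_PiM_single')
    show "step u s \<in> space (PiM UNIV (\<lambda>_. count_space states)) \<rightarrow> (\<Pi>\<^sub>E i\<in>UNIV. space (count_space states))"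
      using step_paths[OF s] by (auto simp: paths_def space_PiM)
    fix i :: nat
    have "(\<lambda>x. step u s x i) \<in> measurable paths (count_space states)"
    proof (cases i)
      case (Suc k)
      have "(\<lambda>a. (push H s (fst a), snd a)) \<in> measurable (count_space states) (count_space states)"
        using s by auto
      from measurable_compose[OF coordinate_measurable this] show ?thesis by (simp add: Suc)
    qed simp
    then show "(\<lambda>x. step u s x i) \<in> measurable (PiM UNIV (\<lambda>_. count_space states)) (count_space states)"
      by (simp add: paths_def)
  qed
qed

lemma measure_path_law:
  "A \<in> sets paths \<Longrightarrow> measure (path_law u) A = measure (P u) {\<omega>\<in>space (P u). (\<lambda>n. X n \<omega>) \<in> A}"
  unfolding path_law_def
  by (subst measure_distr) (auto simp: vimage_def Int_def conj_commute)

lemma thin_single: "measure (path_law u) (thin [a]) = (if a = ([], u) then 1 else 0)"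
proof -
  interpret prob_space "P u" by (rule walk_process)
  note [measurable] = walk_process(2)[of _ u]
  have X0: "Measurable.pred (P u) (\<lambda>\<omega>. X 0 \<omega> = b)" for b
    by (rule measurable_compose[OF walk_process(2)[of 0 u]]) simp
  have eq: "measure (path_law u) (thin [a]) = prob {\<omega>\<in>space (P u). X 0 \<omega> = a}"
    by (subst measure_path_law) (use path_measurable[of u, THEN measurable_space] in
      \<open>auto simp: thin_def intro!: arg_cong[where f=prob]\<close>)
  show ?thesis
  proof (cases "a = ([], u)")
    case False
    have "AE \<omega> in P u. X 0 \<omega> = ([], u)"
      using walk_process(3) X0 by (subst prob_Collect_eq_1[symmetric]) (auto simp: pred_def)
    then have "prob {\<omega>\<in>space (P u). X 0 \<omega> = a} = prob {}"
      by (intro finite_measure_eq_AE) (use False X0 in \<open>auto simp: pred_def\<close>)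
    then show ?thesis using eq False by simp
  qed (use eq walk_process(3) in simp)
qed

lemma inv_Nil [simp]: "inv\<^bsub>G\<^esub> [] = []" and Nil_mult [simp]: "[] \<otimes>\<^bsub>G\<^esub> w = w"
  using G.inv_one by (auto simp: mult_eq_foldr)

definition kern :: "'b letter list \<times> 'r \<Rightarrow> 'b letter list \<times> 'r \<Rightarrow> real" where
  "kern a b = p (inv\<^bsub>G\<^esub> (fst a) \<otimes>\<^bsub>G\<^esub> fst b) $ snd a $ snd b"

lemma thin_snoc:
  assumes "l \<noteq> []" "b \<in> states"
  shows "measure (path_law u) (thin (l @ [b])) = measure (path_law u) (thin l) * kern (last l) b"
proof -
  interpret prob_space "P u" by (rule walk_process)
  define n where "n = length l - 1"
  have n: "length l = Suc n" using assms(1) by (simp add: n_def)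
  have mk: "prob {\<omega> \<in> space (P u). (\<forall>i\<le>n. X i \<omega> = l ! i) \<and> X (Suc n) \<omega> = b} =
        prob {\<omega> \<in> space (P u). \<forall>i\<le>n. X i \<omega> = l ! i} * kern (l ! n) b"
  proof -
    have "\<forall>n x. \<forall>y\<in>states.
        measure (P u) {\<omega> \<in> space (P u). (\<forall>i\<le>n. X i \<omega> = x i) \<and> X (Suc n) \<omega> = y} =
        measure (P u) {\<omega> \<in> space (P u). \<forall>i\<le>n. X i \<omega> = x i} *
          (case x n of (g, u) \<Rightarrow> \<lambda>(h, v). p (inv\<^bsub>G\<^esub> g \<otimes>\<^bsub>G\<^esub> h) $ u $ v) y"
      using law[of u] unfolding walk_law_def markov_chain_def by blast
    from this[rule_format, OF assms(2), of n "\<lambda>i. l ! i"] show ?thesis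
      by (simp add: kern_def case_prod_beta)
  qed
  have lt: "(\<forall>i<Suc (Suc n). Q i) \<longleftrightarrow> (\<forall>i\<le>n. Q i) \<and> Q (Suc n)" for Q
    using less_Suc_eq_le by (auto simp: less_Suc_eq)
  have 1: "measure (path_law u) (thin (l @ [b])) =
      prob {\<omega> \<in> space (P u). (\<forall>i\<le>n. X i \<omega> = l ! i) \<and> X (Suc n) \<omega> = b}"
    by (subst measure_path_law)
      (use path_measurable[of u, THEN measurable_space] n in
        \<open>auto simp: thin_def nth_append lt intro!: arg_cong[where f=prob]\<close>)
  have 2: "measure (path_law u) (thin l) = prob {\<omega> \<in> space (P u). \<forall>i\<le>n. X i \<omega> = l ! i}"
    by (subst measure_path_law)
      (use path_measurable[of u, THEN measurable_space] n in
        \<open>auto simp: thin_def less_Suc_eq_le intro!: arg_cong[where f=prob]\<close>)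
  show ?thesis using 1 2 mk assms(1) n by (simp add: last_conv_nth)
qed

definition shift_state :: "'b letter \<Rightarrow> 'b letter list \<times> 'r \<Rightarrow> 'b letter list \<times> 'r" where
  "shift_state s a = (pull s (fst a), snd a)"

lemma vimage_step_thin:
  assumes "s \<in> S" "set (a # l) \<subseteq> states"
  shows "step u s -` thin (a # l) \<inter> space paths =
    (if a = ([], u) then thin (map (shift_state s) l) else {})"
proof -
  have "step u s x (Suc i) = l ! i \<longleftrightarrow> x i = shift_state s (l ! i)"
    if "x \<in> space paths" "i < length l" for x i
  proof -
    have "l ! i \<in> states" using assms(2) that by auto
    then show ?thesis using that(1) assms(1)
      by (auto simp: shift_state_def space_paths prod_eq_iff) (metis pull_push)
  qed
  moreover have "(\<forall>i<Suc n. Q i) \<longleftrightarrow> Q 0 \<and> (\<forall>i<n. Q (Suc i))" for Q n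
    by (auto simp: less_Suc_eq_0_disj)
  ultimately show ?thesis
    by (auto simp: thin_def step_paths[OF assms(1)] simp del: step_simps(2))
qed

lemma kern_shift:
  assumes "s \<in> S" "a \<in> states" "b \<in> states"
  shows "kern (shift_state s a) (shift_state s b) = kern a b"
proof -
  have "pull s w = inv\<^bsub>G\<^esub> [s] \<otimes>\<^bsub>G\<^esub> w" for w using assms(1) by (simp add: inv_letter)
  moreover have "inv\<^bsub>G\<^esub> (t \<otimes>\<^bsub>G\<^esub> g) \<otimes>\<^bsub>G\<^esub> (t \<otimes>\<^bsub>G\<^esub> h) = inv\<^bsub>G\<^esub> g \<otimes>\<^bsub>G\<^esub> h"
    if "g \<in> carrier G" "h \<in> carrier G" "t \<in> carrier G" for g h t
    using that by (simp add: G.inv_mult_group G.m_assoc G.inv_solve_left' del: carrier_iff)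
  moreover have "inv\<^bsub>G\<^esub> [s] \<in> carrier G" using assms(1) by (simp add: inv_letter)
  ultimately show ?thesis using assms
    by (simp add: kern_def shift_state_def mem_Times_iff del: letter_mult)
qed

lemma one_step_thin:
  assumes "l \<in> lists states"
  shows "measure (path_law u) (thin l) =
    (\<Sum>s\<in>S. \<Sum>c\<in>UNIV. p [s] $ u $ c * measure (path_law c) (step u s -` thin l \<inter> space paths))"
  using assms
proof (induction l rule: rev_induct)
  case Nil
  have [simp]: "thin [] = space paths" by (auto simp: thin_def)
  have [simp]: "measure (path_law c) (space paths) = 1" for c
    using prob_space.prob_space[OF prob_path_law[of c]] by simp
  have "step u s -` space paths \<inter> space paths = space paths" if "s \<in> S" for s
    using step_paths[OF that] by auto
  then show ?case using p_sum[of u] by simp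
next
  case (snoc b l)
  have b: "b \<in> states" and l: "l \<in> lists states" using snoc.prems by auto
  consider "l = []" | a where "l = [a]" | a a' l' where "l = a # a' # l'"
    by (metis neq_Nil_conv)
  then show ?case
  proof cases
    case 1
    have "step u s -` thin [b] \<inter> space paths = (if b = ([], u) then space paths else {})" if "s \<in> S" for s
      using vimage_step_thin[OF that, of b "[]"] b by (auto simp: thin_def)
    moreover have "measure (path_law c) (space paths) = 1" for c
      using prob_space.prob_space[OF prob_path_law[of c]] by simp
    ultimately show ?thesis using 1 p_sum[of u] by (auto simp: thin_single)
  next
    case (2 a)
    obtain g v where gv: "b = (g, v)" "red g" using b by (cases b) auto
    have *: "(\<Sum>s\<in>S. \<Sum>c\<in>UNIV. p [s] $ u $ c * measure (path_law c) (thin [shift_state s b])) = p g $ u $ v"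
    proof -
      have "(\<Sum>c\<in>UNIV. p [s] $ u $ c * measure (path_law c) (thin [shift_state s b])) =
          (if g = [s] then p [s] $ u $ v else 0)" if "s \<in> S" for s
      proof -
        have "shift_state s b = ([], c) \<longleftrightarrow> g = [s] \<and> v = c" for c
          using pull_eq_Nil_iff[OF that gv(2)] gv(1) by (simp add: shift_state_def)
        then show ?thesis by (simp add: thin_single if_distrib[of "\<lambda>z. _ * z"] sum.delta cong: if_cong)
      qed
      then have "(\<Sum>s\<in>S. \<Sum>c\<in>UNIV. p [s] $ u $ c * measure (path_law c) (thin [shift_state s b])) =
        (\<Sum>s\<in>S. if g = [s] then p [s] $ u $ v else 0)" by simp
      also have "\<dots> = p g $ u $ v"
      proof (cases "\<exists>s\<in>S. g = [s]")
        case True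
        then show ?thesis using finite_letters by (auto simp: sum.delta' cong: if_cong)
      next
        case False
        then show ?thesis using p_eq_0[OF gv(2)] by (auto simp: image_iff)
      qed
      finally show ?thesis .
    qed
    have "measure (path_law u) (thin [a, b]) = (if a = ([], u) then p g $ u $ v else 0)"
      using thin_snoc[of "[a]" b u] b gv by (auto simp: thin_single kern_def)
    also have "\<dots> = (\<Sum>s\<in>S. \<Sum>c\<in>UNIV. p [s] $ u $ c * measure (path_law c) (step u s -` thin [a, b] \<inter> space paths))"
      using l b * 2 by (simp add: vimage_step_thin)
    finally show ?thesis using 2 by simp
  next
    case (3 a a' l')
    have st: "step u s -` thin (l @ [b]) \<inter> space paths =
        (if a = ([], u) then thin (map (shift_state s) (a' # l') @ [shift_state s b]) else {})"
      "step u s -` thin l \<inter> space paths =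
        (if a = ([], u) then thin (map (shift_state s) (a' # l')) else {})" if "s \<in> S" for s
      using vimage_step_thin[OF that, of a "a' # l' @ [b]" u] vimage_step_thin[OF that, of a "a' # l'" u]
        3 l b by (simp_all add: lists_eq_set)
    have "measure (path_law c) (thin (map (shift_state s) (a' # l') @ [shift_state s b])) =
        measure (path_law c) (thin (map (shift_state s) (a' # l'))) * kern (last l) b"
      if "s \<in> S" for s c
    proof -
      have "last l \<in> states" using l 3 by (metis in_listsD last_in_set list.discI)
      moreover have "last (map (shift_state s) (a' # l')) = shift_state s (last l)"
        using 3 by (metis last_ConsR last_map list.discI)
      moreover have "shift_state s b \<in> states" using b that by (auto simp: shift_state_def)
      ultimately show ?thesis using kern_shift[OF that _ b] by (subst thin_snoc) auto
    qed
    then have "(\<Sum>s\<in>S. \<Sum>c\<in>UNIV. p [s] $ u $ c * measure (path_law c) (step u s -` thin (l @ [b]) \<inter> space paths))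
        = (\<Sum>s\<in>S. \<Sum>c\<in>UNIV. p [s] $ u $ c * measure (path_law c) (step u s -` thin l \<inter> space paths)) * kern (last l) b"
      by (cases "a = ([], u)") (simp_all add: st sum_distrib_right mult.assoc cong: sum.cong)
    then show ?thesis using snoc.IH[OF l] thin_snoc[OF _ b, of l u] 3 by auto
  qed
qed

text \<open>
  The Markov property at time \<open>1\<close>, combined with invariance under translation: after the first step
  to \<open>s\<close> the walk, seen from \<open>s\<close>, again starts at the identity. Later times are reached by induction.
\<close>

theorem one_step:
  assumes "A \<in> sets paths"
  shows "measure (path_law u) A =
    (\<Sum>s\<in>S. \<Sum>c\<in>UNIV. p [s] $ u $ c * measure (path_law c) (step u s -` A \<inter> space paths))"
proof -
  have "insert {} (thin ` lists states) \<subseteq> Pow (space paths)" by (auto simp: thin_def)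
  from Int_stable_thin this assms[unfolded sets_paths] show ?thesis
  proof (induction rule: sigma_sets_induct_disjoint)
    case (basic A)
    then show ?case using one_step_thin by auto
  next
    case empty
    show ?case by simp
  next
    case (compl A)
    have A[measurable]: "A \<in> sets paths" using compl(1) by (simp add: sets_paths)
    have pr: "measure (path_law c) (space paths - B) = 1 - measure (path_law c) B" if "B \<in> sets paths" for B c
      using prob_space.prob_compl[OF prob_path_law[of c], of B] that by simp
    have "step u s -` (space paths - A) \<inter> space paths = space paths - (step u s -` A \<inter> space paths)"
      if "s \<in> S" for s using step_paths[OF that] by auto
    then have "measure (path_law c) (step u s -` (space paths - A) \<inter> space paths) =
        1 - measure (path_law c) (step u s -` A \<inter> space paths)" if "s \<in> S" for s c
      using pr[of "step u s -` A \<inter> space paths" c] measurable_sets[OF step_measurable[OF that] A] that by simp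
    then show ?case using p_sum[of u] compl(2) pr[OF A]
      by (simp add: right_diff_distrib sum_subtractf cong: sum.cong)
  next
    case (union A)
    have A[measurable]: "A i \<in> sets paths" for i using union(2) by (auto simp: sets_paths)
    interpret L: prob_space "path_law c" for c by (rule prob_path_law)
    have "(\<lambda>i. measure (path_law u) (A i)) sums measure (path_law u) (\<Union> (range A))"
      by (rule L.finite_measure_UNION) (use A union(1) in auto)
    moreover have "(\<lambda>i. measure (path_law c) (step u s -` A i \<inter> space paths)) sums
        measure (path_law c) (step u s -` \<Union> (range A) \<inter> space paths)" if s: "s \<in> S" for s c
    proof -
      have "step u s -` \<Union> (range A) \<inter> space paths = (\<Union>i. step u s -` A i \<inter> space paths)" by auto
      moreover have "range (\<lambda>i. step u s -` A i \<inter> space paths) \<subseteq> sets (path_law c)"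
        using measurable_sets[OF step_measurable[OF s] A] by auto
      moreover have "disjoint_family (\<lambda>i. step u s -` A i \<inter> space paths)"
        using union(1) unfolding disjoint_family_on_def by blast
      ultimately show ?thesis using L.finite_measure_UNION[of "\<lambda>i. step u s -` A i \<inter> space paths" c]
        by simp
    qed
    then have "(\<lambda>i. \<Sum>s\<in>S. \<Sum>c\<in>UNIV. p [s] $ u $ c * measure (path_law c) (step u s -` A i \<inter> space paths)) sums
        (\<Sum>s\<in>S. \<Sum>c\<in>UNIV. p [s] $ u $ c * measure (path_law c) (step u s -` \<Union> (range A) \<inter> space paths))"
      by (intro sums_sum sums_mult)
    ultimately show ?case using union(3) sums_unique2 by simp
  qed
qed

section \<open>Events of the walk\<close>

definition path_prob :: "'r \<Rightarrow> ((nat \<Rightarrow> 'b letter list \<times> 'r) \<Rightarrow> bool) \<Rightarrow> real" where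
  "path_prob u Q = measure (path_law u) {x\<in>space paths. Q x}"

lemma one_step_pred:
  assumes Q[measurable]: "Measurable.pred paths Q"
  shows "path_prob u Q = (\<Sum>s\<in>S. \<Sum>c\<in>UNIV. p [s] $ u $ c * path_prob c (\<lambda>x. Q (step u s x)))"
proof -
  have "step u s -` {x\<in>space paths. Q x} \<inter> space paths = {x\<in>space paths. Q (step u s x)}" if "s \<in> S" for s
    using step_paths[OF that] by auto
  then show ?thesis unfolding path_prob_def by (subst one_step) (auto intro!: sum.cong)
qed

lemma pred_step [measurable (raw)]:
  "s \<in> S \<Longrightarrow> Measurable.pred paths Q \<Longrightarrow> Measurable.pred paths (\<lambda>x. Q (step u s x))"
  by (rule measurable_compose[OF step_measurable])

lemma path_prob_cong_AE:
  assumes "AE x in path_law u. Q x \<longleftrightarrow> R x" "Measurable.pred paths Q" "Measurable.pred paths R"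
  shows "path_prob u Q = path_prob u R"
  unfolding path_prob_def
  by (rule measure_eq_AE) (use assms in \<open>auto simp: pred_def elim!: AE_mp\<close>)

lemma path_prob_cong: "(\<And>x. x \<in> space paths \<Longrightarrow> Q x \<longleftrightarrow> R x) \<Longrightarrow> path_prob u Q = path_prob u R"
  unfolding path_prob_def by (metis (mono_tags, lifting) Collect_cong)

lemma path_prob_nonneg: "0 \<le> path_prob u Q"
  by (simp add: path_prob_def)

lemma path_prob_True: "path_prob u (\<lambda>x. True) = 1"
  using prob_space.prob_space[OF prob_path_law[of u]] by (simp add: path_prob_def)

lemma path_prob_False: "path_prob u (\<lambda>x. False) = 0"
  by (simp add: path_prob_def)

lemma path_prob_mono:
  assumes "\<And>x. x \<in> space paths \<Longrightarrow> Q x \<Longrightarrow> R x" "Measurable.pred paths R"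
  shows "path_prob u Q \<le> path_prob u R"
proof -
  interpret prob_space "path_law u" by (rule prob_path_law)
  show ?thesis unfolding path_prob_def
    by (rule finite_measure_mono) (use assms in \<open>auto simp: pred_def\<close>)
qed

lemma AE_iff_path_prob: "Measurable.pred paths Q \<Longrightarrow> (AE x in path_law u. Q x) \<longleftrightarrow> path_prob u (\<lambda>x. \<not> Q x) = 0"
proof -
  assume Q[measurable]: "Measurable.pred paths Q"
  interpret prob_space "path_law u" by (rule prob_path_law)
  have "(AE x in path_law u. Q x) \<longleftrightarrow> prob {x\<in>space paths. Q x} = 1"
    using prob_Collect_eq_1[of Q] by simp
  also have "\<dots> \<longleftrightarrow> prob {x\<in>space paths. \<not> Q x} = 0"
    using prob_neg[of Q] by (auto simp: pred_def)
  finally show ?thesis by (simp add: path_prob_def)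
qed

lemma path_prob_sum:
  assumes "finite I" "\<And>i. i \<in> I \<Longrightarrow> Measurable.pred paths (Q i)"
    "\<And>i j x. x \<in> space paths \<Longrightarrow> i \<in> I \<Longrightarrow> j \<in> I \<Longrightarrow> Q i x \<Longrightarrow> Q j x \<Longrightarrow> i = j"
  shows "path_prob u (\<lambda>x. \<exists>i\<in>I. Q i x) = (\<Sum>i\<in>I. path_prob u (Q i))"
proof -
  interpret prob_space "path_law u" by (rule prob_path_law)
  have "{x\<in>space paths. \<exists>i\<in>I. Q i x} = (\<Union>i\<in>I. {x\<in>space paths. Q i x})" by auto
  moreover have "prob (\<Union>i\<in>I. {x\<in>space paths. Q i x}) = (\<Sum>i\<in>I. prob {x\<in>space paths. Q i x})"
    by (rule finite_measure_finite_Union)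
      (use assms in \<open>auto simp: pred_def disjoint_family_on_def\<close>)
  ultimately show ?thesis by (simp add: path_prob_def)
qed

lemma path_prob_incseq:
  assumes Q[measurable]: "\<And>n::nat. Measurable.pred paths (Q n)"
    and mono: "\<And>m n x. m \<le> n \<Longrightarrow> Q m x \<Longrightarrow> Q n x"
  shows "(\<lambda>n. path_prob u (Q n)) \<longlonglongrightarrow> path_prob u (\<lambda>x. \<exists>n. Q n x)"
proof -
  interpret prob_space "path_law u" by (rule prob_path_law)
  have "(\<lambda>n. prob {x\<in>space paths. Q n x}) \<longlonglongrightarrow> prob (\<Union>n. {x\<in>space paths. Q n x})"
    by (rule finite_Lim_measure_incseq) (auto simp: incseq_def mono)
  moreover have "(\<Union>n. {x\<in>space paths. Q n x}) = {x\<in>space paths. \<exists>n. Q n x}" by auto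
  ultimately show ?thesis by (simp add: path_prob_def)
qed

lemma AE_start: "AE x in path_law u. x 0 = ([], u)"
proof -
  have "path_prob u (\<lambda>x. x 0 \<noteq> ([], u)) = 0"
    by (subst one_step_pred) (auto simp: path_prob_False)
  then show ?thesis by (subst AE_iff_path_prob) auto
qed

abbreviation word_limit :: "(nat \<Rightarrow> 'b letter list \<times> 'r) \<Rightarrow> 'b letter stream \<Rightarrow> bool" where
  "word_limit x \<equiv> converges_to (\<lambda>n. fst (x n))"

lemma pred_converges [measurable]: "Measurable.pred paths (\<lambda>x. \<exists>\<xi>\<in>bdry. word_limit x \<xi>)"
proof -
  have [measurable]: "Measurable.pred paths (\<lambda>x. \<exists>v\<in>{v. red v \<and> length v = k}.
      \<forall>\<^sub>F n in sequentially. prefix v (fst (x n)))" for k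
    by (rule pred_intros_finite(4)[OF finite_words]) measurable
  show ?thesis unfolding converges_to_iff by measurable
qed

lemma AE_converges: "AE x in path_law u. \<exists>\<xi>\<in>bdry. word_limit x \<xi>"
  unfolding path_law_def using converges
  by (subst AE_distr_iff) (auto simp flip: pred_def)

lemma pred_two_coordinates: "Measurable.pred paths (\<lambda>x. Q (x i) (x j))"
proof -
  have "{x\<in>space paths. Q (x i) (x j)} = (\<Union>a\<in>states. {x\<in>space paths. x i = a \<and> Q a (x j)})"
    by (auto simp: space_paths mem_Times_iff)
  also have "\<dots> \<in> sets paths" by (rule sets.countable_UN'[OF countable_states]) auto
  finally show ?thesis by (simp add: pred_def)
qed

lemma AE_nearest_neighbour:
  "AE x in path_law u. \<forall>n. \<exists>t\<in>S. fst (x (Suc n)) = fst (x n) \<otimes>\<^bsub>G\<^esub> [t]"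
proof -
  define bad where "bad n x \<longleftrightarrow> (\<forall>t\<in>S. fst (x (Suc n)) \<noteq> fst (x n) \<otimes>\<^bsub>G\<^esub> [t])"
    for n and x :: "nat \<Rightarrow> 'b letter list \<times> 'r"
  have [measurable]: "Measurable.pred paths (bad n)" for n
    unfolding bad_def by (rule pred_two_coordinates)
  have "path_prob u (bad n) = 0" for u n
  proof (induction n arbitrary: u)
    case 0
    have "path_prob c (\<lambda>x. bad 0 (step u s x)) = path_prob c (\<lambda>x. False)" if s: "s \<in> S" for s c
    proof (rule path_prob_cong_AE)
      show "AE x in path_law c. bad 0 (step u s x) \<longleftrightarrow> False"
        using AE_start[of c] by eventually_elim (use s in \<open>auto simp: bad_def\<close>)
    qed (use s in measurable)
    then show ?case by (subst one_step_pred) (auto simp: path_prob_False)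
  next
    case (Suc n)
    have "path_prob c (\<lambda>x. bad (Suc n) (step u s x)) = path_prob c (bad n)" if s: "s \<in> S" for s c
    proof (rule path_prob_cong)
      fix x assume x: "x \<in> space paths"
      have "push H s w = push H s v \<otimes>\<^bsub>G\<^esub> [t] \<longleftrightarrow> w = v \<otimes>\<^bsub>G\<^esub> [t]"
        if "red w" "red v" "t \<in> S" for w v t
      proof -
        have "push H s v \<otimes>\<^bsub>G\<^esub> [t] = push H s (v \<otimes>\<^bsub>G\<^esub> [t])"
          using G.m_assoc[of "[s]" v "[t]"] s that by simp
        then show ?thesis using s that pull_push G.m_closed by (metis carrier_iff red_single)
      qed
      then show "bad (Suc n) (step u s x) \<longleftrightarrow> bad n x"
        using x by (auto simp: bad_def space_paths)
    qed
    then show ?case using Suc by (subst one_step_pred) auto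
  qed
  then have "AE x in path_law u. \<not> bad n x" for n by (subst AE_iff_path_prob) auto
  then have "AE x in path_law u. \<forall>n. \<not> bad n x" by (simp add: AE_all_countable)
  then show ?thesis by eventually_elim (auto simp: bad_def)
qed

section \<open>First passages\<close>

definition hit_at :: "'b letter list \<Rightarrow> 'r \<Rightarrow> nat \<Rightarrow> (nat \<Rightarrow> 'b letter list \<times> 'r) \<Rightarrow> bool" where
  "hit_at w v n x \<longleftrightarrow> x n = (w, v) \<and> (\<forall>i<n. fst (x i) \<noteq> w)"

definition hit_by :: "'b letter list \<Rightarrow> 'r \<Rightarrow> nat \<Rightarrow> (nat \<Rightarrow> 'b letter list \<times> 'r) \<Rightarrow> bool" where
  "hit_by w v n x \<longleftrightarrow> (\<exists>k\<le>n. hit_at w v k x)"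

definition hit :: "'b letter list \<Rightarrow> 'r \<Rightarrow> (nat \<Rightarrow> 'b letter list \<times> 'r) \<Rightarrow> bool" where
  "hit w v x \<longleftrightarrow> (\<exists>n. hit_at w v n x)"

lemma pred_hit [measurable]:
  "Measurable.pred paths (hit_at w v n)" "Measurable.pred paths (hit_by w v n)" "Measurable.pred paths (hit w v)"
  unfolding hit_at_def hit_by_def hit_def by measurable

lemma hit_by_hit: "hit w v x \<longleftrightarrow> (\<exists>n. hit_by w v n x)"
  by (auto simp: hit_def hit_by_def)

lemma hit_at_unique: "hit_at w v n x \<Longrightarrow> hit_at w v' n' x \<Longrightarrow> n = n' \<and> v = v'"
  unfolding hit_at_def by (metis fst_conv linorder_neqE_nat prod.inject)

lemma hit_step:
  assumes "s \<in> S" "x \<in> space paths" "red w" "w \<noteq> []"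
  shows "\<not> hit_by w v 0 (step u s x)"
    "hit_by w v (Suc n) (step u s x) \<longleftrightarrow> hit_by (pull s w) v n x"
    "hit w v (step u s x) \<longleftrightarrow> hit (pull s w) v x"
proof -
  have eq: "push H s (fst (x k)) = w \<longleftrightarrow> fst (x k) = pull s w" for k
    using assms by (auto simp: space_paths)
  have 0: "\<not> hit_at w v 0 (step u s x)" using assms by (simp add: hit_at_def)
  have S: "hit_at w v (Suc n) (step u s x) \<longleftrightarrow> hit_at (pull s w) v n x" for n
  proof -
    have "(\<forall>i<Suc n. fst (step u s x i) \<noteq> w) \<longleftrightarrow> (\<forall>i<n. fst (x i) \<noteq> pull s w)"
      unfolding All_less_Suc2 using assms(4) eq by simp
    then show ?thesis using eq by (simp add: hit_at_def prod_eq_iff)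
  qed
  show "\<not> hit_by w v 0 (step u s x)" using 0 by (simp add: hit_by_def)
  show "hit_by w v (Suc n) (step u s x) \<longleftrightarrow> hit_by (pull s w) v n x"
    unfolding hit_by_def using 0 S by (metis Suc_le_mono not0_implies_Suc)
  show "hit w v (step u s x) \<longleftrightarrow> hit (pull s w) v x"
    unfolding hit_def using 0 S by (metis not0_implies_Suc)
qed

lemma hit_Nil: "x 0 = ([], u) \<Longrightarrow> hit_at [] v n x \<longleftrightarrow> n = 0 \<and> v = u"
  by (cases n) (auto simp: hit_at_def)

text \<open>
  First-passage decomposition at \<open>w\<close>: what the walk does in the end, seen from \<open>w\<close>, is
  independent of how it got to \<open>w\<close>. The event in question does not notice the deletion of finitely
  many initial steps of the path, which lets the induction on \<open>n\<close> go through.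
\<close>

lemma hit_by_eventually:
  assumes "red w"
  shows "path_prob u (\<lambda>x. hit_by w v n x \<and> (\<forall>\<^sub>F k in sequentially. Q (inv\<^bsub>G\<^esub> w \<otimes>\<^bsub>G\<^esub> fst (x k)))) =
    path_prob u (hit_by w v n) * path_prob v (\<lambda>x. \<forall>\<^sub>F k in sequentially. Q (fst (x k)))"
  using assms
proof (induction n arbitrary: u w)
  case (0 u w)
  show ?case
  proof (cases "w = []")
    case True
    have "AE x in path_law u. hit_by w v 0 x \<longleftrightarrow> v = u"
      using AE_start[of u] by eventually_elim (auto simp: hit_by_def hit_Nil True)
    then have "path_prob u (\<lambda>x. hit_by w v 0 x \<and> (\<forall>\<^sub>F k in sequentially. Q (inv\<^bsub>G\<^esub> w \<otimes>\<^bsub>G\<^esub> fst (x k)))) =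
        path_prob u (\<lambda>x. v = u \<and> (\<forall>\<^sub>F k in sequentially. Q (fst (x k))))"
      "path_prob u (hit_by w v 0) = path_prob u (\<lambda>x. v = u)"
      by (auto intro!: path_prob_cong_AE simp: True)
    then show ?thesis by (cases "v = u") (auto simp: path_prob_True path_prob_False)
  next
    case False
    have "path_prob u (\<lambda>x. hit_by w v 0 x \<and> R x) = 0" if [measurable]: "Measurable.pred paths R" for R
      using hit_step(1)[OF _ _ 0 False]
      by (subst one_step_pred) (auto intro!: sum.neutral path_prob_cong[THEN trans, OF _ path_prob_False])
    from this[of "\<lambda>x. True"] this show ?thesis by simp
  qed
next
  case (Suc n u w)
  show ?case
  proof (cases "w = []")
    case True
    have "AE x in path_law u. hit_by w v (Suc n) x \<longleftrightarrow> v = u"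
      using AE_start[of u] by eventually_elim (auto simp: hit_by_def hit_Nil True)
    then have "path_prob u (\<lambda>x. hit_by w v (Suc n) x \<and> (\<forall>\<^sub>F k in sequentially. Q (inv\<^bsub>G\<^esub> w \<otimes>\<^bsub>G\<^esub> fst (x k)))) =
        path_prob u (\<lambda>x. v = u \<and> (\<forall>\<^sub>F k in sequentially. Q (fst (x k))))"
      "path_prob u (hit_by w v (Suc n)) = path_prob u (\<lambda>x. v = u)"
      by (auto intro!: path_prob_cong_AE simp: True)
    then show ?thesis by (cases "v = u") (auto simp: path_prob_True path_prob_False)
  next
    case False
    have eq: "inv\<^bsub>G\<^esub> w \<otimes>\<^bsub>G\<^esub> push H s y = inv\<^bsub>G\<^esub> (pull s w) \<otimes>\<^bsub>G\<^esub> y" if "s \<in> S" "red y" for s y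
    proof -
      have "pull s w = inv\<^bsub>G\<^esub> [s] \<otimes>\<^bsub>G\<^esub> w" using that by (simp add: inv_letter)
      moreover have "inv\<^bsub>G\<^esub> (inv\<^bsub>G\<^esub> [s] \<otimes>\<^bsub>G\<^esub> w) = inv\<^bsub>G\<^esub> w \<otimes>\<^bsub>G\<^esub> [s]"
        using that Suc.prems by (subst G.inv_mult_group) (auto simp: inv_letter)
      moreover have "red (inv\<^bsub>G\<^esub> w)" using Suc.prems G.inv_closed by simp
      then have "inv\<^bsub>G\<^esub> w \<otimes>\<^bsub>G\<^esub> [s] \<otimes>\<^bsub>G\<^esub> y = inv\<^bsub>G\<^esub> w \<otimes>\<^bsub>G\<^esub> ([s] \<otimes>\<^bsub>G\<^esub> y)"
        using that by (intro G.m_assoc) (auto simp: inv_letter)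
      ultimately show ?thesis by simp
    qed
    have "path_prob u (\<lambda>x. hit_by w v (Suc n) x \<and> (\<forall>\<^sub>F k in sequentially. Q (inv\<^bsub>G\<^esub> w \<otimes>\<^bsub>G\<^esub> fst (x k)))) =
      (\<Sum>s\<in>S. \<Sum>c\<in>UNIV. p [s] $ u $ c * path_prob c (\<lambda>x. hit_by (pull s w) v n x \<and>
         (\<forall>\<^sub>F k in sequentially. Q (inv\<^bsub>G\<^esub> (pull s w) \<otimes>\<^bsub>G\<^esub> fst (x k)))))"
    proof (subst one_step_pred, measurable, intro sum.cong refl arg_cong2[where f="(*)"] path_prob_cong)
      fix s c x assume "s \<in> S" "x \<in> space paths"
      then show "hit_by w v (Suc n) (step u s x) \<and>
          (\<forall>\<^sub>F k in sequentially. Q (inv\<^bsub>G\<^esub> w \<otimes>\<^bsub>G\<^esub> fst (step u s x k))) \<longleftrightarrow>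
          hit_by (pull s w) v n x \<and>
          (\<forall>\<^sub>F k in sequentially. Q (inv\<^bsub>G\<^esub> (pull s w) \<otimes>\<^bsub>G\<^esub> fst (x k)))"
        using hit_step(2)[OF _ _ Suc.prems False]
        by (subst eventually_sequentially_Suc[symmetric]) (auto simp: eq space_paths)
    qed
    also have "\<dots> = (\<Sum>s\<in>S. \<Sum>c\<in>UNIV. p [s] $ u $ c * path_prob c (hit_by (pull s w) v n)) *
        path_prob v (\<lambda>x. \<forall>\<^sub>F k in sequentially. Q (fst (x k)))"
      using Suc.IH Suc.prems by (simp add: sum_distrib_right mult.assoc)
    also have "(\<Sum>s\<in>S. \<Sum>c\<in>UNIV. p [s] $ u $ c * path_prob c (hit_by (pull s w) v n)) = path_prob u (hit_by w v (Suc n))"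
      using hit_step(2)[OF _ _ Suc.prems False]
      by (subst one_step_pred[of "hit_by w v (Suc n)"])
        (auto intro!: sum.cong arg_cong2[where f="(*)"] path_prob_cong)
    finally show ?thesis .
  qed
qed

definition passage_by :: "nat \<Rightarrow> 'b letter list \<Rightarrow> real^'r^'r" where
  "passage_by n w = (\<chi> u v. path_prob u (hit_by w v n))"

definition passage :: "'b letter list \<Rightarrow> real^'r^'r" where
  "passage w = (\<chi> u v. path_prob u (hit w v))"

lemma passage_Nil: "passage_by n [] = mat 1" "passage [] = mat 1"
proof -
  have "AE x in path_law u. hit_by [] v n x \<longleftrightarrow> v = u" "AE x in path_law u. hit [] v x \<longleftrightarrow> v = u" for u v n
    using AE_start[of u] by (eventually_elim, auto simp: hit_by_def hit_def hit_Nil)+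
  then have "path_prob u (hit_by [] v n) = path_prob u (\<lambda>x. v = u)" "path_prob u (hit [] v) = path_prob u (\<lambda>x. v = u)" for u v n
    by (auto intro!: path_prob_cong_AE)
  then show "passage_by n [] = mat 1" "passage [] = mat 1"
    by (auto simp: passage_by_def passage_def mat_def vec_eq_iff path_prob_True path_prob_False)
qed

lemma passage_by_0: "red w \<Longrightarrow> w \<noteq> [] \<Longrightarrow> passage_by 0 w = 0"
proof -
  assume w: "red w" "w \<noteq> []"
  have "path_prob u (hit_by w v 0) = 0" for u v
    using hit_step(1)[OF _ _ w]
    by (subst one_step_pred) (auto intro!: sum.neutral path_prob_cong[THEN trans, OF _ path_prob_False])
  then show ?thesis by (simp add: passage_by_def vec_eq_iff)
qed

lemma passage_by_Suc:
  "red w \<Longrightarrow> w \<noteq> [] \<Longrightarrow> passage_by (Suc n) w = (\<Sum>s\<in>S. p [s] ** passage_by n (pull s w))"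
proof -
  assume w: "red w" "w \<noteq> []"
  show ?thesis using hit_step(2)[OF _ _ w]
    by (auto simp: vec_eq_iff matrix_matrix_mult_def passage_by_def one_step_pred[of "hit_by w _ (Suc n)"]
      intro!: sum.cong arg_cong2[where f="(*)"] path_prob_cong)
qed

lemma passage_step:
  "red w \<Longrightarrow> w \<noteq> [] \<Longrightarrow> passage w = (\<Sum>s\<in>S. p [s] ** passage (pull s w))"
proof -
  assume w: "red w" "w \<noteq> []"
  show ?thesis using hit_step(3)[OF _ _ w]
    by (auto simp: vec_eq_iff matrix_matrix_mult_def passage_def one_step_pred[of "hit w _"]
      intro!: sum.cong arg_cong2[where f="(*)"] path_prob_cong)
qed

lemma hit_by_mono: "k \<le> n \<Longrightarrow> hit_by w v k x \<Longrightarrow> hit_by w v n x"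
  unfolding hit_by_def using le_trans by blast

lemma passage_limit: "(\<lambda>n. passage_by n w $ u $ v) \<longlonglongrightarrow> passage w $ u $ v"
proof -
  have "(\<lambda>n. path_prob u (hit_by w v n)) \<longlonglongrightarrow> path_prob u (\<lambda>x. \<exists>n. hit_by w v n x)"
  proof (rule path_prob_incseq)
    show "hit_by w v n x" if "m \<le> n" "hit_by w v m x" for m n x using that by (rule hit_by_mono)
  qed (rule pred_hit)
  then show ?thesis by (simp add: passage_by_def passage_def hit_by_hit[abs_def])
qed

text \<open>
  This is \<open>\<Delta>\<^sub>g(u, u)\<close>. The walk almost surely leaves the identity for good; admitting the empty word
  makes the event literally the translate by \<open>w\<close> of ending in the cone of \<open>w\<close>, if \<open>g\<close> is the last
  letter of \<open>w\<close>.
\<close>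

definition exit_prob :: "'b letter \<Rightarrow> 'r \<Rightarrow> real" where
  "exit_prob g u = path_prob u (\<lambda>x. \<forall>\<^sub>F k in sequentially. fst (x k) = [] \<or> hd (fst (x k)) \<in> nexts g)"

definition cone_prob :: "'b letter list \<Rightarrow> 'r \<Rightarrow> real" where
  "cone_prob w u = path_prob u (\<lambda>x. \<forall>\<^sub>F k in sequentially. prefix w (fst (x k)))"

lemma hit_cone:
  assumes "red w" "w \<noteq> []"
  shows "path_prob u (\<lambda>x. hit w v x \<and> (\<forall>\<^sub>F k in sequentially. prefix w (fst (x k)))) =
    passage w $ u $ v * exit_prob (last w) v"
proof -
  let ?Q = "\<lambda>y. y = [] \<or> hd y \<in> nexts (last w)"
  have Q: "?Q (inv\<^bsub>G\<^esub> w \<otimes>\<^bsub>G\<^esub> y) \<longleftrightarrow> prefix w y" if "red y" for y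
  proof -
    have "red (inv\<^bsub>G\<^esub> w)" using assms G.inv_closed by simp
    then have "red (inv\<^bsub>G\<^esub> w \<otimes>\<^bsub>G\<^esub> y)" using that G.m_closed by simp
    moreover have "w \<otimes>\<^bsub>G\<^esub> (inv\<^bsub>G\<^esub> w \<otimes>\<^bsub>G\<^esub> y) = y"
      using assms that \<open>red (inv\<^bsub>G\<^esub> w)\<close> G.m_assoc[of w "inv\<^bsub>G\<^esub> w" y] G.r_inv[of w] by simp
    ultimately show ?thesis using prefix_mult_iff[OF assms, of "inv\<^bsub>G\<^esub> w \<otimes>\<^bsub>G\<^esub> y"] by simp
  qed
  have "path_prob u (\<lambda>x. hit_by w v n x \<and> (\<forall>\<^sub>F k in sequentially. prefix w (fst (x k)))) =
      passage_by n w $ u $ v * exit_prob (last w) v" for n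
    using hit_by_eventually[OF assms(1), of u v n ?Q]
    by (simp add: passage_by_def exit_prob_def)
      (subst (asm) path_prob_cong[of _ "\<lambda>x. hit_by w v n x \<and> (\<forall>\<^sub>F k in sequentially. prefix w (fst (x k)))"],
        auto simp: space_paths Q)
  then have "(\<lambda>n. path_prob u (\<lambda>x. hit_by w v n x \<and> (\<forall>\<^sub>F k in sequentially. prefix w (fst (x k)))))
      \<longlonglongrightarrow> passage w $ u $ v * exit_prob (last w) v"
    using tendsto_mult_right[OF passage_limit] by simp
  moreover have "(\<lambda>n. path_prob u (\<lambda>x. hit_by w v n x \<and> (\<forall>\<^sub>F k in sequentially. prefix w (fst (x k)))))
      \<longlonglongrightarrow> path_prob u (\<lambda>x. \<exists>n. hit_by w v n x \<and> (\<forall>\<^sub>F k in sequentially. prefix w (fst (x k))))"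
  proof (rule path_prob_incseq)
    show "Measurable.pred paths (\<lambda>x. hit_by w v n x \<and> (\<forall>\<^sub>F k in sequentially. prefix w (fst (x k))))" for n
      by measurable
    fix m n x
    assume "m \<le> n" "hit_by w v m x \<and> (\<forall>\<^sub>F k in sequentially. prefix w (fst (x k)))"
    then show "hit_by w v n x \<and> (\<forall>\<^sub>F k in sequentially. prefix w (fst (x k)))"
      using hit_by_mono by auto
  qed
  ultimately show ?thesis by (simp add: hit_by_hit LIMSEQ_unique)
qed

lemma AE_cone_hit:
  assumes "w \<noteq> []"
  shows "AE x in path_law u. (\<forall>\<^sub>F k in sequentially. prefix w (fst (x k))) \<longrightarrow> (\<exists>v. hit w v x)"
proof -
  have "AE x in path_law u. x \<in> space paths" using AE_space[of "path_law u"] by simp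
  then show ?thesis using AE_start[of u] AE_nearest_neighbour[of u]
  proof eventually_elim
    case (elim x)
    show ?case
    proof
      assume "\<forall>\<^sub>F k in sequentially. prefix w (fst (x k))"
      then obtain k where "prefix w (fst (x k))"
        using eventually_happens' sequentially_bot by blast
      then have "\<exists>k. fst (x k) = w"
      proof (induction k)
        case 0
        then show ?case using elim(2) assms by simp
      next
        case (Suc k)
        obtain t where t: "t \<in> S" "fst (x (Suc k)) = fst (x k) \<otimes>\<^bsub>G\<^esub> [t]" using elim(3) by blast
        have "fst (x (Suc k)) = w" if "\<not> prefix w (fst (x k))"
          using enter_cone[of "fst (x k)" t w] t Suc.prems that elim(1) assms by (simp add: space_paths)
        then show ?case using Suc.IH by blast
      qed
      define n where "n = (LEAST k. fst (x k) = w)"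
      have "hit_at w (snd (x n)) n x"
        unfolding hit_at_def n_def prod_eq_iff
        using LeastI_ex[OF \<open>\<exists>k. fst (x k) = w\<close>] by (auto dest: not_less_Least)
      then show "\<exists>v. hit w v x" by (auto simp: hit_def)
    qed
  qed
qed

lemma cone_prob_eq:
  assumes "red w" "w \<noteq> []"
  shows "cone_prob w u = (\<Sum>v\<in>UNIV. passage w $ u $ v * exit_prob (last w) v)"
proof -
  have "cone_prob w u = path_prob u (\<lambda>x. \<exists>v\<in>UNIV. hit w v x \<and> (\<forall>\<^sub>F k in sequentially. prefix w (fst (x k))))"
    unfolding cone_prob_def using AE_cone_hit[OF assms(2), of u] by (intro path_prob_cong_AE) auto
  also have "\<dots> = (\<Sum>v\<in>UNIV. path_prob u (\<lambda>x. hit w v x \<and> (\<forall>\<^sub>F k in sequentially. prefix w (fst (x k)))))"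
  proof (rule path_prob_sum)
    fix v v' x
    assume "hit w v x \<and> (\<forall>\<^sub>F k in sequentially. prefix w (fst (x k)))"
      "hit w v' x \<and> (\<forall>\<^sub>F k in sequentially. prefix w (fst (x k)))"
    then show "v = v'" unfolding hit_def using hit_at_unique by blast
  qed auto
  finally show ?thesis by (simp add: hit_cone[OF assms])
qed

lemma AE_first_letter:
  "AE x in path_law u. (\<forall>\<^sub>F k in sequentially. fst (x k) = [] \<or> hd (fst (x k)) \<in> A) \<longleftrightarrow>
     (\<exists>h\<in>A. \<forall>\<^sub>F k in sequentially. prefix [h] (fst (x k)))"
  using AE_converges[of u]
proof eventually_elim
  case (elim x)
  then obtain \<xi> where \<xi>: "\<xi> \<in> bdry" "word_limit x \<xi>" by blast
  have *: "(\<forall>\<^sub>F k in sequentially. prefix [h] (fst (x k))) \<longleftrightarrow> shd \<xi> = h" for h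
    using converges_to_prefix[OF \<xi>(2), of "[h]"] by simp
  have "\<forall>\<^sub>F k in sequentially. prefix [shd \<xi>] (fst (x k))" using * by blast
  then have "(\<forall>\<^sub>F k in sequentially. fst (x k) = [] \<or> hd (fst (x k)) \<in> A) \<longleftrightarrow>
      (\<forall>\<^sub>F k in sequentially. shd \<xi> \<in> A)"
    by (rule eventually_cong) (auto simp: prefix_def)
  then show ?case by (simp add: *)
qed

lemma exit_prob_eq: "exit_prob g u = (\<Sum>h\<in>nexts g. cone_prob [h] u)"
proof -
  have [measurable]: "Measurable.pred paths (\<lambda>x. \<exists>h\<in>nexts g. \<forall>\<^sub>F k in sequentially. prefix [h] (fst (x k)))"
    using finite_Next by (intro pred_intros_finite) auto
  have "exit_prob g u = path_prob u (\<lambda>x. \<exists>h\<in>nexts g. \<forall>\<^sub>F k in sequentially. prefix [h] (fst (x k)))"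
    unfolding exit_prob_def using AE_first_letter[of "nexts g" u] by (intro path_prob_cong_AE) auto
  also have "\<dots> = (\<Sum>h\<in>nexts g. cone_prob [h] u)"
    unfolding cone_prob_def
    by (rule path_prob_sum) (use prefix_single_unique in \<open>simp_all add: finite_Next\<close>)
  finally show ?thesis .
qed

lemma cone_prob_letters: "(\<Sum>s\<in>S. cone_prob [s] u) = 1"
proof -
  have [measurable]: "Measurable.pred paths (\<lambda>x. \<exists>h\<in>S. \<forall>\<^sub>F k in sequentially. prefix [h] (fst (x k)))"
    using finite_letters by (intro pred_intros_finite) auto
  have "(\<Sum>s\<in>S. cone_prob [s] u) = path_prob u (\<lambda>x. \<exists>h\<in>S. \<forall>\<^sub>F k in sequentially. prefix [h] (fst (x k)))"
    unfolding cone_prob_def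
    by (rule path_prob_sum[symmetric]) (use prefix_single_unique in \<open>simp_all add: finite_letters\<close>)
  also have "\<dots> = path_prob u (\<lambda>x. True)"
  proof (rule path_prob_cong_AE)
    have "AE x in path_law u. x \<in> space paths" using AE_space[of "path_law u"] by simp
    then show "AE x in path_law u. (\<exists>h\<in>S. \<forall>\<^sub>F k in sequentially. prefix [h] (fst (x k))) \<longleftrightarrow> True"
      using AE_first_letter[of S u]
    proof eventually_elim
      case (elim x)
      have "fst (x k) = [] \<or> hd (fst (x k)) \<in> S" for k
        using elim(1) by (cases "fst (x k)") (auto simp: space_paths reduced_Cons dest: spec[of _ k])
      then show ?case using elim(2) by simp
    qed
  qed auto
  finally show ?thesis by (simp add: path_prob_True)
qed

section \<open>Multiplicativity of first passages\<close>

lemma passage_nonneg: "0 \<le> passage w $ u $ v" "0 \<le> passage_by n w $ u $ v"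
  by (simp_all add: passage_def passage_by_def path_prob_nonneg)

lemma passage_by_le: "passage_by n w $ u $ v \<le> passage w $ u $ v"
  unfolding passage_by_def passage_def vec_lambda_beta
  by (rule path_prob_mono) (auto simp: hit_by_hit)

text \<open>
  As functions of \<open>w\<close>, the matrices \<open>passage (w @ z)\<close> and \<open>passage w ** passage z\<close> satisfy the same
  first-step equation, with the same value at the empty word. The passages within \<open>n\<close> steps are the
  iterates of this equation that start from \<open>0\<close> at non-empty words, so each of the two matrices
  bounds the iterates of the other.
\<close>

lemma passage_append_upper:
  assumes "red (w @ z)" "z \<noteq> []"
  shows "passage_by n (w @ z) $ u $ v \<le> (passage w ** passage z) $ u $ v"
  using assms(1)
proof (induction n arbitrary: w u)
  case (0 w u)
  then show ?case using passage_by_0 assms(2)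
    by (simp add: matrix_matrix_mult_def sum_nonneg passage_nonneg)
next
  case (Suc n w u)
  show ?case
  proof (cases "w = []")
    case True
    then show ?thesis by (simp add: passage_Nil passage_by_le)
  next
    case False
    have eq: "pull s (w @ z) = pull s w @ z" if "s \<in> S" for s using push_append[OF False] .
    have "passage_by (Suc n) (w @ z) $ u $ v = (\<Sum>s\<in>S. (p [s] ** passage_by n (pull s w @ z)) $ u $ v)"
      using passage_by_Suc[OF Suc.prems] False eq by simp
    also have "\<dots> \<le> (\<Sum>s\<in>S. (p [s] ** (passage (pull s w) ** passage z)) $ u $ v)"
    proof (rule sum_mono)
      fix s assume s: "s \<in> S"
      have "red (pull s w @ z)" using eq[OF s] red_push[of "linv s" "w @ z"] s Suc.prems by simp
      then show "(p [s] ** passage_by n (pull s w @ z)) $ u $ v \<le>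
          (p [s] ** (passage (pull s w) ** passage z)) $ u $ v"
        unfolding matrix_matrix_mult_def[of "p [s]"]
        using Suc.IH p_nonneg[OF s] by (auto intro!: sum_mono mult_left_mono)
    qed
    also have "\<dots> = ((\<Sum>s\<in>S. p [s] ** passage (pull s w)) ** passage z) $ u $ v"
      by (simp add: matrix_mul_assoc matrix_sum_mult)
    also have "\<dots> = (passage w ** passage z) $ u $ v"
      using passage_step[of w] Suc.prems False by (simp add: red_append)
    finally show ?thesis .
  qed
qed

lemma passage_append_lower:
  assumes "red (w @ z)" "z \<noteq> []"
  shows "(passage_by n w ** passage z) $ u $ v \<le> passage (w @ z) $ u $ v"
  using assms(1)
proof (induction n arbitrary: w u)
  case (0 w u)
  then show ?case using passage_by_0[of w] assms(2)
    by (cases "w = []") (simp_all add: passage_Nil red_append passage_nonneg)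
next
  case (Suc n w u)
  show ?case
  proof (cases "w = []")
    case True
    then show ?thesis by (simp add: passage_Nil)
  next
    case False
    have eq: "pull s (w @ z) = pull s w @ z" if "s \<in> S" for s using push_append[OF False] .
    have "(passage_by (Suc n) w ** passage z) $ u $ v =
        (\<Sum>s\<in>S. (p [s] ** (passage_by n (pull s w) ** passage z)) $ u $ v)"
      using passage_by_Suc[of w n] False Suc.prems
      by (simp add: red_append matrix_mul_assoc matrix_sum_mult)
    also have "\<dots> \<le> (\<Sum>s\<in>S. (p [s] ** passage (pull s w @ z)) $ u $ v)"
    proof (rule sum_mono)
      fix s assume s: "s \<in> S"
      have "red (pull s w @ z)" using eq[OF s] red_push[of "linv s" "w @ z"] s Suc.prems by simp
      then show "(p [s] ** (passage_by n (pull s w) ** passage z)) $ u $ v \<le>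
          (p [s] ** passage (pull s w @ z)) $ u $ v"
        unfolding matrix_matrix_mult_def[of "p [s]"]
        using Suc.IH p_nonneg[OF s] by (auto intro!: sum_mono mult_left_mono)
    qed
    also have "\<dots> = passage (w @ z) $ u $ v"
      using passage_step[OF Suc.prems] False eq by simp
    finally show ?thesis .
  qed
qed

text \<open>A path to \<open>w @ z\<close> has to pass through \<open>w\<close>, from where it needs a passage to \<open>z\<close>.\<close>

lemma passage_append:
  assumes "red (w @ z)"
  shows "passage (w @ z) = passage w ** passage z"
proof (cases "z = []")
  case False
  have "passage (w @ z) $ u $ v = (passage w ** passage z) $ u $ v" for u v
  proof (rule antisym)
    show "passage (w @ z) $ u $ v \<le> (passage w ** passage z) $ u $ v"
      by (rule LIMSEQ_le_const2[OF passage_limit]) (use passage_append_upper[OF assms False] in auto)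
    have "(\<lambda>n. (passage_by n w ** passage z) $ u $ v) \<longlonglongrightarrow> (passage w ** passage z) $ u $ v"
      unfolding matrix_matrix_mult_def
      by (simp, intro tendsto_sum tendsto_mult passage_limit tendsto_const)
    then show "(passage w ** passage z) $ u $ v \<le> passage (w @ z) $ u $ v"
      by (rule LIMSEQ_le_const2) (use passage_append_lower[OF assms False] in auto)
  qed
  then show ?thesis by (simp add: vec_eq_iff)
qed (simp add: passage_Nil)

section \<open>The limit point and the hitting times as functions of the path\<close>

text \<open>
  With the paths as sample space the walk is the coordinate process, and the limit and the hitting
  times turn into functions of the path.
\<close>

abbreviation "coord \<equiv> (\<lambda>n x. x n)"

lemma path_prob_eq_P:
  "Measurable.pred paths Q \<Longrightarrow> measure (P u) {\<omega>\<in>space (P u). Q (\<lambda>n. X n \<omega>)} = path_prob u Q"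
  unfolding path_prob_def using path_measurable[of u, THEN measurable_space]
  by (subst measure_path_law) (auto simp: pred_def intro!: arg_cong[where f="measure (P u)"])

lemma boundary_nonempty: "bdry \<noteq> {}"
proof
  assume "bdry = {}"
  then have "AE x in path_law u. False" for u using AE_converges[of u] by simp
  then show False using prob_space.AE_False[OF prob_path_law] by blast
qed

lemma X_inf_cyl_iff:
  assumes "\<exists>\<xi>\<in>bdry. word_limit x \<xi>"
  shows "X_inf d m H coord x \<in> cyl w \<longleftrightarrow> (\<forall>\<^sub>F k in sequentially. prefix w (fst (x k)))"
proof -
  obtain \<xi> where \<xi>: "\<xi> \<in> bdry" "word_limit x \<xi>" using assms by blast
  then show ?thesis
    using boundary_limit_eq[OF \<xi>] converges_to_prefix[OF \<xi>(2)] by (simp add: X_inf_def cylinder_def)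
qed

lemma X_inf_boundary: "X_inf d m H Y x \<in> bdry"
  unfolding X_inf_def by (rule boundary_limit_boundary[OF boundary_nonempty])

lemma X_inf_coord_measurable [measurable]: "X_inf d m H coord \<in> measurable paths BS"
proof (rule measurable_sigma_sets[OF sets_BS])
  show "cylinders \<subseteq> Pow bdry" by (auto simp: cylinders_def cylinder_def)
  show "X_inf d m H coord \<in> space paths \<rightarrow> bdry" by (auto intro: X_inf_boundary)
  fix A assume "A \<in> cylinders"
  then consider "A = {}" | w where "A = cyl w" by (auto simp: cylinders_def)
  then show "X_inf d m H coord -` A \<inter> space paths \<in> sets paths"
  proof cases
    case 2
    have "X_inf d m H coord x = (SOME \<xi>. \<xi> \<in> bdry)" if "\<not> (\<exists>\<xi>\<in>bdry. word_limit x \<xi>)" for x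
      using that by (simp add: X_inf_def boundary_limit_def)
    then have "X_inf d m H coord x \<in> cyl w \<longleftrightarrow>
        (if \<exists>\<xi>\<in>bdry. word_limit x \<xi> then \<forall>\<^sub>F k in sequentially. prefix w (fst (x k))
        else (SOME \<xi>. \<xi> \<in> bdry) \<in> cyl w)" for x
      by (metis X_inf_cyl_iff)
    then have "X_inf d m H coord -` A \<inter> space paths = {x\<in>space paths.
        if \<exists>\<xi>\<in>bdry. word_limit x \<xi> then \<forall>\<^sub>F k in sequentially. prefix w (fst (x k))
        else (SOME \<xi>. \<xi> \<in> bdry) \<in> cyl w}"
      by (simp add: 2 vimage_def Int_def conj_commute split del: if_split)
    also have "\<dots> \<in> sets paths" by measurable
    finally show ?thesis .
  qed simp
qed

lemma X_inf_measurable: "X_inf d m H X \<in> measurable (P u) BS"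
  using measurable_compose[OF path_measurable X_inf_coord_measurable] by (simp add: X_inf_def[abs_def])

lemma hitting_time_eq:
  "hitting_time coord w x = enat n \<longleftrightarrow> fst (x n) = w \<and> (\<forall>i<n. fst (x i) \<noteq> w)"
  "hitting_time coord w x = \<infinity> \<longleftrightarrow> (\<forall>n. fst (x n) \<noteq> w)"
proof -
  let ?N = "{n. fst (x n) = w}"
  have inf: "hitting_time coord w x = \<infinity>" if "?N = {}"
    using that by (simp add: hitting_time_def Inf_enat_def)
  have fin: "hitting_time coord w x = enat (LEAST n. fst (x n) = w)" if "n \<in> ?N" for n
    unfolding hitting_time_def
  proof (rule antisym)
    show "Inf (enat ` ?N) \<le> enat (LEAST n. fst (x n) = w)"
      using that LeastI[of "\<lambda>n. fst (x n) = w"] by (intro Inf_lower) auto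
    show "enat (LEAST n. fst (x n) = w) \<le> Inf (enat ` ?N)"
      by (intro Inf_greatest) (auto intro: Least_le)
  qed
  have least: "(LEAST n. fst (x n) = w) = n \<longleftrightarrow> fst (x n) = w \<and> (\<forall>i<n. fst (x i) \<noteq> w)" if "k \<in> ?N" for k
    using Least_nat_iff[of "\<lambda>n. fst (x n) = w" k n] that by simp
  show "hitting_time coord w x = enat n \<longleftrightarrow> fst (x n) = w \<and> (\<forall>i<n. fst (x i) \<noteq> w)"
  proof (cases "?N = {}")
    case False
    then obtain k where k: "k \<in> ?N" by blast
    show ?thesis unfolding fin[OF k] using least[OF k] by simp
  qed (use inf in auto)
  show "hitting_time coord w x = \<infinity> \<longleftrightarrow> (\<forall>n. fst (x n) \<noteq> w)"
  proof (cases "?N = {}")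
    case False
    then obtain k where k: "k \<in> ?N" by blast
    then show ?thesis unfolding fin[OF k] by auto
  qed (use inf in auto)
qed

lemma hit_at_hitting_time:
  "hit_at w v n x \<longleftrightarrow> hitting_time coord w x = enat n \<and> x n = (w, v)"
  by (auto simp: hit_at_def hitting_time_eq)

lemma hit_iff_hitting_time:
  "hit w v x \<longleftrightarrow> hitting_time coord w x \<noteq> \<infinity> \<and> x (the_enat (hitting_time coord w x)) = (w, v)"
  unfolding hit_def hit_at_hitting_time by (cases "hitting_time coord w x") auto

text \<open>
  If the hitting time is infinite, the path is read at the unspecified time \<open>the_enat \<infinity>\<close>, which is
  the same for all paths.
\<close>

lemma pred_the_hitting_time [measurable]:
  "Measurable.pred paths (\<lambda>x. Q (x (the_enat (hitting_time coord w x))))"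
proof -
  have eq: "the_enat (hitting_time coord w x) = k \<longleftrightarrow>
      (fst (x k) = w \<and> (\<forall>i<k. fst (x i) \<noteq> w)) \<or> ((\<forall>n. fst (x n) \<noteq> w) \<and> the_enat \<infinity> = k)"
    for x :: "nat \<Rightarrow> 'b letter list \<times> 'r" and k
    using hitting_time_eq(1)[of w x] hitting_time_eq(2)[of w x]
    by (cases "hitting_time coord w x") auto
  have "(\<lambda>x. Q (x (the_enat (hitting_time coord w x)))) =
      (\<lambda>x. \<exists>k. the_enat (hitting_time coord w x) = k \<and> Q (x k))"
    by simp
  then show ?thesis unfolding eq by simp
qed

lemma hitting_colour_prob:
  assumes "red w" "w \<noteq> []"
  shows "measure (P u) {\<omega>\<in>space (P u). stake (length w) (X_inf d m H X \<omega>) = w \<and>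
      hitting_colour d m H X (length w) \<omega> = v} = passage w $ u $ v * exit_prob (last w) v"
proof -
  let ?Q = "\<lambda>x. X_inf d m H coord x \<in> cyl w \<and> snd (x (the_enat (hitting_time coord w x))) = v"
  have [measurable]: "Measurable.pred paths ?Q" by measurable
  have "measure (P u) {\<omega>\<in>space (P u). stake (length w) (X_inf d m H X \<omega>) = w \<and>
      hitting_colour d m H X (length w) \<omega> = v} = measure (P u) {\<omega>\<in>space (P u). ?Q (\<lambda>n. X n \<omega>)}"
    using X_inf_boundary
    by (intro arg_cong[where f="measure (P u)"])
      (auto simp: hitting_colour_def X_inf_def cylinder_def hitting_time_def)
  also have "\<dots> = path_prob u ?Q" by (rule path_prob_eq_P) measurable
  also have "\<dots> = path_prob u (\<lambda>x. hit w v x \<and> (\<forall>\<^sub>F k in sequentially. prefix w (fst (x k))))"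
  proof (rule path_prob_cong_AE)
    show "AE x in path_law u. ?Q x \<longleftrightarrow> hit w v x \<and> (\<forall>\<^sub>F k in sequentially. prefix w (fst (x k)))"
      using AE_converges[of u] AE_cone_hit[OF assms(2), of u]
    proof eventually_elim
      case (elim x)
      show ?case using elim(2) by (auto simp: X_inf_cyl_iff[OF elim(1)] hit_iff_hitting_time)
    qed
  qed measurable
  also have "\<dots> = passage w $ u $ v * exit_prob (last w) v" by (rule hit_cone[OF assms])
  finally show ?thesis .
qed

abbreviation "\<mu> \<equiv> mu d m H P X"

lemma mu_eq:
  assumes "g \<in> S"
  shows "\<mu> g $ u $ v = passage [g] $ u $ v * exit_prob g v"
proof -
  let ?Q = "\<lambda>x. X_inf d m H coord x \<in> cyl [g] \<and> hit [g] v x"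
  have [measurable]: "Measurable.pred paths ?Q" by measurable
  have "\<mu> g $ u $ v = measure (P u) {\<omega>\<in>space (P u). ?Q (\<lambda>n. X n \<omega>)}"
    unfolding mu_def vec_lambda_beta using X_inf_boundary
    by (intro arg_cong[where f="measure (P u)"])
      (auto simp: hit_iff_hitting_time X_inf_def cylinder_def hitting_time_def)
  also have "\<dots> = path_prob u ?Q" by (rule path_prob_eq_P) measurable
  also have "\<dots> = path_prob u (\<lambda>x. hit [g] v x \<and> (\<forall>\<^sub>F k in sequentially. prefix [g] (fst (x k))))"
  proof (rule path_prob_cong_AE)
    show "AE x in path_law u. ?Q x \<longleftrightarrow> hit [g] v x \<and> (\<forall>\<^sub>F k in sequentially. prefix [g] (fst (x k)))"
      using AE_converges[of u] by eventually_elim (auto simp: X_inf_cyl_iff)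
  qed measurable
  also have "\<dots> = passage [g] $ u $ v * exit_prob g v" using hit_cone[of "[g]" u v] assms by simp
  finally show ?thesis .
qed

lemma harmonic_cyl: "measure (harmonic_measure d m H P X u) (cyl w) = cone_prob w u"
proof -
  have "measure (harmonic_measure d m H P X u) (cyl w) =
      measure (P u) {\<omega>\<in>space (P u). X_inf d m H coord (\<lambda>n. X n \<omega>) \<in> cyl w}"
    unfolding harmonic_measure_def
    by (subst measure_distr[OF X_inf_measurable]) (auto simp: X_inf_def intro!: arg_cong[where f="measure (P u)"])
  also have "\<dots> = path_prob u (\<lambda>x. X_inf d m H coord x \<in> cyl w)" by (rule path_prob_eq_P) measurable
  also have "\<dots> = cone_prob w u" unfolding cone_prob_def
    using AE_converges[of u] by (intro path_prob_cong_AE) (auto simp: X_inf_cyl_iff)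
  finally show ?thesis .
qed

lemma mu_row_sum: "g \<in> S \<Longrightarrow> (\<Sum>v\<in>UNIV. \<mu> g $ u $ v) = cone_prob [g] u"
  using cone_prob_eq[of "[g]" u] by (simp add: mu_eq)

lemma Delta_mu: "Delta d m H \<mu> g = (\<chi> u v. if u = v then exit_prob g u else 0)"
  using mu_row_sum subsetD[OF Next_subset]
  by (auto simp: Delta_def exit_prob_eq vec_eq_iff intro!: sum.cong)

lemma exit_prob_nonneg: "0 \<le> exit_prob g v"
  by (simp add: exit_prob_def path_prob_nonneg)

text \<open>
  The factor \<open>\<Delta>\<^sub>g\<close> in \<open>\<mu>\<^sub>g = passage [g] ** \<Delta>\<^sub>g\<close> is cancelled by the inverse that follows it in the
  product, and what remains is a product of passages.
\<close>

lemma cylinder_product_mu: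
  assumes "red w" "w \<noteq> []"
  shows "cylinder_product d m H \<mu> w $ u $ v = passage w $ u $ v * exit_prob (last w) v"
  using assms
proof (induction w arbitrary: u)
  case (Cons g w)
  have g: "g \<in> S" using Cons.prems by (simp add: reduced_Cons)
  show ?case
  proof (cases w)
    case Nil
    then show ?thesis using g by (simp add: mu_eq)
  next
    case (Cons h w')
    have w: "red w" "w \<noteq> []" "h \<in> nexts g" using \<open>red (g # w)\<close> Cons by (auto simp: reduced_Cons)
    have IH: "cylinder_product d m H \<mu> w $ c $ v = passage w $ c $ v * exit_prob (last w) v" for c
      using Cons.IH w by blast
    \<comment> \<open>where \<open>\<Delta>\<^sub>g\<close> vanishes, nothing is cancelled, but the factor that follows vanishes as well\<close>
    have zero: "passage w $ c $ v * exit_prob (last w) v = 0" if "exit_prob g c = 0" for c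
    proof -
      have "(\<Sum>h\<in>nexts g. cone_prob [h] c) = 0" using that by (simp add: exit_prob_eq)
      then have "cone_prob [h] c = 0"
        using w(3) finite_Next by (subst (asm) sum_nonneg_eq_0_iff) (auto simp: cone_prob_def path_prob_nonneg)
      moreover have "cone_prob w c \<le> cone_prob [h] c" unfolding cone_prob_def
        by (rule path_prob_mono) (auto simp: Cons prefix_def elim!: eventually_mono)
      moreover have "0 \<le> cone_prob w c" by (simp add: cone_prob_def path_prob_nonneg)
      ultimately have "(\<Sum>v\<in>UNIV. passage w $ c $ v * exit_prob (last w) v) = 0"
        using cone_prob_eq[OF w(1,2), of c] by simp
      then show ?thesis
        by (subst (asm) sum_nonneg_eq_0_iff) (auto simp: passage_nonneg exit_prob_nonneg)
    qed
    have "diag_inverse (Delta d m H \<mu> g) = (\<chi> u v. if u = v then inverse (exit_prob g u) else 0)"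
      by (simp add: diag_inverse_def Delta_mu vec_eq_iff)
    then have "cylinder_product d m H \<mu> (g # w) $ u $ v =
        (\<Sum>c\<in>UNIV. passage [g] $ u $ c * exit_prob g c * inverse (exit_prob g c) *
          (passage w $ c $ v * exit_prob (last w) v))"
      using IH g Cons
      by (simp add: matrix_matrix_mult_def[of "\<mu> g ** _"] diag_mult_nth mu_eq)
    also have "\<dots> = (\<Sum>c\<in>UNIV. passage [g] $ u $ c * passage w $ c $ v) * exit_prob (last w) v"
      unfolding sum_distrib_right
    proof (rule sum.cong[OF refl])
      fix c show "passage [g] $ u $ c * exit_prob g c * inverse (exit_prob g c) *
          (passage w $ c $ v * exit_prob (last w) v) = passage [g] $ u $ c * passage w $ c $ v * exit_prob (last w) v"
        using zero[of c] by (cases "exit_prob g c = 0") auto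
    qed
    also have "\<dots> = passage (g # w) $ u $ v * exit_prob (last (g # w)) v"
      using passage_append[of "[g]" w] \<open>red (g # w)\<close> w(2) by (simp add: matrix_matrix_mult_def)
    finally show ?thesis .
  qed
qed simp

section \<open>The matrix system\<close>

text \<open>
  The two sums of the system together run over all first steps \<open>s\<close> other than \<open>g\<close>: the first over
  those for which \<open>s\<inverse>g\<close> is a letter, the second, with \<open>h = s\<inverse>\<close>, over those for which it is the
  word \<open>hg\<close>.
\<close>

lemma system_sum:
  assumes g: "g \<in> S"
  shows "(\<Sum>(h, h') \<in> {(h, h'). h \<in> S \<and> h' \<in> S \<and> [h] \<otimes>\<^bsub>G\<^esub> [h'] = [g]}. p [h] ** x h')
       + (\<Sum>h\<in>nexts g. p (inv\<^bsub>G\<^esub> [h]) ** x h ** diag_inverse (Delta d m H x h) ** x g) =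
     (\<Sum>s\<in>S - {g}. p [s] ** cylinder_product d m H x (pull s [g]))"
proof -
  let ?T = "\<lambda>s. p [s] ** cylinder_product d m H x (pull s [g])"
  let ?A = "{s\<in>S - {g}. length (pull s [g]) = 1}" and ?B = "{s\<in>S - {g}. length (pull s [g]) = 2}"
  have "length (pull s [g]) = 1 \<or> length (pull s [g]) = 2" if "s \<in> S - {g}" for s
    using pull_cases[of s g] that g by (metis DiffD1 DiffD2 One_nat_def Suc_1 insertI1 length_Cons list.size(3))
  then have AB: "?A \<union> ?B = S - {g}" by auto
  have "sum ?T (?A \<union> ?B) = sum ?T ?A + sum ?T ?B"
    by (rule sum.union_disjoint) (use finite_letters in auto)
  then have "sum ?T (S - {g}) = sum ?T ?A + sum ?T ?B" unfolding AB .
  moreover have "(\<Sum>(h, h') \<in> {(h, h'). h \<in> S \<and> h' \<in> S \<and> [h] \<otimes>\<^bsub>G\<^esub> [h'] = [g]}. p [h] ** x h') = sum ?T ?A"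
  proof (rule sum.reindex_bij_witness[of _ "\<lambda>s. (s, hd (pull s [g]))" fst])
    fix a assume "a \<in> {(h, h'). h \<in> S \<and> h' \<in> S \<and> [h] \<otimes>\<^bsub>G\<^esub> [h'] = [g]}"
    then obtain h h' where a: "a = (h, h')" "h \<in> S" "h' \<in> S" "push H h [h'] = [g]" by auto
    then have eq: "pull h [g] = [h']" using pull_push[of h "[h']"] by simp
    moreover have "h \<noteq> g" using eq pull_Cons_self[of h "[]"] a by auto
    ultimately show "(fst a, hd (pull (fst a) [g])) = a" "fst a \<in> ?A"
      "?T (fst a) = (case a of (h, h') \<Rightarrow> p [h] ** x h')" using a by auto
  next
    fix s assume s: "s \<in> ?A"
    then obtain h where h: "pull s [g] = [h]" by (cases "pull s [g]") auto
    moreover have "red (pull s [g])" using s g by auto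
    ultimately have "h \<in> S" "push H s [h] = [g]" using push_pull[of s "[g]"] s g by auto
    then show "(s, hd (pull s [g])) \<in> {(h, h'). h \<in> S \<and> h' \<in> S \<and> [h] \<otimes>\<^bsub>G\<^esub> [h'] = [g]}"
      using s h by auto
  qed auto
  moreover have "(\<Sum>h\<in>nexts g. p (inv\<^bsub>G\<^esub> [h]) ** x h ** diag_inverse (Delta d m H x h) ** x g) = sum ?T ?B"
  proof (rule sum.reindex_bij_witness[of _ linv linv])
    fix h assume h: "h \<in> nexts g"
    then have hS: "h \<in> S" using Next_subset by blast
    then show "linv (linv h) = h" by simp
    have B: "linv h \<in> S" "linv h \<noteq> g" "length (pull (linv h) [g]) = 2"
      using linv_Next_iff[of "linv h" g] h hS g by auto
    then show "linv h \<in> ?B" by auto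
    have "pull (linv h) [g] = [h, g]"
      using pull_cases[OF B(1) g B(2)] B(3) hS by (metis length_Cons linv_linv list.size(3) n_not_Suc_n Suc_1 One_nat_def)
    then show "?T (linv h) = p (inv\<^bsub>G\<^esub> [h]) ** x h ** diag_inverse (Delta d m H x h) ** x g"
      using hS by (simp add: inv_letter matrix_mul_assoc)
  next
    fix s assume s: "s \<in> ?B"
    then show "linv (linv s) = s" "linv s \<in> nexts g" using linv_Next_iff[of s g] g by auto
  qed
  ultimately show ?thesis by simp
qed

lemma solves_system_iff:
  "solves_system d m H p x \<longleftrightarrow>
     (\<forall>g\<in>S. \<forall>u v. 0 \<le> x g $ u $ v) \<and> stochastic (\<Sum>g\<in>S. x g) \<and>
     (\<forall>g\<in>S. x g = p [g] ** Delta d m H x g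
        + (\<Sum>s\<in>S - {g}. p [s] ** cylinder_product d m H x (pull s [g])))"
  unfolding solves_system_def using system_sum[of _ x] by (simp add: add.assoc)

theorem mu_solves: "solves_system d m H p \<mu>"
  unfolding solves_system_iff
proof (intro conjI ballI allI)
  show "0 \<le> \<mu> g $ u $ v" if "g \<in> S" for g u v
    using that by (simp add: mu_eq passage_nonneg exit_prob_nonneg)
  then show "stochastic (\<Sum>g\<in>S. \<mu> g)"
    using cone_prob_letters mu_row_sum
    by (simp add: stochastic_def sum_nonneg sum.swap[of _ S])
next
  fix g assume g: "g \<in> S"
  have "\<mu> g $ u $ v = (p [g] ** Delta d m H \<mu> g
      + (\<Sum>s\<in>S - {g}. p [s] ** cylinder_product d m H \<mu> (pull s [g]))) $ u $ v" for u v
  proof -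
    have cp: "(p [s] ** cylinder_product d m H \<mu> (pull s [g])) $ u $ v =
        (p [s] ** passage (pull s [g])) $ u $ v * exit_prob g v" if s: "s \<in> S - {g}" for s
    proof -
      have "pull s [g] \<noteq> []" "nexts (last (pull s [g])) = nexts g" "red (pull s [g])"
        using pull_append_last[of s "[g]" "[]"] s g by auto
      then show ?thesis
        by (simp add: matrix_matrix_mult_def cylinder_product_mu exit_prob_def sum_distrib_right mult.assoc)
    qed
    have "\<mu> g $ u $ v = (\<Sum>s\<in>S. (p [s] ** passage (pull s [g])) $ u $ v) * exit_prob g v"
      using passage_step[of "[g]"] g by (simp add: mu_eq)
    also have "\<dots> = (p [g] ** passage (pull g [g])) $ u $ v * exit_prob g v
        + (\<Sum>s\<in>S - {g}. (p [s] ** passage (pull s [g])) $ u $ v * exit_prob g v)"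
      using finite_letters g by (simp add: sum.remove distrib_right sum_distrib_right)
    also have "(p [g] ** passage (pull g [g])) $ u $ v * exit_prob g v = (p [g] ** Delta d m H \<mu> g) $ u $ v"
      using g pull_Cons_self[of g "[]"] by (simp add: passage_Nil Delta_mu diag_mult_nth)
    finally show ?thesis using cp by simp
  qed
  then show "\<mu> g = p [g] ** Delta d m H \<mu> g
      + (\<Sum>s\<in>S - {g}. p [s] ** cylinder_product d m H \<mu> (pull s [g]))"
    by (simp add: vec_eq_iff)
qed

end

section \<open>Solutions of the matrix system\<close>

locale system_solution = nearest_neighbour_walk d m H p P X
  for d m :: nat and H :: "nat \<Rightarrow> 'b monoid" and p :: "'b letter list \<Rightarrow> real^'r^'r"
    and P :: "'r \<Rightarrow> 'w measure" and X :: "nat \<Rightarrow> 'w \<Rightarrow> 'b letter list \<times> 'r" +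
  fixes x :: "'b letter \<Rightarrow> real^'r^'r"
  assumes solves: "solves_system d m H p x"
begin

abbreviation cp :: "'b letter list \<Rightarrow> real^'r^'r" where "cp \<equiv> cylinder_product d m H x"

definition exit_mass :: "'b letter \<Rightarrow> 'r \<Rightarrow> real" where
  "exit_mass g u = (\<Sum>h\<in>nexts g. \<Sum>v\<in>UNIV. x h $ u $ v)"

lemma Delta_x: "Delta d m H x g = (\<chi> u v. if u = v then exit_mass g u else 0)"
  unfolding Delta_def exit_mass_def by (rule refl)

lemma diag_inverse_x:
  "diag_inverse (Delta d m H x g) = (\<chi> u v. if u = v then inverse (exit_mass g u) else 0)"
  by (simp add: diag_inverse_def Delta_x vec_eq_iff)

lemma exit_mass_cong: "nexts g = nexts h \<Longrightarrow> exit_mass g = exit_mass h"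
  by (simp add: exit_mass_def fun_eq_iff)

lemma x_nonneg: "g \<in> S \<Longrightarrow> 0 \<le> x g $ u $ v"
  using solves by (simp add: solves_system_def)

lemma x_sum: "(\<Sum>g\<in>S. \<Sum>v\<in>UNIV. x g $ u $ v) = 1"
  using solves by (simp add: solves_system_def stochastic_def sum.swap[of _ S])

lemma x_step: "g \<in> S \<Longrightarrow>
    x g = p [g] ** Delta d m H x g + (\<Sum>s\<in>S - {g}. p [s] ** cp (pull s [g]))"
  using solves by (simp add: solves_system_iff)

lemma exit_mass_nonneg: "0 \<le> exit_mass g u"
  unfolding exit_mass_def using x_nonneg subsetD[OF Next_subset] by (intro sum_nonneg) auto

lemma cp_Cons: "w \<noteq> [] \<Longrightarrow> cp (g # w) = x g ** diag_inverse (Delta d m H x g) ** cp w"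
  by (cases w) simp_all

lemma cp_nonneg: "set w \<subseteq> S \<Longrightarrow> 0 \<le> cp w $ u $ v"
proof (induction w arbitrary: u v)
  case Nil
  then show ?case by (simp add: mat_def)
next
  case (Cons g w)
  show ?case
  proof (cases "w = []")
    case True
    then show ?thesis using Cons x_nonneg by simp
  next
    case False
    show ?thesis unfolding cp_Cons[OF False] diag_inverse_x
      using Cons by (intro matrix_mult_nonneg) (auto simp: x_nonneg exit_mass_nonneg)
  qed
qed

lemma cp_append:
  "w \<noteq> [] \<Longrightarrow> z \<noteq> [] \<Longrightarrow> cp (w @ z) = cp w ** diag_inverse (Delta d m H x (last w)) ** cp z"
proof (induction w)
  case (Cons g w)
  then show ?case by (cases "w = []") (simp_all add: cp_Cons matrix_mul_assoc)
qed simp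

lemma red_letters: "red w \<Longrightarrow> set w \<subseteq> S"
  by (simp add: reduced_def)

lemma x_row_zero:
  assumes "h \<in> nexts g" "exit_mass g c = 0"
  shows "x h $ c $ v = 0"
proof -
  have S: "nexts g \<subseteq> S" by (rule Next_subset)
  have "\<forall>h\<in>nexts g. (\<Sum>v\<in>UNIV. x h $ c $ v) = 0"
    using assms(2) finite_Next S x_nonneg unfolding exit_mass_def
    by (subst (asm) sum_nonneg_eq_0_iff) (auto intro!: sum_nonneg)
  then have "(\<Sum>v\<in>UNIV. x h $ c $ v) = 0" using assms(1) by blast
  then show ?thesis using x_nonneg assms(1) S by (subst (asm) sum_nonneg_eq_0_iff) auto
qed

lemma cp_row_zero:
  assumes "w \<noteq> []" "hd w \<in> nexts g" "exit_mass g c = 0"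
  shows "cp w $ c $ v = 0"
proof -
  obtain h w' where w: "w = h # w'" using assms(1) by (cases w) auto
  have "x h $ c $ v = 0" for v using x_row_zero assms w by simp
  then show ?thesis unfolding w
    by (cases w') (simp_all add: matrix_matrix_mult_def)
qed

lemma Delta_inverse_cp:
  assumes "w \<noteq> []" "hd w \<in> nexts g"
  shows "Delta d m H x g ** diag_inverse (Delta d m H x g) ** cp w = cp w"
proof -
  have "(Delta d m H x g ** diag_inverse (Delta d m H x g) ** cp w) $ c $ v = cp w $ c $ v" for c v
    unfolding matrix_mul_assoc[symmetric] Delta_x
    using cp_row_zero[OF assms, of c v]
    by (cases "exit_mass g c = 0") (auto simp: diag_mult_nth diag_inverse_x[unfolded Delta_x])
  then show ?thesis by (simp add: vec_eq_iff)
qed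

text \<open>
  Multiply the equation for the first letter \<open>g\<close> by the rest of the product. The term \<open>p\<^sub>g \<Delta>\<^sub>g\<close>
  becomes \<open>p\<^sub>g\<close> times the rest, as the rest has vanishing rows where \<open>\<Delta>\<^sub>g\<close> vanishes. So the first
  step to \<open>g\<close> is no longer special.
\<close>

lemma cp_step:
  assumes "red w" "length w \<ge> 2"
  shows "cp w = (\<Sum>s\<in>S. p [s] ** cp (pull s w))"
proof -
  obtain g w' where w: "w = g # w'" "w' \<noteq> []" using assms(2) by (cases w; cases "tl w") auto
  have g: "g \<in> S" "hd w' \<in> nexts g" using assms(1) w by (auto simp: reduced_Cons)
  let ?D = "Delta d m H x g"
  have "cp w = (p [g] ** ?D + (\<Sum>s\<in>S - {g}. p [s] ** cp (pull s [g]))) ** (diag_inverse ?D ** cp w')"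
    unfolding w cp_Cons[OF w(2)] using x_step[OF g(1)] by (metis matrix_mul_assoc)
  also have "\<dots> = p [g] ** (?D ** diag_inverse ?D ** cp w')
      + (\<Sum>s\<in>S - {g}. p [s] ** (cp (pull s [g]) ** diag_inverse ?D ** cp w'))"
    by (simp add: matrix_add_mult matrix_sum_mult matrix_mul_assoc)
  also have "?D ** diag_inverse ?D ** cp w' = cp (pull g w)"
    using Delta_inverse_cp[OF w(2) g(2)] pull_Cons_self[of g w'] assms(1) w by simp
  also have "(\<Sum>s\<in>S - {g}. p [s] ** (cp (pull s [g]) ** diag_inverse ?D ** cp w')) =
      (\<Sum>s\<in>S - {g}. p [s] ** cp (pull s w))"
  proof (rule sum.cong[OF refl])
    fix s assume s: "s \<in> S - {g}"
    have l: "pull s ([g] @ w') = pull s [g] @ w'" "pull s [g] \<noteq> []"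
        "nexts (last (pull s [g])) = nexts g"
      using pull_append_last[of s "[g]" w'] s assms(1) w by auto
    have "diag_inverse (Delta d m H x (last (pull s [g]))) = diag_inverse ?D"
      unfolding diag_inverse_x exit_mass_cong[OF l(3)] by (rule refl)
    then show "p [s] ** (cp (pull s [g]) ** diag_inverse ?D ** cp w') = p [s] ** cp (pull s w)"
      using l(1) w(1) cp_append[OF l(2) w(2)] by simp
  qed
  also have "p [g] ** cp (pull g w) + (\<Sum>s\<in>S - {g}. p [s] ** cp (pull s w)) = (\<Sum>s\<in>S. p [s] ** cp (pull s w))"
    using finite_letters g(1) by (simp add: sum.remove)
  finally show ?thesis .
qed

section \<open>No mass is lost\<close>

definition mass :: "'b letter list \<Rightarrow> 'r \<Rightarrow> real" where
  "mass w u = (\<Sum>v\<in>UNIV. cp w $ u $ v)"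

text \<open>
  A chain of letters and colours with the cylinder weights given by \<open>cp\<close> gets stuck after \<open>w\<close> in a
  colour with vanishing outgoing mass. The defect is the mass of the chains with this fate.
\<close>

definition defect :: "'b letter list \<Rightarrow> 'r \<Rightarrow> real" where
  "defect w u = (if w = [] then 0
     else \<Sum>v\<in>UNIV. if exit_mass (last w) v = 0 then cp w $ u $ v else 0)"

definition level_mass :: "nat \<Rightarrow> 'r \<Rightarrow> real" where
  "level_mass k u = (\<Sum>w\<in>{w. red w \<and> length w = k}. mass w u)"

lemma mass_nonneg: "red w \<Longrightarrow> 0 \<le> mass w u"
  unfolding mass_def by (intro sum_nonneg cp_nonneg red_letters)

lemma defect_nonneg: "red w \<Longrightarrow> 0 \<le> defect w u"
  unfolding defect_def using cp_nonneg[OF red_letters] by (auto intro!: sum_nonneg)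

lemma mass_extend:
  assumes "w \<noteq> []"
  shows "(\<Sum>h\<in>nexts (last w). mass (w @ [h]) u) = mass w u - defect w u"
proof -
  let ?e = "exit_mass (last w)"
  have "mass (w @ [h]) u = (\<Sum>c\<in>UNIV. cp w $ u $ c * inverse (?e c) * (\<Sum>v\<in>UNIV. x h $ c $ v))" for h
  proof -
    have "cp (w @ [h]) $ u $ v = (\<Sum>c\<in>UNIV. cp w $ u $ c * inverse (?e c) * x h $ c $ v)" for v
      using cp_append[OF assms, of "[h]"]
      by (simp add: matrix_matrix_mult_def[of "cp w ** _"] diag_inverse_x diag_mult_nth)
    then show ?thesis
      by (simp add: mass_def sum_distrib_left) (rule sum.swap)
  qed
  then have "(\<Sum>h\<in>nexts (last w). mass (w @ [h]) u) =
      (\<Sum>c\<in>UNIV. cp w $ u $ c * inverse (?e c) * ?e c)"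
    by (simp add: exit_mass_def sum_distrib_left) (rule sum.swap)
  also have "\<dots> = (\<Sum>c\<in>UNIV. cp w $ u $ c - (if ?e c = 0 then cp w $ u $ c else 0))"
    by (rule sum.cong) auto
  finally show ?thesis using assms by (simp add: mass_def defect_def sum_subtractf)
qed

lemma level_mass_1: "level_mass 1 u = 1"
proof -
  have "{w. red w \<and> length w = 1} = (\<lambda>s. [s]) ` S"
    by (auto simp: length_Suc_conv)
  then have "level_mass 1 u = (\<Sum>s\<in>S. mass [s] u)"
    unfolding level_mass_def by (simp add: sum.reindex inj_on_def)
  then show ?thesis using x_sum by (simp add: mass_def)
qed

lemma level_mass_Suc:
  assumes "k \<ge> 1"
  shows "level_mass (Suc k) u = level_mass k u - (\<Sum>w\<in>{w. red w \<and> length w = k}. defect w u)"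
proof -
  have "level_mass (Suc k) u =
      (\<Sum>(w, h)\<in>(SIGMA w:{w. red w \<and> length w = k}. nexts (last w)). mass (w @ [h]) u)"
    unfolding level_mass_def
    by (subst sum.reindex_bij_betw[OF words_Suc[OF assms], symmetric]) (simp add: case_prod_beta)
  also have "\<dots> = (\<Sum>w\<in>{w. red w \<and> length w = k}. \<Sum>h\<in>nexts (last w). mass (w @ [h]) u)"
    by (rule sum.Sigma[symmetric]) (auto simp: finite_words finite_Next)
  also have "\<dots> = (\<Sum>w\<in>{w. red w \<and> length w = k}. mass w u - defect w u)"
  proof (rule sum.cong[OF refl])
    fix w assume "w \<in> {w. red w \<and> length w = k}"
    then have "w \<noteq> []" using assms by auto
    then show "(\<Sum>h\<in>nexts (last w). mass (w @ [h]) u) = mass w u - defect w u" by (rule mass_extend)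
  qed
  finally show ?thesis by (simp add: level_mass_def sum_subtractf)
qed

lemma level_mass_bounds: "k \<ge> 1 \<Longrightarrow> 0 \<le> level_mass k u \<and> level_mass k u \<le> 1"
proof (induction k rule: dec_induct)
  case base
  then show ?case using level_mass_1[of u] by simp
next
  case (step k)
  have "0 \<le> (\<Sum>w\<in>{w. red w \<and> length w = k}. defect w u)"
    by (intro sum_nonneg) (simp add: defect_nonneg)
  moreover have "0 \<le> level_mass (Suc k) u"
    unfolding level_mass_def by (intro sum_nonneg) (simp add: mass_nonneg)
  ultimately show ?case using step level_mass_Suc[of k u] by simp
qed

lemma defect_le_level:
  assumes "red w" "w \<noteq> []"
  shows "defect w u \<le> level_mass (length w) u - level_mass (Suc (length w)) u"
proof -
  have "length w \<ge> 1" using assms(2) by (cases w) auto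
  moreover have "defect w u \<le> (\<Sum>v\<in>{v. red v \<and> length v = length w}. defect v u)"
    by (rule member_le_sum) (use assms in \<open>auto simp: defect_nonneg finite_words\<close>)
  ultimately show ?thesis using level_mass_Suc[of "length w" u] by simp
qed

lemma defect_le_1: "red w \<Longrightarrow> defect w u \<le> 1"
  using defect_le_level[of w u] level_mass_bounds[of "length w" u] level_mass_bounds[of "Suc (length w)" u]
  by (cases "w = []") (auto simp: defect_def Suc_le_eq)

lemma level_mass_diff: "(\<lambda>k. level_mass k u - level_mass (Suc k) u) \<longlonglongrightarrow> 0"
proof -
  have dec: "decseq (\<lambda>k. level_mass (Suc k) u)"
  proof (rule decseq_SucI)
    fix k
    have "0 \<le> (\<Sum>w\<in>{w. red w \<and> length w = Suc k}. defect w u)"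
      by (intro sum_nonneg) (simp add: defect_nonneg)
    then show "level_mass (Suc (Suc k)) u \<le> level_mass (Suc k) u" using level_mass_Suc[of "Suc k" u] by simp
  qed
  then obtain L where "(\<lambda>k. level_mass (Suc k) u) \<longlonglongrightarrow> L"
    by (rule decseq_convergent[of _ 0]) (use level_mass_bounds in auto)
  then have L: "(\<lambda>k. level_mass k u) \<longlonglongrightarrow> L" by (rule LIMSEQ_imp_Suc)
  show ?thesis using tendsto_diff[OF L LIMSEQ_Suc[OF L]] by simp
qed

lemma defect_small:
  assumes "0 < \<epsilon>"
  shows "\<exists>K. \<forall>w u. red w \<longrightarrow> K \<le> length w \<longrightarrow> defect w u \<le> \<epsilon>"
proof -
  have "\<forall>\<^sub>F k in sequentially. \<forall>u\<in>UNIV. level_mass k u - level_mass (Suc k) u < \<epsilon>"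
    using order_tendstoD(2)[OF level_mass_diff assms] by (intro eventually_ball_finite) auto
  then obtain K where K: "\<And>k u. K \<le> k \<Longrightarrow> level_mass k u - level_mass (Suc k) u < \<epsilon>"
    by (auto simp: eventually_sequentially)
  have "defect w u \<le> \<epsilon>" if "red w" "K \<le> length w" for w u
    using defect_le_level[OF that(1)] K[OF that(2), of u] assms
    by (cases "w = []") (auto simp: defect_def intro: order_trans less_imp_le)
  then show ?thesis by blast
qed

text \<open>
  This follows from the first-step equation. For a single letter \<open>g\<close>, the first step to \<open>g\<close> enters
  through \<open>p\<^sub>g \<Delta>\<^sub>g\<close>, which vanishes in the colours that count for the defect.
\<close>

lemma defect_step:
  assumes "red w"
  shows "defect w u \<le> (\<Sum>s\<in>S. \<Sum>c\<in>UNIV. p [s] $ u $ c * defect (pull s w) c)"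
proof (cases "length w \<ge> 2")
  case True
  have w: "w \<noteq> []" "w \<noteq> [s]" for s using True by auto
  have e: "exit_mass (last (pull s w)) = exit_mass (last w)" "pull s w \<noteq> []" if "s \<in> S" for s
    using pull_append_last(2)[of s w "[]"] exit_mass_cong[OF pull_append_last(3)[of s w "[]"]] that assms w
    by auto
  have "defect w u = (\<Sum>v\<in>UNIV. if exit_mass (last w) v = 0
      then \<Sum>s\<in>S. \<Sum>c\<in>UNIV. p [s] $ u $ c * cp (pull s w) $ c $ v else 0)"
    unfolding defect_def using w(1)
    by (subst cp_step[OF assms True]) (simp add: matrix_matrix_mult_def cong: if_cong)
  also have "\<dots> = (\<Sum>v\<in>UNIV. \<Sum>s\<in>S. \<Sum>c\<in>UNIV. p [s] $ u $ c *
      (if exit_mass (last w) v = 0 then cp (pull s w) $ c $ v else 0))"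
    by (intro sum.cong) auto
  also have "\<dots> = (\<Sum>s\<in>S. \<Sum>c\<in>UNIV. \<Sum>v\<in>UNIV. p [s] $ u $ c *
      (if exit_mass (last w) v = 0 then cp (pull s w) $ c $ v else 0))"
    by (subst sum.swap) (intro sum.cong refl sum.swap)
  also have "\<dots> = (\<Sum>s\<in>S. \<Sum>c\<in>UNIV. p [s] $ u $ c * defect (pull s w) c)"
    using e by (intro sum.cong) (auto simp: defect_def sum_distrib_left)
  finally show ?thesis by simp
next
  case False
  show ?thesis
  proof (cases "w = []")
    case True
    then show ?thesis using assms p_nonneg defect_nonneg
      by (auto simp: defect_def[of "[]"] intro!: sum_nonneg mult_nonneg_nonneg)
  next
    case wn: False
    then obtain g where w: "w = [g]" using False by (cases w; cases "tl w") auto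
    have g: "g \<in> S" using assms w by simp
    let ?z = "\<lambda>v y. if exit_mass g v = 0 then y else (0::real)"
    have e: "exit_mass (last (pull s w)) = exit_mass g" "pull s w \<noteq> []" if "s \<in> S - {g}" for s
      using pull_append_last(2)[of s w "[]"] exit_mass_cong[OF pull_append_last(3)[of s w "[]"]] that assms w
    by auto
    have "defect w u = (\<Sum>v\<in>UNIV. ?z v (x g $ u $ v))" by (simp add: defect_def w cong: if_cong)
    also have "\<dots> = (\<Sum>v\<in>UNIV. ?z v (\<Sum>s\<in>S - {g}. \<Sum>c\<in>UNIV. p [s] $ u $ c * cp (pull s w) $ c $ v))"
    proof (rule sum.cong[OF refl])
      fix v
      have "x g $ u $ v = p [g] $ u $ v * exit_mass g v
          + (\<Sum>s\<in>S - {g}. \<Sum>c\<in>UNIV. p [s] $ u $ c * cp (pull s w) $ c $ v)"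
        by (subst x_step[OF g]) (simp add: Delta_x diag_mult_nth w, simp add: matrix_matrix_mult_def)
      then show "?z v (x g $ u $ v) = ?z v (\<Sum>s\<in>S - {g}. \<Sum>c\<in>UNIV. p [s] $ u $ c * cp (pull s w) $ c $ v)"
        by simp
    qed
    also have "\<dots> = (\<Sum>v\<in>UNIV. \<Sum>s\<in>S - {g}. \<Sum>c\<in>UNIV. p [s] $ u $ c * ?z v (cp (pull s w) $ c $ v))"
      by (intro sum.cong) auto
    also have "\<dots> = (\<Sum>s\<in>S - {g}. \<Sum>c\<in>UNIV. \<Sum>v\<in>UNIV. p [s] $ u $ c * ?z v (cp (pull s w) $ c $ v))"
      by (subst sum.swap) (intro sum.cong refl sum.swap)
    also have "\<dots> = (\<Sum>s\<in>S - {g}. \<Sum>c\<in>UNIV. p [s] $ u $ c * defect (pull s w) c)"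
      using e by (intro sum.cong) (auto simp: defect_def sum_distrib_left)
    also have "\<dots> \<le> (\<Sum>s\<in>S. \<Sum>c\<in>UNIV. p [s] $ u $ c * defect (pull s w) c)"
      using finite_letters assms p_nonneg defect_nonneg
      by (intro sum_mono2) (auto intro!: sum_nonneg mult_nonneg_nonneg)
    finally show ?thesis .
  qed
qed

text \<open>
  After \<open>n\<close> applications of \<open>defect_step\<close> the defect at \<open>w\<close> is bounded by the mean of the defect at
  \<open>g\<inverse>w\<close>, where \<open>g\<close> is the position of the walk at time \<open>n\<close>; if \<open>g\<inverse>w\<close> is long, its defect is small.
\<close>

lemma defect_le_far:
  assumes "red w" "0 \<le> \<epsilon>" "\<And>w u. red w \<Longrightarrow> K \<le> length w \<Longrightarrow> defect w u \<le> \<epsilon>"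
  shows "defect w u \<le> \<epsilon> + path_prob u (\<lambda>y. length (inv\<^bsub>G\<^esub> (fst (y n)) \<otimes>\<^bsub>G\<^esub> w) < K)"
  using assms(1)
proof (induction n arbitrary: u w)
  case (0 u w)
  have "path_prob u (\<lambda>y. length (inv\<^bsub>G\<^esub> (fst (y 0)) \<otimes>\<^bsub>G\<^esub> w) < K) = path_prob u (\<lambda>y. length w < K)"
    by (rule path_prob_cong_AE) (use AE_start[of u] in \<open>auto elim!: eventually_mono\<close>)
  then show ?case using defect_le_1[OF 0, of u] assms(2,3) 0
    by (cases "length w < K") (auto simp: path_prob_True path_prob_False)
next
  case (Suc n u w)
  let ?F = "\<lambda>w y. length (inv\<^bsub>G\<^esub> (fst (y n)) \<otimes>\<^bsub>G\<^esub> w) < K"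
  have "defect w u \<le> (\<Sum>s\<in>S. \<Sum>c\<in>UNIV. p [s] $ u $ c * defect (pull s w) c)"
    by (rule defect_step[OF Suc.prems])
  also have "\<dots> \<le> (\<Sum>s\<in>S. \<Sum>c\<in>UNIV. p [s] $ u $ c * (\<epsilon> + path_prob c (?F (pull s w))))"
    using Suc p_nonneg by (intro sum_mono mult_left_mono) auto
  also have "\<dots> = \<epsilon> + (\<Sum>s\<in>S. \<Sum>c\<in>UNIV. p [s] $ u $ c * path_prob c (?F (pull s w)))"
    using p_sum[of u] by (simp add: distrib_left sum.distrib sum_distrib_right[symmetric])
  also have "(\<Sum>s\<in>S. \<Sum>c\<in>UNIV. p [s] $ u $ c * path_prob c (?F (pull s w))) =
      path_prob u (\<lambda>y. length (inv\<^bsub>G\<^esub> (fst (y (Suc n))) \<otimes>\<^bsub>G\<^esub> w) < K)"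
  proof (subst one_step_pred, measurable, intro sum.cong refl arg_cong2[where f="(*)"] path_prob_cong)
    fix s c y assume s: "s \<in> S" and y: "y \<in> space paths"
    have ry: "red (fst (y n))" using y by (simp add: space_paths)
    then have iy: "red (inv\<^bsub>G\<^esub> (fst (y n)))" using G.inv_closed by simp
    have "inv\<^bsub>G\<^esub> (push H s (fst (y n))) = inv\<^bsub>G\<^esub> (fst (y n)) \<otimes>\<^bsub>G\<^esub> [linv s]"
      using G.inv_mult_group[of "[s]" "fst (y n)"] s ry by (simp add: inv_letter)
    then have "inv\<^bsub>G\<^esub> (push H s (fst (y n))) \<otimes>\<^bsub>G\<^esub> w = inv\<^bsub>G\<^esub> (fst (y n)) \<otimes>\<^bsub>G\<^esub> pull s w"
      using G.m_assoc[of "inv\<^bsub>G\<^esub> (fst (y n))" "[linv s]" w] s iy Suc.prems by simp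
    then show "?F (pull s w) y \<longleftrightarrow> length (inv\<^bsub>G\<^esub> (fst (step u s y (Suc n))) \<otimes>\<^bsub>G\<^esub> w) < K" by simp
  qed
  finally show ?case .
qed

lemma length_inv: "red w \<Longrightarrow> length (inv\<^bsub>G\<^esub> w) \<le> length w"
proof (induction w)
  case (Cons s w)
  have s: "s \<in> S" "red w" using Cons.prems by (auto simp: reduced_Cons)
  have "inv\<^bsub>G\<^esub> (s # w) = inv\<^bsub>G\<^esub> w \<otimes>\<^bsub>G\<^esub> [linv s]"
    using G.inv_mult_group[of "[s]" w] s push_Next[OF s(1) Cons.prems] by (simp add: inv_letter)
  moreover have "red (inv\<^bsub>G\<^esub> w)" using G.inv_closed s by simp
  ultimately show ?case using length_mult_le[of "inv\<^bsub>G\<^esub> w" "[linv s]"] Cons.IH s by simp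
qed simp

lemma far_limit:
  assumes "red w"
  shows "(\<lambda>n. path_prob u (\<lambda>y. length (inv\<^bsub>G\<^esub> (fst (y n)) \<otimes>\<^bsub>G\<^esub> w) < K)) \<longlonglongrightarrow> 0"
proof -
  let ?K = "K + length w"
  define Q where "Q n y \<longleftrightarrow> (\<forall>k\<ge>n. ?K \<le> length (fst (y k)))" for n and y :: "nat \<Rightarrow> 'b letter list \<times> 'r"
  have [measurable]: "Measurable.pred paths (Q n)" for n unfolding Q_def by measurable
  have "(\<lambda>n. path_prob u (Q n)) \<longlonglongrightarrow> path_prob u (\<lambda>y. \<exists>n. Q n y)"
    by (rule path_prob_incseq) (auto simp: Q_def)
  also have "path_prob u (\<lambda>y. \<exists>n. Q n y) = path_prob u (\<lambda>y. True)"
  proof (rule path_prob_cong_AE)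
    show "AE y in path_law u. (\<exists>n. Q n y) \<longleftrightarrow> True"
      using AE_converges[of u]
    proof eventually_elim
      case (elim y)
      then show ?case using converges_to_length[of "\<lambda>n. fst (y n)" _ ?K]
        by (auto simp: Q_def eventually_sequentially)
    qed
  qed auto
  finally have lim: "(\<lambda>n. 1 - path_prob u (Q n)) \<longlonglongrightarrow> 0"
    using tendsto_diff[OF tendsto_const[of 1]] by (fastforce simp: path_prob_True)
  have le: "path_prob u (\<lambda>y. length (inv\<^bsub>G\<^esub> (fst (y n)) \<otimes>\<^bsub>G\<^esub> w) < K) \<le> 1 - path_prob u (Q n)" for n
  proof -
    have "length (fst (y n)) < ?K" if y: "y \<in> space paths" "length (inv\<^bsub>G\<^esub> (fst (y n)) \<otimes>\<^bsub>G\<^esub> w) < K" for y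
    proof -
      let ?g = "fst (y n)" and ?z = "inv\<^bsub>G\<^esub> (fst (y n)) \<otimes>\<^bsub>G\<^esub> w"
      have g: "?g \<in> carrier G" using y by (simp add: space_paths)
      have w: "w \<in> carrier G" using assms by simp
      have z: "?z \<in> carrier G" using g w by (intro G.m_closed G.inv_closed)
      have "inv\<^bsub>G\<^esub> ?z = inv\<^bsub>G\<^esub> w \<otimes>\<^bsub>G\<^esub> ?g"
        using g w G.inv_mult_group[of "inv\<^bsub>G\<^esub> ?g" w] G.inv_closed[OF g] G.inv_inv[OF g] by metis
      then have "w \<otimes>\<^bsub>G\<^esub> inv\<^bsub>G\<^esub> ?z = ?g"
        using g w G.m_assoc[of w "inv\<^bsub>G\<^esub> w" ?g] G.r_inv[OF w] G.l_one[OF g] G.inv_closed[OF w] by metis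
      then have "length ?g \<le> length w + length (inv\<^bsub>G\<^esub> ?z)"
        using length_mult_le[of w "inv\<^bsub>G\<^esub> ?z"] assms G.inv_closed[OF z] by simp
      also have "\<dots> \<le> length w + length ?z" using length_inv[of ?z] z by simp
      finally show ?thesis using y(2) by simp
    qed
    then have "path_prob u (\<lambda>y. length (inv\<^bsub>G\<^esub> (fst (y n)) \<otimes>\<^bsub>G\<^esub> w) < K) \<le> path_prob u (\<lambda>y. \<not> Q n y)"
      by (intro path_prob_mono) (auto simp: Q_def not_le)
    moreover have "path_prob u (\<lambda>y. \<not> Q n y) = 1 - path_prob u (Q n)"
      unfolding path_prob_def using prob_space.prob_neg[OF prob_path_law[of u], of "Q n"] by simp
    ultimately show ?thesis by simp
  qed
  show ?thesis
    by (rule tendsto_sandwich[OF _ _ tendsto_const lim]) (auto simp: path_prob_nonneg le)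
qed

text \<open>
  The defect is a bounded subharmonic function which vanishes at infinity, and the walk goes to
  infinity.
\<close>

lemma defect_zero:
  assumes "red w"
  shows "defect w u = 0"
proof (rule antisym[OF field_le_epsilon defect_nonneg[OF assms]])
  fix \<epsilon> :: real assume \<epsilon>: "0 < \<epsilon>"
  obtain K where K: "\<And>w u. red w \<Longrightarrow> K \<le> length w \<Longrightarrow> defect w u \<le> \<epsilon>"
    using defect_small[OF \<epsilon>] by blast
  have "(\<lambda>n. \<epsilon> + path_prob u (\<lambda>y. length (inv\<^bsub>G\<^esub> (fst (y n)) \<otimes>\<^bsub>G\<^esub> w) < K)) \<longlonglongrightarrow> \<epsilon> + 0"
    by (intro tendsto_add tendsto_const far_limit[OF assms])
  then have "defect w u \<le> \<epsilon> + 0"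
    by (rule LIMSEQ_le_const) (use defect_le_far[OF assms less_imp_le[OF \<epsilon>] K] in auto)
  then show "defect w u \<le> 0 + \<epsilon>" by simp
qed

lemma x_column_zero:
  assumes "g \<in> S" "exit_mass g v = 0"
  shows "x g $ u $ v = 0"
proof -
  have "(\<Sum>v\<in>UNIV. if exit_mass g v = 0 then x g $ u $ v else 0) = 0"
    using defect_zero[of "[g]" u] assms(1) by (simp add: defect_def cong: if_cong)
  then have "\<forall>v\<in>UNIV. (if exit_mass g v = 0 then x g $ u $ v else 0) = 0"
    using x_nonneg[OF assms(1)] by (subst (asm) sum_nonneg_eq_0_iff) auto
  then show ?thesis using assms(2) by (metis UNIV_I)
qed

section \<open>The measure on the boundary\<close>

fun followers :: "'b letter option \<Rightarrow> 'b letter set" where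
  "followers None = S"
| "followers (Some g) = nexts g"

definition out_mass :: "'b letter option \<Rightarrow> 'r \<Rightarrow> real" where
  "out_mass a u = (\<Sum>h\<in>followers a. \<Sum>v\<in>UNIV. x h $ u $ v)"

lemma out_mass_simps: "out_mass None u = 1" "out_mass (Some g) u = exit_mass g u"
  using x_sum by (simp_all add: out_mass_def exit_mass_def)

lemma finite_followers: "finite (followers a)" and followers_subset: "followers a \<subseteq> S"
  using finite_Next finite_letters Next_subset by (cases a; simp)+

lemma followers_nonempty: "followers a \<noteq> {}"
proof -
  obtain \<xi> where \<xi>: "\<xi> \<in> bdry" using boundary_nonempty by blast
  define g h where "g = \<xi> !! 0" and "h = \<xi> !! 1"
  have gh: "g \<in> S" "h \<in> S" "h \<in> nexts g"
    using \<xi> unfolding boundary_def g_def h_def by (auto dest: spec[of _ 0] spec[of _ 1])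
  have "nexts k \<noteq> {}" for k
  proof (cases k)
    case (Gen i)
    have "g \<in> nexts k \<or> h \<in> nexts k \<or> Gen i \<in> nexts k" using Gen gh by (cases g) auto
    then show ?thesis by blast
  next
    case (GenInv i)
    have "g \<in> nexts k \<or> h \<in> nexts k \<or> GenInv i \<in> nexts k" using GenInv gh by (cases g) auto
    then show ?thesis by blast
  next
    case (Elt j y)
    have "g \<in> nexts k \<or> h \<in> nexts k" using Elt gh by (cases g; cases h) auto
    then show ?thesis by blast
  qed
  then show ?thesis using gh by (cases a) auto
qed

text \<open>
  The family \<open>transition\<close> is the Markov kernel of the chain of letters and colours whose cylinder
  weights are the matrix products. Where the outgoing mass vanishes it is arbitrary.
\<close>

definition transition :: "'b letter option \<times> 'r \<Rightarrow> ('b letter \<times> 'r) pmf" where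
  "transition s = (SOME q. set_pmf q \<subseteq> followers (fst s) \<times> UNIV \<and>
     (out_mass (fst s) (snd s) \<noteq> 0 \<longrightarrow> (\<forall>h\<in>followers (fst s). \<forall>v.
        pmf q (h, v) = x h $ snd s $ v / out_mass (fst s) (snd s))))"

lemma transition:
  "set_pmf (transition (a, u)) \<subseteq> followers a \<times> UNIV"
  "out_mass a u \<noteq> 0 \<Longrightarrow> h \<in> followers a \<Longrightarrow>
     pmf (transition (a, u)) (h, v) = x h $ u $ v / out_mass a u"
proof -
  have "\<exists>q. set_pmf q \<subseteq> followers a \<times> UNIV \<and>
     (out_mass a u \<noteq> 0 \<longrightarrow> (\<forall>h\<in>followers a. \<forall>v. pmf q (h, v) = x h $ u $ v / out_mass a u))"
  proof (cases "out_mass a u = 0")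
    case True
    obtain h where "h \<in> followers a" using followers_nonempty by blast
    then show ?thesis using True by (intro exI[of _ "return_pmf (h, u)"]) auto
  next
    case False
    have nn: "0 \<le> x h $ u $ v" if "h \<in> followers a" for h v
      using x_nonneg subsetD[OF followers_subset that] by (simp add: that x_nonneg subsetD[OF followers_subset])
    then have "0 \<le> out_mass a u" unfolding out_mass_def by (intro sum_nonneg) auto
    moreover have "(\<Sum>(h, v)\<in>followers a \<times> UNIV. x h $ u $ v / out_mass a u) = 1"
      using False by (simp add: sum.cartesian_product[symmetric] sum_divide_distrib[symmetric] out_mass_def[symmetric])
    ultimately have "\<exists>q. set_pmf q \<subseteq> followers a \<times> UNIV \<and>
        (\<forall>b\<in>followers a \<times> UNIV. pmf q b = (case b of (h, v) \<Rightarrow> x h $ u $ v / out_mass a u))"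
      using nn finite_followers by (intro finite_pmf_exists) auto
    then show ?thesis by auto
  qed
  from someI_ex[OF this] show "set_pmf (transition (a, u)) \<subseteq> followers a \<times> UNIV"
    "out_mass a u \<noteq> 0 \<Longrightarrow> h \<in> followers a \<Longrightarrow>
       pmf (transition (a, u)) (h, v) = x h $ u $ v / out_mass a u"
    by (simp_all add: transition_def)
qed

text \<open>
  The chain is driven by independent random functions, one for each step, whose value at a state is
  the next letter and colour. Forbidden values, which have probability \<open>0\<close>, are replaced by permitted
  ones, so that every input yields a point of the boundary.
\<close>

definition random_map :: "('b letter option \<times> 'r \<Rightarrow> 'b letter \<times> 'r) pmf" where
  "random_map = Pi_pmf (insert None (Some ` S) \<times> UNIV) undefined transition"

definition move ::
    "'b letter option \<times> 'r \<Rightarrow> ('b letter option \<times> 'r \<Rightarrow> 'b letter \<times> 'r) \<Rightarrow> 'b letter \<times> 'r" where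
  "move s f = (if fst (f s) \<in> followers (fst s) then f s else (SOME h. h \<in> followers (fst s), snd s))"

abbreviation "noise \<equiv> stream_space (measure_pmf random_map)"

lemma move_followers: "fst (move s f) \<in> followers (fst s)"
  using followers_nonempty by (simp add: move_def some_in_eq)

lemma driven_word_boundary: "driven_word move s \<omega> \<in> bdry"
proof -
  have "driven_word move s \<omega> !! n \<in> S \<and>
      driven_word move s \<omega> !! Suc n \<in> nexts (driven_word move s \<omega> !! n)" for n
  proof (induction n arbitrary: s \<omega>)
    case 0
    show ?case using move_followers[of s "shd \<omega>"] subsetD[OF followers_subset]
        move_followers[of "apfst Some (move s (shd \<omega>))" "shd (stl \<omega>)"] by auto
  qed simp
  then show ?thesis by (simp add: boundary_def)
qed

lemma move_measurable [measurable]: "(\<lambda>\<omega>. move s (shd \<omega>)) \<in> measurable noise (count_space UNIV)"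
  by (rule measurable_compose[OF measurable_shd]) simp

lemma driven_word_measurable: "driven_word move s \<in> measurable noise BS"
proof -
  have "(\<lambda>\<omega>. driven_word move s \<omega> !! n) \<in> measurable noise (count_space UNIV)" for n
  proof (induction n arbitrary: s)
    case 0
    show ?case using measurable_compose[OF move_measurable, of fst "count_space UNIV"] by simp
  next
    case (Suc n)
    let ?I = "followers (fst s) \<times> (UNIV :: 'r set)"
    have "(\<lambda>\<omega>. driven_word move (apfst Some (move s (shd \<omega>))) (stl \<omega>) !! n) \<in> measurable noise (count_space UNIV)"
    proof (rule measurable_compose_countable'[where I="?I" and f="\<lambda>i \<omega>. driven_word move (apfst Some i) (stl \<omega>) !! n"])
      show "(\<lambda>\<omega>. driven_word move (apfst Some i) (stl \<omega>) !! n) \<in> measurable noise (count_space UNIV)" for i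
        by (rule measurable_compose[OF measurable_stl Suc])
      show "(\<lambda>\<omega>. move s (shd \<omega>)) \<in> measurable noise (count_space ?I)"
      proof (rule measurable_compose[OF measurable_shd])
        show "move s \<in> measurable (measure_pmf random_map) (count_space ?I)"
          using move_followers[of s] by (auto simp: mem_Times_iff)
      qed
      show "countable ?I" by (intro countable_finite finite_cartesian_product finite_followers) simp
    qed
    then show ?case by simp
  qed
  then show ?thesis unfolding boundary_space_def
    using driven_word_boundary by (intro measurable_restrict_space2 measurable_stream_space2) auto
qed

lemma prob_noise: "prob_space noise"
  by (rule prob_space.prob_space_stream_space[OF measure_pmf.prob_space_axioms])

definition prefix_prob :: "'b letter option \<times> 'r \<Rightarrow> 'b letter list \<Rightarrow> real" where
  "prefix_prob s w = measure noise {\<omega>\<in>space noise. stake (length w) (driven_word move s \<omega>) = w}"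

lemma prefix_pred [measurable]:
  "Measurable.pred noise (\<lambda>\<omega>. stake (length w) (driven_word move s \<omega>) = w)"
proof -
  have "{\<omega>\<in>space noise. stake (length w) (driven_word move s \<omega>) = w} =
      driven_word move s -` cyl w \<inter> space noise"
    using driven_word_boundary by (auto simp: cylinder_def)
  then show ?thesis using measurable_sets[OF driven_word_measurable cyl_sets] by (simp add: pred_def)
qed

lemma prefix_prob_Nil: "prefix_prob s [] = 1"
  using prob_space.prob_space[OF prob_noise] by (simp add: prefix_prob_def)

lemma prefix_prob_Cons:
  assumes a: "a \<in> insert None (Some ` S)" and h: "h \<in> followers a"
  shows "prefix_prob (a, u) (h # w) =
    (\<Sum>c\<in>UNIV. pmf (transition (a, u)) (h, c) * prefix_prob (Some h, c) w)"
proof -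
  let ?s = "(a, u)"
  define F where "F b = (if fst b = h then prefix_prob (Some h, snd b) w else 0)" for b :: "'b letter \<times> 'r"
  have space: "space noise = UNIV" by (simp add: space_stream_space)
  have inner: "measure noise {\<omega>\<in>space noise. stake (length (h # w)) (driven_word move ?s (f ## \<omega>)) = h # w} =
      F (move ?s f)" for f
  proof (cases "fst (move ?s f) = h")
    case True
    then have "apfst Some (move ?s f) = (Some h, snd (move ?s f))" by (simp add: prod_eq_iff)
    then show ?thesis using True by (simp add: F_def prefix_prob_def space)
  qed (simp add: F_def)
  have "ennreal (prefix_prob ?s (h # w)) = (\<integral>\<^sup>+f. ennreal (F (move ?s f)) \<partial>measure_pmf random_map)"
    unfolding prefix_prob_def
    by (subst prob_space.prob_stream_space[OF measure_pmf.prob_space_axioms prefix_pred[unfolded pred_def]]) (simp only: inner)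
  also have "\<dots> = (\<integral>\<^sup>+f. ennreal (F (f ?s)) \<partial>measure_pmf random_map)"
  proof (rule nn_integral_cong_AE, unfold AE_measure_pmf_iff, rule ballI)
    fix f assume "f \<in> set_pmf random_map"
    then have "f ?s \<in> set_pmf (map_pmf (\<lambda>f. f ?s) random_map)" by simp
    also have "map_pmf (\<lambda>f. f ?s) random_map = transition ?s"
      unfolding random_map_def using a finite_letters by (subst Pi_pmf_component) auto
    finally have "fst (f ?s) \<in> followers a" using transition(1)[of a u] by auto
    then show "ennreal (F (move ?s f)) = ennreal (F (f ?s))" by (simp add: move_def)
  qed
  also have "\<dots> = (\<integral>\<^sup>+b. ennreal (F b) \<partial>measure_pmf (map_pmf (\<lambda>f. f ?s) random_map))" by simp
  also have "map_pmf (\<lambda>f. f ?s) random_map = transition ?s"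
    unfolding random_map_def using a finite_letters by (subst Pi_pmf_component) auto
  also have "(\<integral>\<^sup>+b. ennreal (F b) \<partial>measure_pmf (transition ?s)) =
      (\<Sum>b\<in>{h} \<times> UNIV. ennreal (F b) * ennreal (pmf (transition ?s) b))"
    by (rule nn_integral_measure_pmf_support) (auto simp: F_def)
  also have "\<dots> = (\<Sum>b\<in>{h} \<times> UNIV. ennreal (F b * pmf (transition ?s) b))"
    by (simp add: ennreal_mult F_def prefix_prob_def)
  also have "\<dots> = ennreal (\<Sum>b\<in>{h} \<times> UNIV. F b * pmf (transition ?s) b)"
    by (rule sum_ennreal) (simp add: F_def prefix_prob_def)
  also have "(\<Sum>b\<in>{h} \<times> UNIV. F b * pmf (transition ?s) b) =
      (\<Sum>c\<in>UNIV. pmf (transition ?s) (h, c) * prefix_prob (Some h, c) w)"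
  proof -
    have "{h} \<times> (UNIV :: 'r set) = Pair h ` UNIV" by auto
    then show ?thesis by (simp add: sum.reindex inj_on_def F_def mult.commute)
  qed
  finally show ?thesis
    by (subst (asm) ennreal_inj) (auto simp: prefix_prob_def intro!: sum_nonneg)
qed

lemma prefix_prob_mass:
  assumes "red w" "w \<noteq> []" "hd w \<in> followers a" "a \<in> insert None (Some ` S)" "out_mass a u \<noteq> 0"
  shows "prefix_prob (a, u) w = mass w u / out_mass a u"
  using assms
proof (induction w arbitrary: a u)
  case (Cons h w)
  have h: "h \<in> followers a" "h \<in> S" using Cons.prems by (auto simp: reduced_Cons)
  have "prefix_prob (a, u) (h # w) = (\<Sum>c\<in>UNIV. x h $ u $ c / out_mass a u * prefix_prob (Some h, c) w)"
    using prefix_prob_Cons[OF Cons.prems(4) h(1)] transition(2)[OF Cons.prems(5) h(1)] by simp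
  also have "\<dots> = mass (h # w) u / out_mass a u"
  proof (cases "w = []")
    case True
    then show ?thesis by (simp add: prefix_prob_Nil mass_def sum_divide_distrib)
  next
    case False
    have w: "red w" "hd w \<in> nexts h" using Cons.prems False by (auto simp: reduced_Cons)
    have xp: "x h $ u $ c * prefix_prob (Some h, c) w = x h $ u $ c * inverse (exit_mass h c) * mass w c" for c
    proof (cases "exit_mass h c = 0")
      case True
      then show ?thesis using x_column_zero[OF h(2)] by simp
    next
      case nz: False
      then have "prefix_prob (Some h, c) w = mass w c / exit_mass h c"
        using Cons.IH[of "Some h" c] w False h by (simp add: out_mass_simps)
      then show ?thesis by (simp add: field_simps)
    qed
    have xm: "mass (h # w) u = (\<Sum>c\<in>UNIV. x h $ u $ c * inverse (exit_mass h c) * mass w c)"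
    proof -
      have "cp (h # w) $ u $ v = (\<Sum>c\<in>UNIV. x h $ u $ c * inverse (exit_mass h c) * cp w $ c $ v)" for v
        unfolding cp_Cons[OF False]
        by (simp add: matrix_matrix_mult_def[of "x h ** _"] diag_inverse_x diag_mult_nth)
      then show ?thesis by (simp add: mass_def sum_distrib_left) (rule sum.swap)
    qed
    have "(\<Sum>c\<in>UNIV. x h $ u $ c / out_mass a u * prefix_prob (Some h, c) w) =
        (\<Sum>c\<in>UNIV. x h $ u $ c * prefix_prob (Some h, c) w) / out_mass a u"
      by (simp add: sum_divide_distrib)
    then show ?thesis by (simp only: xp xm)
  qed
  finally show ?case .
qed simp

definition boundary_measure :: "'r \<Rightarrow> 'b letter stream measure" where
  "boundary_measure u = distr noise BS (driven_word move (None, u))"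

lemma prob_boundary_measure: "prob_space (boundary_measure u)"
  unfolding boundary_measure_def by (rule prob_space.prob_space_distr[OF prob_noise driven_word_measurable])

lemma sets_boundary_measure [measurable_cong, simp]: "sets (boundary_measure u) = sets BS"
  by (simp add: boundary_measure_def)

lemma space_boundary_measure [simp]: "space (boundary_measure u) = bdry"
  by (simp add: boundary_measure_def space_BS)

lemma boundary_measure_cyl:
  assumes "red w" "w \<noteq> []"
  shows "measure (boundary_measure u) (cyl w) = mass w u"
proof -
  have "measure (boundary_measure u) (cyl w) = prefix_prob (None, u) w"
    unfolding boundary_measure_def prefix_prob_def
    by (subst measure_distr[OF driven_word_measurable cyl_sets])
      (use driven_word_boundary in \<open>auto simp: cylinder_def intro!: arg_cong[where f="measure noise"]\<close>)
  also have "\<dots> = mass w u"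
    using prefix_prob_mass[of w None u] assms by (cases w) (auto simp: out_mass_simps reduced_Cons)
  finally show ?thesis .
qed

lemma boundary_measure_stationary_cyl:
  assumes w: "red w"
  shows "measure (boundary_measure u) (cyl w) = (\<Sum>s\<in>S. \<Sum>c\<in>UNIV.
    p [s] $ u $ c * measure (boundary_measure c) {\<zeta>\<in>bdry. act H [s] \<zeta> \<in> cyl w})"
proof -
  have one: "measure (boundary_measure c) bdry = 1" for c
    using prob_space.prob_space[OF prob_boundary_measure[of c]] by simp
  have shifted: "measure (boundary_measure c) {\<zeta>\<in>bdry. act H [s] \<zeta> \<in> cyl w} = mass (pull s w) c"
    if "s \<in> S" "w \<noteq> []" "w \<noteq> [s]" for s c
    using that w by (simp add: vimage_act_cyl boundary_measure_cyl pull_eq_Nil_iff)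
  consider "w = []" | g where "w = [g]" | "length w \<ge> 2" by (cases w; cases "tl w") auto
  then show ?thesis
  proof cases
    case 1
    have "{\<zeta>\<in>bdry. act H [s] \<zeta> \<in> bdry} = bdry" if "s \<in> S" for s
      using act_boundary[OF that] by auto
    then show ?thesis using p_sum[of u] one 1 by (simp add: cyl_Nil cong: sum.cong)
  next
    case (2 g)
    have g: "g \<in> S" using w 2 by simp
    have self: "measure (boundary_measure c) {\<zeta>\<in>bdry. act H [g] \<zeta> \<in> cyl w} = exit_mass g c" for c
    proof -
      interpret B: prob_space "boundary_measure c" by (rule prob_boundary_measure)
      have "measure (boundary_measure c) (\<Union>h\<in>nexts g. cyl [h]) = (\<Sum>h\<in>nexts g. measure (boundary_measure c) (cyl [h]))"
      proof (rule B.finite_measure_finite_Union)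
        show "disjoint_family_on (\<lambda>h. cyl [h]) (nexts g)"
          by (auto simp: disjoint_family_on_def cylinder_def)
      qed (use finite_Next cyl_sets in auto)
      also have "\<dots> = exit_mass g c"
        unfolding exit_mass_def using subsetD[OF Next_subset]
        by (intro sum.cong) (auto simp: boundary_measure_cyl mass_def)
      finally show ?thesis using 2 g by (simp add: vimage_act_cyl)
    qed
    have "measure (boundary_measure u) (cyl w) = (\<Sum>v\<in>UNIV. x g $ u $ v)"
      using boundary_measure_cyl[OF w] 2 by (simp add: mass_def)
    also have "\<dots> = (\<Sum>v\<in>UNIV. p [g] $ u $ v * exit_mass g v)
        + (\<Sum>v\<in>UNIV. \<Sum>s\<in>S - {g}. \<Sum>c\<in>UNIV. p [s] $ u $ c * cp (pull s w) $ c $ v)"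
      by (subst x_step[OF g]) (simp add: Delta_x diag_mult_nth 2 sum.distrib, simp add: matrix_matrix_mult_def)
    also have "(\<Sum>v\<in>UNIV. \<Sum>s\<in>S - {g}. \<Sum>c\<in>UNIV. p [s] $ u $ c * cp (pull s w) $ c $ v) =
        (\<Sum>s\<in>S - {g}. \<Sum>c\<in>UNIV. \<Sum>v\<in>UNIV. p [s] $ u $ c * cp (pull s w) $ c $ v)"
      by (subst sum.swap) (intro sum.cong refl sum.swap)
    also have "\<dots> = (\<Sum>s\<in>S - {g}. \<Sum>c\<in>UNIV. p [s] $ u $ c *
        measure (boundary_measure c) {\<zeta>\<in>bdry. act H [s] \<zeta> \<in> cyl w})"
      using shifted 2 by (intro sum.cong) (auto simp: mass_def sum_distrib_left)
    finally show ?thesis using self finite_letters g by (simp add: sum.remove)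
  next
    case 3
    then have ne: "w \<noteq> []" "w \<noteq> [s]" for s by auto
    have "measure (boundary_measure u) (cyl w) = (\<Sum>v\<in>UNIV. \<Sum>s\<in>S. \<Sum>c\<in>UNIV. p [s] $ u $ c * cp (pull s w) $ c $ v)"
      unfolding boundary_measure_cyl[OF w ne(1)] mass_def
      by (subst cp_step[OF w 3]) (simp add: matrix_matrix_mult_def)
    also have "\<dots> = (\<Sum>s\<in>S. \<Sum>c\<in>UNIV. \<Sum>v\<in>UNIV. p [s] $ u $ c * cp (pull s w) $ c $ v)"
      by (subst sum.swap) (intro sum.cong refl sum.swap)
    finally show ?thesis using shifted ne by (simp add: mass_def sum_distrib_left)
  qed
qed

theorem boundary_measure_stationary: "stationary_family d m H p boundary_measure"
proof -
  have act_sets: "{\<zeta>\<in>bdry. act H [s] \<zeta> \<in> A} \<in> sets BS" if "s \<in> S" "A \<in> sets BS" for s A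
    using measurable_sets[OF act_measurable[OF that(1)] that(2)]
    by (simp add: space_BS vimage_def Int_def conj_commute)
  have "measure (boundary_measure u) A = (\<Sum>s\<in>S. \<Sum>c\<in>UNIV.
      p [s] $ u $ c * measure (boundary_measure c) {\<zeta>\<in>bdry. act H [s] \<zeta> \<in> A})"
    if "A \<in> sets BS" for u A
  proof -
    have "cylinders \<subseteq> Pow bdry" by (auto simp: cylinders_def cylinder_def)
    from Int_stable_cylinders this that[unfolded sets_BS] show ?thesis
    proof (induction rule: sigma_sets_induct_disjoint)
      case (basic A)
      then show ?case using boundary_measure_stationary_cyl by (auto simp: cylinders_def)
    next
      case empty
      show ?case by simp
    next
      case (compl A)
      have A: "A \<in> sets BS" using compl(1) by (simp add: sets_BS)
      have pr: "measure (boundary_measure c) (bdry - B) = 1 - measure (boundary_measure c) B" if "B \<in> sets BS" for B c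
        using prob_space.prob_compl[OF prob_boundary_measure[of c], of B] that by simp
      have "{\<zeta>\<in>bdry. act H [s] \<zeta> \<in> bdry - A} = bdry - {\<zeta>\<in>bdry. act H [s] \<zeta> \<in> A}" if "s \<in> S" for s
        using act_boundary[OF that] by auto
      then have "measure (boundary_measure c) {\<zeta>\<in>bdry. act H [s] \<zeta> \<in> bdry - A} =
          1 - measure (boundary_measure c) {\<zeta>\<in>bdry. act H [s] \<zeta> \<in> A}" if "s \<in> S" for s c
        using pr[OF act_sets[OF that A]] that by simp
      then show ?case using p_sum[of u] compl(2) pr[OF A]
        by (simp add: right_diff_distrib sum_subtractf cong: sum.cong)
    next
      case (union A)
      have A: "A i \<in> sets BS" for i using union(2) by (auto simp: sets_BS)
      interpret B: prob_space "boundary_measure c" for c by (rule prob_boundary_measure)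
      have "(\<lambda>i. measure (boundary_measure u) (A i)) sums measure (boundary_measure u) (\<Union> (range A))"
        by (rule B.finite_measure_UNION) (use A union(1) in auto)
      moreover have "(\<lambda>i. measure (boundary_measure c) {\<zeta>\<in>bdry. act H [s] \<zeta> \<in> A i}) sums
          measure (boundary_measure c) {\<zeta>\<in>bdry. act H [s] \<zeta> \<in> \<Union> (range A)}" if s: "s \<in> S" for s c
      proof -
        let ?B = "\<lambda>i. {\<zeta>\<in>bdry. act H [s] \<zeta> \<in> A i}"
        have "range ?B \<subseteq> sets (boundary_measure c)" using act_sets[OF s A] by auto
        moreover have "disjoint_family ?B" using union(1) unfolding disjoint_family_on_def by blast
        moreover have "\<Union> (range ?B) = {\<zeta>\<in>bdry. act H [s] \<zeta> \<in> \<Union> (range A)}" by auto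
        ultimately show ?thesis using B.finite_measure_UNION[of ?B c] by simp
      qed
      then have "(\<lambda>i. \<Sum>s\<in>S. \<Sum>c\<in>UNIV. p [s] $ u $ c * measure (boundary_measure c) {\<zeta>\<in>bdry. act H [s] \<zeta> \<in> A i}) sums
          (\<Sum>s\<in>S. \<Sum>c\<in>UNIV. p [s] $ u $ c * measure (boundary_measure c) {\<zeta>\<in>bdry. act H [s] \<zeta> \<in> \<Union> (range A)})"
        by (intro sums_sum sums_mult)
      ultimately show ?case using union(3) sums_unique2 by simp
    qed
  qed
  moreover have "(\<Sum>g\<in>supp G p. \<Sum>v\<in>UNIV. p g $ u $ v * measure (distr (boundary_measure v) BS (act H g)) A) =
      (\<Sum>s\<in>S. \<Sum>c\<in>UNIV. p [s] $ u $ c * measure (boundary_measure c) {\<zeta>\<in>bdry. act H [s] \<zeta> \<in> A})"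
    if A: "A \<in> sets BS" for u A
  proof -
    have "measure (distr (boundary_measure c) BS (act H [s])) A =
        measure (boundary_measure c) {\<zeta>\<in>bdry. act H [s] \<zeta> \<in> A}" if s: "s \<in> S" for s c
      using act_measurable[OF s] A
      by (subst measure_distr) (auto simp: vimage_def Int_def conj_commute)
    then show ?thesis by (subst sum_supp) auto
  qed
  ultimately show ?thesis
    unfolding stationary_family_def using prob_boundary_measure by simp
qed

section \<open>Uniqueness of the solution\<close>

text \<open>
  The left-hand sides are the iterates from \<open>0\<close> of the monotone system in which \<open>\<Delta>\<close> is kept fixed, and
  \<open>cp\<close> is a fixed point.
\<close>

lemma passage_by_le_cp:
  assumes "red w" "w \<noteq> []"
  shows "passage_by n w $ u $ v * exit_mass (last w) v \<le> cp w $ u $ v"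
  using assms
proof (induction n arbitrary: w u)
  case (0 w u)
  then show ?case using passage_by_0 cp_nonneg[OF red_letters] by simp
next
  case (Suc n w u)
  have step: "(p [s] ** passage_by n (pull s w)) $ u $ v * exit_mass (last w) v \<le> (p [s] ** cp (pull s w)) $ u $ v"
    if s: "s \<in> S" "w \<noteq> [s]" for s
  proof -
    have "pull s w \<noteq> []" "red (pull s w)" "exit_mass (last (pull s w)) = exit_mass (last w)"
      using pull_append_last(2)[of s w "[]"] exit_mass_cong[OF pull_append_last(3)[of s w "[]"]] s Suc.prems
      by auto
    then have "passage_by n (pull s w) $ c $ v * exit_mass (last w) v \<le> cp (pull s w) $ c $ v" for c
      using Suc.IH[of "pull s w" c] by simp
    then show ?thesis
      by (auto simp: matrix_matrix_mult_def sum_distrib_right mult.assoc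
        intro!: sum_mono mult_left_mono p_nonneg s)
  qed
  have eq: "passage_by (Suc n) w $ u $ v * exit_mass (last w) v =
      (\<Sum>s\<in>S. (p [s] ** passage_by n (pull s w)) $ u $ v * exit_mass (last w) v)"
    using passage_by_Suc[OF Suc.prems] by (simp add: sum_distrib_right)
  show ?case
  proof (cases "length w \<ge> 2")
    case True
    then have "w \<noteq> [s]" for s by auto
    then have "passage_by (Suc n) w $ u $ v * exit_mass (last w) v \<le> (\<Sum>s\<in>S. (p [s] ** cp (pull s w)) $ u $ v)"
      unfolding eq using step by (intro sum_mono) auto
    also have "\<dots> = cp w $ u $ v" by (subst cp_step[OF Suc.prems(1) True]) simp
    finally show ?thesis .
  next
    case False
    then obtain g where w: "w = [g]" using Suc.prems by (cases w; cases "tl w") auto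
    then have g: "g \<in> S" using Suc.prems by simp
    have "passage_by (Suc n) w $ u $ v * exit_mass (last w) v =
        p [g] $ u $ v * exit_mass g v
        + (\<Sum>s\<in>S - {g}. (p [s] ** passage_by n (pull s w)) $ u $ v * exit_mass (last w) v)"
      unfolding eq using finite_letters g w pull_Cons_self[of g "[]"] by (simp add: sum.remove passage_Nil)
    also have "\<dots> \<le> p [g] $ u $ v * exit_mass g v + (\<Sum>s\<in>S - {g}. (p [s] ** cp (pull s w)) $ u $ v)"
      using step w by (intro add_left_mono sum_mono) auto
    also have "\<dots> = cp w $ u $ v"
    proof -
      have "cp w $ u $ v = x g $ u $ v" by (simp add: w)
      also have "\<dots> = p [g] $ u $ v * exit_mass g v + (\<Sum>s\<in>S - {g}. (p [s] ** cp (pull s w)) $ u $ v)"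
        by (subst x_step[OF g]) (simp add: w Delta_x diag_mult_nth)
      finally show ?thesis by simp
    qed
    finally show ?thesis .
  qed
qed

text \<open>
  Both \<open>x\<close> and \<open>\<mu>\<close> have the row sums given by the harmonic measure, and \<open>\<mu>\<close> is the smallest
  solution with these row sums.
\<close>

theorem solution_unique:
  assumes unique: "\<And>\<nu>. stationary_family d m H p \<nu> \<Longrightarrow> \<nu> = harmonic_measure d m H P X"
    and g: "g \<in> S"
  shows "x g = \<mu> g"
proof -
  have "boundary_measure = harmonic_measure d m H P X"
    by (rule unique[OF boundary_measure_stationary])
  then have row: "(\<Sum>v\<in>UNIV. x h $ u $ v) = cone_prob [h] u" if "h \<in> S" for h u
    using boundary_measure_cyl[of "[h]" u] harmonic_cyl[of u "[h]"] that by (simp add: mass_def)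
  then have exit: "exit_mass h u = exit_prob h u" for h u
    unfolding exit_mass_def exit_prob_eq using subsetD[OF Next_subset] by (intro sum.cong) auto
  have le: "\<mu> g $ u $ v \<le> x g $ u $ v" for u v
  proof -
    have "(\<lambda>n. passage_by n [g] $ u $ v * exit_mass g v) \<longlonglongrightarrow> passage [g] $ u $ v * exit_mass g v"
      by (intro tendsto_mult passage_limit tendsto_const)
    then have "passage [g] $ u $ v * exit_mass g v \<le> x g $ u $ v"
      by (rule LIMSEQ_le_const2) (use passage_by_le_cp[of "[g]"] g in auto)
    then show ?thesis using g by (simp add: mu_eq exit)
  qed
  have "x g $ u $ v = \<mu> g $ u $ v" for u v
  proof -
    have "(\<Sum>v\<in>UNIV. x g $ u $ v - \<mu> g $ u $ v) = 0"
      using row[OF g] mu_row_sum[OF g] by (simp add: sum_subtractf)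
    then have "\<forall>v\<in>UNIV. x g $ u $ v - \<mu> g $ u $ v = 0"
      using le by (subst (asm) sum_nonneg_eq_0_iff) auto
    then show ?thesis by simp
  qed
  then show ?thesis by (simp add: vec_eq_iff)
qed

end

section \<open>The cylinder formulas and the matrices \<open>\<mu>\<^sub>g\<close>\<close>

lemma axis_matrix_axis: "axis u 1 \<bullet> (A *v axis v 1) = A $ u $ v" for A :: "real^'r^'r"
  by (simp add: inner_axis' matrix_vector_mult_basis column_def)

lemma axis_matrix_ones: "axis u 1 \<bullet> (A *v 1) = (\<Sum>v\<in>UNIV. A $ u $ v)" for A :: "real^'r^'r"
  by (simp add: inner_axis' matrix_vector_mult_def)

theorem mainTheorem2:
  fixes d m :: nat
    and H :: "nat \<Rightarrow> 'b monoid"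
    and p :: "'b letter list \<Rightarrow> real^'r^'r"
    and P :: "'r \<Rightarrow> 'w measure"
    and X :: "nat \<Rightarrow> 'w \<Rightarrow> 'b letter list \<times> 'r"
  assumes factors: "\<And>j. j \<in> {1..m} \<Longrightarrow> group (H j) \<and> finite (carrier (H j))"
    and not_Z: "\<not> free_product d m H \<cong> integer_group"
    and not_D_inf: "\<not> free_product d m H \<cong> free_product 0 2 (\<lambda>_. integer_mod_group 2)"
    and walk: "coloured_walk (free_product d m H) p"
    and nearest: "nearest_neighbour d m H p"
    and quasi_irred: "quasi_irreducible (free_product d m H) p"
    and law: "\<And>u. walk_law (free_product d m H) p (P u) X (\<one>\<^bsub>free_product d m H\<^esub>, u)"
    and converges: "\<And>u. AE \<omega> in P u. \<exists>\<xi>\<in>boundary d m H. converges_to (\<lambda>n. fst (X n \<omega>)) \<xi>"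
    and unique_stationary:
      "\<And>\<nu>. stationary_family d m H p \<nu> \<Longrightarrow> \<nu> = harmonic_measure d m H P X"
  shows
    "(\<forall>u. \<forall>n\<ge>1. \<forall>v. \<forall>\<xi>. length \<xi> = n \<and> reduced d m H \<xi> \<longrightarrow>
        measure (P u) {\<omega> \<in> space (P u).
            stake n (X_inf d m H X \<omega>) = \<xi> \<and> hitting_colour d m H X n \<omega> = v} =
          axis u 1 \<bullet> (cylinder_product d m H (mu d m H P X) \<xi> *v axis v 1)) \<and>
     (\<forall>u. \<forall>n\<ge>1. \<forall>\<xi>. length \<xi> = n \<and> reduced d m H \<xi> \<longrightarrow>
        measure (harmonic_measure d m H P X u) (cylinder d m H \<xi>) =
          axis u 1 \<bullet> (cylinder_product d m H (mu d m H P X) \<xi> *v vec 1)) \<and>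
     solves_system d m H p (mu d m H P X) \<and>
     (\<forall>x. solves_system d m H p x \<longrightarrow> (\<forall>g\<in>letters d m H. x g = mu d m H P X g))"
proof -
  interpret nearest_neighbour_walk d m H p P X
    using factors walk nearest law converges
    by unfold_locales (auto simp: free_product_def)
  have cyl: "measure (harmonic_measure d m H P X u) (cylinder d m H \<xi>) =
      (\<Sum>v\<in>UNIV. cylinder_product d m H (mu d m H P X) \<xi> $ u $ v)"
    if "reduced d m H \<xi>" "\<xi> \<noteq> []" for u \<xi>
    using that by (simp add: harmonic_cyl cone_prob_eq cylinder_product_mu)
  have "x g = mu d m H P X g" if "solves_system d m H p x" "g \<in> letters d m H" for x g
  proof -
    interpret system_solution d m H p P X x by unfold_locales (rule that)
    show ?thesis using unique_stationary that(2) by (rule solution_unique)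
  qed
  moreover have "\<xi> \<noteq> []" if "length \<xi> = n" "1 \<le> n" for \<xi> :: "'b letter list" and n
    using that by auto
  ultimately show ?thesis
    using cyl hitting_colour_prob mu_solves
    by (auto simp: axis_matrix_axis axis_matrix_ones cylinder_product_mu)
qed

end
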